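(* Let $M$ be an almost complex surface in the nearly Kähler $S^3\times S^3$, given in isothermal coordinates $(u,v)$ by $\phi(u,v)=(p(u,v),q(u,v))$ with $J(p_u,q_u)=(p_v,q_v)$. Put $\alpha=p^{-1}p_u$, $\beta=p^{-1}p_v$ and $$\tilde\alpha=-\tfrac12\alpha+\tfrac{\sqrt3}{2}\beta,\qquad \tilde\beta=-\tfrac{\sqrt3}{2}\alpha-\tfrac12\beta .$$ Then the form $\tilde\alpha\,du+\tilde\beta\,dv$ is closed. Hence, if $M$ is simply connected, there exists an immersion $\epsilon\colon M\to\mathbb R^3$ with $\epsilon_u=\tilde\alpha$ and $\epsilon_v=\tilde\beta$, and $\epsilon$ satisfies the $H$-surface equation of Wente $$\epsilon_{uu}+\epsilon_{vv}=-\frac{4}{\sqrt3}\,\epsilon_u\times\epsilon_v .$$ This process may be reversed: there is, locally at least, a correspondence between almost complex surfaces in the nearly Kähler $S^3\times S^3$ and solutions of this $H$-surface equation. When $(u,v)$ are isothermal coordinates for $\epsilon$, the image of $\epsilon$ is a surface in $\mathbb R^3$ with constant mean curvature $H=-2/\sqrt3$.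
   Context: $S^3$ is the group of unit quaternions, and $T_{(p,q)}(S^3\times S^3)$ is identified with $T_pS^3\times T_qS^3$. The almost complex structure $J$ on $S^3\times S^3$ is $J(U,V)=\frac{1}{\sqrt3}\bigl(2pq^{-1}V-U,\,-2qp^{-1}U+V\bigr)$ for $(U,V)\in T_{(p,q)}(S^3\times S^3)$ (quaternion multiplication). The nearly Kähler metric is $g(X,Y)=\frac12\bigl(\langle X,Y\rangle+\langle JX,JY\rangle\bigr)$, where $\langle\cdot,\cdot\rangle$ is the standard product metric on $S^3\times S^3$. The nearly Kähler $S^3\times S^3$ is $(S^3\times S^3,g,J)$. An almost complex surface is a smooth surface whose tangent bundle is $J$-invariant. The maps $p^{-1}p_u$ and $p^{-1}p_v$ take values in the imaginary quaternions, identified with $\mathbb R^3$ in the usual way, and "$\times$" is the vector cross product on $\mathbb R^3$. Subscripts $u,v$ denote partial derivatives.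
   Formalization: ε need not be an immersion (p=exp(iu), q=exp(i(u/2−√3v/2)) gives parallel ε_u, ε_v), so the formal statement asserts a smooth ε with the stated derivatives and the H-surface equation, and that ε is an immersion at a point exactly when p is. *)

theory Defs
  imports "HOL-Analysis.Analysis"
begin

text \<open>Calculus on open sets. For finite-dimensional domains \<open>smooth_on\<close> is the usual
  \<open>C\<^sup>\<infinity>\<close>; it is only meaningful for open \<open>S\<close>.\<close>

primrec Ck_on ::
  "nat \<Rightarrow> ('a::real_normed_vector \<Rightarrow> 'b::real_normed_vector) \<Rightarrow> 'a set \<Rightarrow> bool" where
  "Ck_on 0 f S \<longleftrightarrow> continuous_on S f"
| "Ck_on (Suc k) f S \<longleftrightarrow>
     (\<forall>x\<in>S. f differentiable (at x)) \<and>
     (\<forall>v. Ck_on k (\<lambda>x. frechet_derivative f (at x) v) S)"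

definition smooth_on :: "'a::real_normed_vector set \<Rightarrow> ('a \<Rightarrow> 'b::real_normed_vector) \<Rightarrow> bool" where
  "smooth_on S f \<longleftrightarrow> (\<forall>k. Ck_on k f S)"

type_synonym plane = "real \<times> real"

definition du :: "(plane \<Rightarrow> 'b::real_normed_vector) \<Rightarrow> plane \<Rightarrow> 'b" where
  "du f z = vector_derivative (\<lambda>u. f (u, snd z)) (at (fst z))"

definition dv :: "(plane \<Rightarrow> 'b::real_normed_vector) \<Rightarrow> plane \<Rightarrow> 'b" where
  "dv f z = vector_derivative (\<lambda>v. f (fst z, v)) (at (snd z))"

definition immersed_at :: "('a::real_normed_vector \<Rightarrow> 'b::real_normed_vector) \<Rightarrow> 'a \<Rightarrow> bool" where
  "immersed_at f z \<longleftrightarrow> f differentiable (at z) \<and> inj (frechet_derivative f (at z))"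

definition closed_form :: "plane set \<Rightarrow> (plane \<Rightarrow> real^3) \<Rightarrow> (plane \<Rightarrow> real^3) \<Rightarrow> bool" where
  "closed_form D a b \<longleftrightarrow> smooth_on D a \<and> smooth_on D b \<and> (\<forall>z\<in>D. dv a z = du b z)"


text \<open>Quaternions as pairs of real part and imaginary part, so that \<open>snd\<close> is the
  identification of the imaginary quaternions with \<open>real^3\<close>.  The inner product and the norm
  are those of the product space, i.e. the standard ones on the 4-dimensional space.\<close>

type_synonym quat = "real \<times> (real^3)"

definition qmul :: "quat \<Rightarrow> quat \<Rightarrow> quat" (infixl "\<otimes>" 75) where
  "x \<otimes> y = (fst x * fst y - snd x \<bullet> snd y,
            fst x *\<^sub>R snd y + fst y *\<^sub>R snd x + cross3 (snd x) (snd y))"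

definition qinv :: "quat \<Rightarrow> quat" where
  "qinv x = (1 / (norm x)\<^sup>2) *\<^sub>R (fst x, - snd x)"

definition S3 :: "quat set" where
  "S3 = sphere 0 1"


text \<open>The almost complex structure and the nearly Kaehler metric; \<open>J\<close> and \<open>nk_metric\<close>
  take the base point \<open>(p, q)\<close> as first argument, and are meant for tangent vectors there.\<close>

definition J :: "quat \<times> quat \<Rightarrow> quat \<times> quat \<Rightarrow> quat \<times> quat" where
  "J = (\<lambda>(p, q) (U, V). (1 / sqrt 3) *\<^sub>R
          (2 *\<^sub>R (p \<otimes> qinv q \<otimes> V) - U, - (2 *\<^sub>R (q \<otimes> qinv p \<otimes> U)) + V))"

definition nk_metric :: "quat \<times> quat \<Rightarrow> quat \<times> quat \<Rightarrow> quat \<times> quat \<Rightarrow> real" where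
  "nk_metric x X Y = 1 / 2 * (X \<bullet> Y + J x X \<bullet> J x Y)"


text \<open>Smooth surfaces. A chart is a pair of its domain and its coordinate map.\<close>

type_synonym 'm chart = "'m set \<times> ('m \<Rightarrow> plane)"

definition coord_dom :: "'m chart \<Rightarrow> plane set" where
  "coord_dom c = snd c ` fst c"

definition in_coords :: "'m chart \<Rightarrow> ('m \<Rightarrow> 'b) \<Rightarrow> plane \<Rightarrow> 'b" where
  "in_coords c f = f \<circ> inv_into (fst c) (snd c)"

definition smooth_surface :: "'m::topological_space set \<Rightarrow> 'm chart set \<Rightarrow> bool" where
  "smooth_surface M A \<longleftrightarrow>
     Hausdorff_space (top_of_set M) \<and> second_countable (top_of_set M) \<and>
     (\<Union>c\<in>A. fst c) = M \<and>
     (\<forall>c\<in>A. openin (top_of_set M) (fst c) \<and> open (coord_dom c) \<and>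
        homeomorphism (fst c) (coord_dom c) (snd c) (inv_into (fst c) (snd c))) \<and>
     (\<forall>c\<in>A. \<forall>c'\<in>A. smooth_on (snd c ` (fst c \<inter> fst c')) (in_coords c (snd c')))"

definition smooth_map :: "'m chart set \<Rightarrow> ('m \<Rightarrow> 'b::real_normed_vector) \<Rightarrow> bool" where
  "smooth_map A f \<longleftrightarrow> (\<forall>c\<in>A. smooth_on (coord_dom c) (in_coords c f))"


text \<open>Almost complex surfaces: immersions into \<open>S3 \<times> S3\<close> with \<open>J\<close>-invariant tangent planes,
  first for a parametrisation by a plane domain, then for a surface with an atlas.\<close>

definition almost_complex_patch :: "plane set \<Rightarrow> (plane \<Rightarrow> quat \<times> quat) \<Rightarrow> bool" where
  "almost_complex_patch D \<phi> \<longleftrightarrow>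
     smooth_on D \<phi> \<and> \<phi> ` D \<subseteq> S3 \<times> S3 \<and> (\<forall>z\<in>D. immersed_at \<phi> z) \<and>
     (\<forall>z\<in>D. J (\<phi> z) ` range (frechet_derivative \<phi> (at z)) \<subseteq> range (frechet_derivative \<phi> (at z)))"

definition almost_complex_surface ::
  "'m::topological_space set \<Rightarrow> 'm chart set \<Rightarrow> ('m \<Rightarrow> quat \<times> quat) \<Rightarrow> bool" where
  "almost_complex_surface M A \<phi> \<longleftrightarrow> smooth_surface M A \<and>
     (\<forall>c\<in>A. almost_complex_patch (coord_dom c) (in_coords c \<phi>))"

definition J_holomorphic :: "plane set \<Rightarrow> (plane \<Rightarrow> quat \<times> quat) \<Rightarrow> bool" where
  "J_holomorphic D \<phi> \<longleftrightarrow> smooth_on D \<phi> \<and> \<phi> ` D \<subseteq> S3 \<times> S3 \<and> (\<forall>z\<in>D. J (\<phi> z) (du \<phi> z) = dv \<phi> z)"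

definition isothermal_coords :: "plane set \<Rightarrow> (plane \<Rightarrow> quat \<times> quat) \<Rightarrow> bool" where
  "isothermal_coords D \<phi> \<longleftrightarrow> (\<forall>z\<in>D.
     nk_metric (\<phi> z) (du \<phi> z) (du \<phi> z) = nk_metric (\<phi> z) (dv \<phi> z) (dv \<phi> z) \<and>
     nk_metric (\<phi> z) (du \<phi> z) (dv \<phi> z) = 0 \<and>
     J (\<phi> z) (du \<phi> z) = dv \<phi> z)"

definition alpha :: "(plane \<Rightarrow> quat \<times> quat) \<Rightarrow> plane \<Rightarrow> real^3" where
  "alpha \<phi> z = snd (qinv (fst (\<phi> z)) \<otimes> du (\<lambda>w. fst (\<phi> w)) z)"

definition beta :: "(plane \<Rightarrow> quat \<times> quat) \<Rightarrow> plane \<Rightarrow> real^3" where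
  "beta \<phi> z = snd (qinv (fst (\<phi> z)) \<otimes> dv (\<lambda>w. fst (\<phi> w)) z)"

definition alpha_tilde :: "(plane \<Rightarrow> quat \<times> quat) \<Rightarrow> plane \<Rightarrow> real^3" where
  "alpha_tilde \<phi> z = (- 1 / 2) *\<^sub>R alpha \<phi> z + (sqrt 3 / 2) *\<^sub>R beta \<phi> z"

definition beta_tilde :: "(plane \<Rightarrow> quat \<times> quat) \<Rightarrow> plane \<Rightarrow> real^3" where
  "beta_tilde \<phi> z = (- sqrt 3 / 2) *\<^sub>R alpha \<phi> z - (1 / 2) *\<^sub>R beta \<phi> z"

text \<open>A map \<open>\<epsilon>\<close> with \<open>associated D \<phi> \<epsilon>\<close> is an immersion exactly where \<open>p = fst \<circ> \<phi>\<close> is one, which is not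
  automatic: with \<open>i = (0, axis 1 1)\<close>, the flat torus \<open>p = exp (i u)\<close>,
  \<open>q = exp (i (u / 2 - sqrt 3 v / 2))\<close> is almost complex and \<open>(u, v)\<close> are isothermal, but
  \<open>\<alpha> = i\<close>, \<open>\<beta> = 0\<close>, so that \<open>\<epsilon>\<close> takes values in a line.\<close>

definition associated :: "plane set \<Rightarrow> (plane \<Rightarrow> quat \<times> quat) \<Rightarrow> (plane \<Rightarrow> real^3) \<Rightarrow> bool" where
  "associated D \<phi> \<epsilon> \<longleftrightarrow> (\<forall>z\<in>D. du \<epsilon> z = alpha_tilde \<phi> z \<and> dv \<epsilon> z = beta_tilde \<phi> z)"

definition H_surface :: "plane set \<Rightarrow> (plane \<Rightarrow> real^3) \<Rightarrow> bool" where
  "H_surface D \<epsilon> \<longleftrightarrow> smooth_on D \<epsilon> \<and>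
     (\<forall>z\<in>D. du (du \<epsilon>) z + dv (dv \<epsilon>) z = (- 4 / sqrt 3) *\<^sub>R cross3 (du \<epsilon> z) (dv \<epsilon> z))"


text \<open>Surfaces in Euclidean 3-space.\<close>

definition isothermal_coords_R3 :: "plane set \<Rightarrow> (plane \<Rightarrow> real^3) \<Rightarrow> bool" where
  "isothermal_coords_R3 D \<epsilon> \<longleftrightarrow> (\<forall>z\<in>D. du \<epsilon> z \<bullet> du \<epsilon> z = dv \<epsilon> z \<bullet> dv \<epsilon> z \<and>
     du \<epsilon> z \<bullet> du \<epsilon> z > 0 \<and> du \<epsilon> z \<bullet> dv \<epsilon> z = 0)"

definition unit_normal :: "(plane \<Rightarrow> real^3) \<Rightarrow> plane \<Rightarrow> real^3" where
  "unit_normal \<epsilon> z = sgn (cross3 (du \<epsilon> z) (dv \<epsilon> z))"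

definition mean_curvature :: "(plane \<Rightarrow> real^3) \<Rightarrow> plane \<Rightarrow> real" where
  "mean_curvature \<epsilon> z =
     (let E = du \<epsilon> z \<bullet> du \<epsilon> z; F = du \<epsilon> z \<bullet> dv \<epsilon> z; G = dv \<epsilon> z \<bullet> dv \<epsilon> z;
          N = unit_normal \<epsilon> z;
          e = du (du \<epsilon>) z \<bullet> N; f = dv (du \<epsilon>) z \<bullet> N; g = dv (dv \<epsilon>) z \<bullet> N
      in (E * g - 2 * F * f + G * e) / (2 * (E * G - F\<^sup>2)))"

end

theory Submission
  imports Defs
begin

text \<open>Write \<open>\<alpha>, \<beta>\<close> for the components of \<open>p\<^sup>-\<^sup>1dp\<close> and \<open>\<gamma>, \<delta>\<close> for those of \<open>q\<^sup>-\<^sup>1dq\<close>. In the left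
  trivialisation of the tangent bundle of \<open>S3 \<times> S3\<close> the structure \<open>J\<close> has constant coefficients, so that
  \<open>J (p_u, q_u) = (p_v, q_v)\<close> is the pair of linear relations
  \<open>\<beta> = (2\<gamma> - \<alpha>) / sqrt 3\<close> and \<open>\<delta> = (\<gamma> - 2\<alpha>) / sqrt 3\<close> (\<open>J_du_eq_dv_iff\<close>). They give two expressions
  for the form of the theorem (\<open>tilde_components\<close>):
  \<open>\<alpha>~ = \<gamma> - \<alpha>, \<beta>~ = \<delta> - \<beta>\<close>, and also \<open>\<alpha>~ = (\<beta> + \<delta>) / sqrt 3, \<beta>~ = - (\<alpha> + \<gamma>) / sqrt 3\<close>.
  The Maurer--Cartan equations \<open>\<alpha>_v - \<beta>_u = 2 \<alpha> \<times> \<beta>\<close> and \<open>\<gamma>_v - \<delta>_u = 2 \<gamma> \<times> \<delta>\<close>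
  express equality of the mixed partial derivatives of \<open>p\<close> and \<open>q\<close>, and the linear relations make
  their right-hand sides equal. Subtracting the two equations therefore yields closedness, by the first
  expression, and adding them yields the H-surface equation, by the second
  (\<open>tilde_form_integrability\<close>).

  Conversely \<open>\<alpha>, \<beta>, \<gamma>, \<delta>\<close> are linear in \<open>\<alpha>~, \<beta>~\<close>. If these are the partial derivatives of an
  H-surface, both Maurer--Cartan equations hold, and on a disc they can be integrated
  (\<open>Maurer_Cartan_integrable\<close>), uniquely up to left translations (\<open>Maurer_Cartan_unique\<close>). The
  integration solves a linear differential equation along every ray from the centre; the structure
  equation is what makes the derivative of the solution with respect to the end point of the ray
  the prescribed one (\<open>radial_expansion\<close>).

  For the global primitive, the first expression shows that the form is the pull-back of a form
  \<open>q\<^sup>-\<^sup>1dq - p\<^sup>-\<^sup>1dp\<close> on \<open>S3 \<times> S3\<close> and so does not depend on the chart (\<open>tilde_form_pullback\<close>). Its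
  primitives on small discs differ by constants where they overlap, and they can be continued along
  paths. The continuation extends over rectangles, hence depends on the homotopy class of the path
  only, and on a simply connected surface it gives one global function (\<open>global_primitive\<close>).

  Finally, in isothermal coordinates the mean curvature is \<open>(\<epsilon>_uu + \<epsilon>_vv) \<bullet> N / (2 E)\<close>, and
  \<open>\<epsilon>_u \<times> \<epsilon>_v = E N\<close>.\<close>

section \<open>Quaternions\<close>

text \<open>Reduces a quaternion identity to four polynomial identities.\<close>

lemma quat_eqI: "x = y" if "fst x = fst y" "snd x $ 1 = snd y $ 1" "snd x $ 2 = snd y $ 2" "snd x $ 3 = snd y $ 3"
  for x y :: quat
  using that by (simp add: prod_eq_iff vec_eq_iff forall_3)

lemma bounded_bilinear_qmul: "bounded_bilinear (\<otimes>)"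
  unfolding bilinear_conv_bounded_bilinear[symmetric] bilinear_def linear_iff
  by (intro conjI allI quat_eqI; simp add: qmul_def cross3_simps)

interpretation qm: bounded_bilinear "(\<otimes>)"
  by (rule bounded_bilinear_qmul)

lemma qmul_assoc: "(x \<otimes> y) \<otimes> z = x \<otimes> (y \<otimes> z)"
  by (rule quat_eqI; simp add: qmul_def cross3_simps)

lemma qmul_one [simp]: "(1, 0) \<otimes> x = x" "x \<otimes> (1, 0) = x"
  by (simp_all add: qmul_def)

definition qcnj :: "quat \<Rightarrow> quat" where
  "qcnj x = (fst x, - snd x)"

lemma bounded_linear_qcnj: "bounded_linear qcnj"
  unfolding linear_conv_bounded_linear[symmetric] linear_iff by (simp add: qcnj_def)

lemma qcnj_qmul: "qcnj (x \<otimes> y) = qcnj y \<otimes> qcnj x"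
  by (rule quat_eqI; simp add: qmul_def qcnj_def cross3_simps)

lemma norm_quat: "(norm x)\<^sup>2 = fst x * fst x + snd x \<bullet> snd x" for x :: quat
  by (simp add: power2_norm_eq_inner inner_prod_def)

lemma qmul_qcnj: "x \<otimes> qcnj x = ((norm x)\<^sup>2, 0)" "qcnj x \<otimes> x = ((norm x)\<^sup>2, 0)"
  unfolding norm_quat by (rule quat_eqI; simp add: qmul_def qcnj_def cross3_simps)+

lemma norm_qcnj [simp]: "norm (qcnj x) = norm x"
  by (simp add: qcnj_def norm_prod_def)

lemma norm_qmul: "norm (x \<otimes> y) = norm x * norm y"
proof -
  have "(norm (x \<otimes> y))\<^sup>2 = (norm x * norm y)\<^sup>2"
    unfolding power_mult_distrib norm_quat
    by (simp add: qmul_def cross3_simps)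
  then show ?thesis by simp
qed

lemma S3_iff: "x \<in> S3 \<longleftrightarrow> norm x = 1"
  by (simp add: S3_def)

lemma qinv_S3: "norm x = 1 \<Longrightarrow> qinv x = qcnj x"
  by (simp add: qinv_def qcnj_def)

lemma qcancel [simp]:
  assumes "norm x = 1"
  shows "x \<otimes> qcnj x = (1, 0)" "qcnj x \<otimes> x = (1, 0)"
    "x \<otimes> (qcnj x \<otimes> y) = y" "qcnj x \<otimes> (x \<otimes> y) = y"
proof -
  show 1: "x \<otimes> qcnj x = (1, 0)" "qcnj x \<otimes> x = (1, 0)"
    using assms by (simp_all add: qmul_qcnj)
  show "x \<otimes> (qcnj x \<otimes> y) = y" "qcnj x \<otimes> (x \<otimes> y) = y"
    by (simp_all add: qmul_assoc[symmetric] 1)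
qed

section \<open>Smooth functions on open subsets of the plane\<close>

lemma Ck_on_cong:
  assumes "open S" "\<And>x. x \<in> S \<Longrightarrow> f x = g x" "Ck_on k f S"
  shows "Ck_on k g S"
  using assms(2,3)
proof (induction k arbitrary: f g)
  case 0
  then show ?case by (simp cong: continuous_on_cong_simp)
next
  case (Suc k)
  have d: "g differentiable (at x)" "frechet_derivative g (at x) = frechet_derivative f (at x)"
    if "x \<in> S" for x
  proof -
    have "(f has_derivative frechet_derivative f (at x)) (at x)"
      using Suc.prems(2) that frechet_derivative_works by auto
    then have "(g has_derivative frechet_derivative f (at x)) (at x)"
      using assms(1) Suc.prems(1) that by (metis has_derivative_transform_within_open)
    then show "g differentiable (at x)" "frechet_derivative g (at x) = frechet_derivative f (at x)"
      by (auto simp: differentiable_def frechet_derivative_at[symmetric])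
  qed
  have "Ck_on k (\<lambda>x. frechet_derivative g (at x) v) S" for v
    by (rule Suc.IH[where f = "\<lambda>x. frechet_derivative f (at x) v"]) (use d Suc.prems in auto)
  then show ?case using d by simp
qed

text \<open>The definition of \<open>C\<^sup>k\<^sup>+\<^sup>1\<close> does not mention \<open>C\<^sup>k\<close>; the inclusion needs that differentiable
  functions are continuous.\<close>

lemma Ck_on_SucD: "Ck_on (Suc k) f S \<Longrightarrow> Ck_on k f S"
proof (induction k arbitrary: f)
  case 0
  then show ?case
    by (auto intro!: continuous_at_imp_continuous_on differentiable_imp_continuous_within)
next
  case (Suc k)
  have "Ck_on (Suc k) (\<lambda>x. frechet_derivative f (at x) v) S" for v
    using Suc.prems by simp
  then have "Ck_on k (\<lambda>x. frechet_derivative f (at x) v) S" for v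
    by (rule Suc.IH)
  then show ?case using Suc.prems by auto
qed

lemma Ck_on_Suc_derivativeI:
  assumes "open S" "\<And>x. x \<in> S \<Longrightarrow> (f has_derivative f' x) (at x)"
    "\<And>v. Ck_on k (\<lambda>x. f' x v) S"
  shows "Ck_on (Suc k) f S"
proof -
  have "Ck_on k (\<lambda>x. frechet_derivative f (at x) v) S" for v
    by (rule Ck_on_cong[OF assms(1) _ assms(3)]) (simp add: frechet_derivative_at[OF assms(2), symmetric])
  then show ?thesis using assms(2) by (auto simp: differentiable_def)
qed

lemma Ck_on_derivative:
  assumes "Ck_on (Suc k) f S" "x \<in> S"
  shows "(f has_derivative frechet_derivative f (at x)) (at x)"
  using assms frechet_derivative_works by auto

lemma Ck_on_add:
  assumes "open S"
  shows "Ck_on k f S \<Longrightarrow> Ck_on k g S \<Longrightarrow> Ck_on k (\<lambda>x. f x + g x) S"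
proof (induction k arbitrary: f g)
  case (Suc k)
  show ?case
    by (rule Ck_on_Suc_derivativeI[OF assms
          has_derivative_add[OF Ck_on_derivative[OF Suc.prems(1)] Ck_on_derivative[OF Suc.prems(2)]]])
      (use Suc in auto)
qed (simp add: continuous_on_add)

lemma Ck_on_bounded_linear:
  assumes "open S" "bounded_linear h"
  shows "Ck_on k f S \<Longrightarrow> Ck_on k (\<lambda>x. h (f x)) S"
proof (induction k arbitrary: f)
  case 0
  then show ?case using assms by (simp add: bounded_linear.continuous_on)
next
  case (Suc k)
  show ?case
    by (rule Ck_on_Suc_derivativeI[OF assms(1)
          bounded_linear.has_derivative[OF assms(2) Ck_on_derivative[OF Suc.prems]]])
      (use Suc in auto)
qed

lemma Ck_on_bounded_bilinear:
  assumes "open S" "bounded_bilinear h"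
  shows "Ck_on k f S \<Longrightarrow> Ck_on k g S \<Longrightarrow> Ck_on k (\<lambda>x. h (f x) (g x)) S"
proof (induction k arbitrary: f g)
  case 0
  then show ?case using assms by (simp add: bounded_bilinear.continuous_on)
next
  case (Suc k)
  have "Ck_on k (\<lambda>x. h (f x) (frechet_derivative g (at x) v) + h (frechet_derivative f (at x) v) (g x)) S" for v
    by (intro Ck_on_add assms Suc.IH) (use Suc.prems Ck_on_SucD in auto)
  moreover have "((\<lambda>x. h (f x) (g x)) has_derivative
      (\<lambda>v. h (f x) (frechet_derivative g (at x) v) + h (frechet_derivative f (at x) v) (g x))) (at x)"
    if "x \<in> S" for x
    by (rule bounded_bilinear.FDERIV[OF assms(2) Ck_on_derivative[OF Suc.prems(1) that]
          Ck_on_derivative[OF Suc.prems(2) that]])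
  ultimately show ?case
    using Ck_on_Suc_derivativeI[OF assms(1), of "\<lambda>x. h (f x) (g x)"
        "\<lambda>x v. h (f x) (frechet_derivative g (at x) v) + h (frechet_derivative f (at x) v) (g x)" k]
    by blast
qed

lemma smooth_on_cong:
  "open S \<Longrightarrow> (\<And>x. x \<in> S \<Longrightarrow> f x = g x) \<Longrightarrow> smooth_on S f \<Longrightarrow> smooth_on S g"
  unfolding smooth_on_def using Ck_on_cong by blast

lemma smooth_on_add:
  "open S \<Longrightarrow> smooth_on S f \<Longrightarrow> smooth_on S g \<Longrightarrow> smooth_on S (\<lambda>x. f x + g x)"
  by (simp add: smooth_on_def Ck_on_add)

lemma smooth_on_bounded_linear:
  "open S \<Longrightarrow> bounded_linear h \<Longrightarrow> smooth_on S f \<Longrightarrow> smooth_on S (\<lambda>x. h (f x))"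
  by (simp add: smooth_on_def Ck_on_bounded_linear)

lemma smooth_on_bounded_bilinear:
  "open S \<Longrightarrow> bounded_bilinear h \<Longrightarrow> smooth_on S f \<Longrightarrow> smooth_on S g \<Longrightarrow>
    smooth_on S (\<lambda>x. h (f x) (g x))"
  by (simp add: smooth_on_def Ck_on_bounded_bilinear)

lemmas smooth_on_qmul = smooth_on_bounded_bilinear[OF _ bounded_bilinear_qmul]

lemma smooth_on_scaleR: "open S \<Longrightarrow> smooth_on S f \<Longrightarrow> smooth_on S (\<lambda>x. c *\<^sub>R f x)"
  by (rule smooth_on_bounded_linear[OF _ bounded_linear_scaleR_right])

lemma smooth_on_Pair:
  assumes "open S" "smooth_on S f" "smooth_on S g"
  shows "smooth_on S (\<lambda>x. (f x, g x))"
proof -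
  have "smooth_on S (\<lambda>x. (f x, 0) + (0, g x))"
    by (intro smooth_on_add smooth_on_bounded_linear[where h = "\<lambda>x. (x, 0)"]
        smooth_on_bounded_linear[where h = "\<lambda>x. (0, x)"] bounded_linear_Pair
        bounded_linear_ident bounded_linear_zero assms)
  then show ?thesis by simp
qed

lemma smooth_on_subset: "smooth_on S f \<Longrightarrow> T \<subseteq> S \<Longrightarrow> smooth_on T f"
proof -
  have "Ck_on k f T" if "Ck_on k f S" "T \<subseteq> S" for k
    using that
  proof (induction k arbitrary: f)
    case 0
    then show ?case using continuous_on_subset by simp blast
  next
    case (Suc k)
    then show ?case by auto
  qed
  then show "smooth_on S f \<Longrightarrow> T \<subseteq> S \<Longrightarrow> smooth_on T f"
    unfolding smooth_on_def by blast
qed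

lemma smooth_on_differentiable: "smooth_on S f \<Longrightarrow> x \<in> S \<Longrightarrow> f differentiable (at x)"
  unfolding smooth_on_def by (metis Ck_on.simps(2))

lemma smooth_on_continuous: "smooth_on S f \<Longrightarrow> continuous_on S f"
  unfolding smooth_on_def by (metis Ck_on.simps(1))

text \<open>The value of the form \<open>a du + b dv\<close> on a tangent vector of the plane. Every derivative of a function on
  the plane is written in this way.\<close>

definition lin2 :: "'b::real_normed_vector \<Rightarrow> 'b \<Rightarrow> plane \<Rightarrow> 'b" where
  "lin2 a b \<zeta> = fst \<zeta> *\<^sub>R a + snd \<zeta> *\<^sub>R b"

lemma lin2_simps [simp]: "lin2 a b (1, 0) = a" "lin2 a b (0, 1) = b"
  by (simp_all add: lin2_def)

lemma bounded_linear_lin2: "bounded_linear (lin2 a b)"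
  unfolding lin2_def
  by (intro bounded_linear_add bounded_linear_scaleR_const bounded_linear_fst bounded_linear_snd)

lemma bounded_linear_eq_lin2:
  assumes "bounded_linear h"
  shows "h = lin2 (h (1, 0)) (h (0, 1))"
proof
  fix \<zeta> :: plane
  interpret bounded_linear h by fact
  have "\<zeta> = fst \<zeta> *\<^sub>R (1, 0) + snd \<zeta> *\<^sub>R (0, 1)" by (simp add: prod_eq_iff)
  then show "h \<zeta> = lin2 (h (1, 0)) (h (0, 1)) \<zeta>"
    by (metis add lin2_def scale)
qed

lemma linear_lin2: "bounded_linear h \<Longrightarrow> h (lin2 a b \<zeta>) = lin2 (h a) (h b) \<zeta>"
  by (simp add: lin2_def linear_simps)

lemma has_derivative_lin2D:
  assumes "(f has_derivative h) (at z)"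
  shows "du f z = h (1, 0)" "dv f z = h (0, 1)"
    "((\<lambda>u. f (u, snd z)) has_vector_derivative h (1, 0)) (at (fst z))"
    "((\<lambda>v. f (fst z, v)) has_vector_derivative h (0, 1)) (at (snd z))"
proof -
  have l: "linear h" using assms by (simp add: has_derivative_bounded_linear bounded_linear.linear)
  have f: "(f has_derivative h) (at (fst z, snd z))" using assms by simp
  have "(\<lambda>x. h (x, 0)) = (\<lambda>x. x *\<^sub>R h (1, 0))"
  proof
    show "h (x, 0) = x *\<^sub>R h (1, 0)" for x
      using linear_cmul[OF l, of x "(1, 0)"] by simp
  qed
  moreover have "((\<lambda>u. f (u, snd z)) has_derivative (\<lambda>x. h (x, 0))) (at (fst z))"
    by (rule has_derivative_compose[of "\<lambda>u. (u, snd z)" "\<lambda>x. (x, 0)" "fst z" UNIV f h, OF _ f])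
      (auto intro!: derivative_eq_intros)
  ultimately show u: "((\<lambda>u. f (u, snd z)) has_vector_derivative h (1, 0)) (at (fst z))"
    unfolding has_vector_derivative_def by (rule subst[where P = "\<lambda>k. ((\<lambda>u. f (u, snd z)) has_derivative k) (at (fst z))"])
  have "(\<lambda>x. h (0, x)) = (\<lambda>x. x *\<^sub>R h (0, 1))"
  proof
    show "h (0, x) = x *\<^sub>R h (0, 1)" for x
      using linear_cmul[OF l, of x "(0, 1)"] by simp
  qed
  moreover have "((\<lambda>v. f (fst z, v)) has_derivative (\<lambda>x. h (0, x))) (at (snd z))"
    by (rule has_derivative_compose[of "\<lambda>v. (fst z, v)" "\<lambda>x. (0, x)" "snd z" UNIV f h, OF _ f])
      (auto intro!: derivative_eq_intros)
  ultimately show v: "((\<lambda>v. f (fst z, v)) has_vector_derivative h (0, 1)) (at (snd z))"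
    unfolding has_vector_derivative_def by (rule subst[where P = "\<lambda>k. ((\<lambda>v. f (fst z, v)) has_derivative k) (at (snd z))"])
  show "du f z = h (1, 0)" "dv f z = h (0, 1)"
    using u v by (simp_all add: du_def dv_def vector_derivative_at)
qed

lemma has_derivative_partials:
  assumes "f differentiable (at z)"
  shows "(f has_derivative lin2 (du f z) (dv f z)) (at z)"
proof -
  have 1: "(f has_derivative frechet_derivative f (at z)) (at z)"
    using assms frechet_derivative_works by blast
  then have "frechet_derivative f (at z) = lin2 (du f z) (dv f z)"
    using bounded_linear_eq_lin2[OF has_derivative_bounded_linear[OF 1]] has_derivative_lin2D[OF 1]
    by simp
  then show ?thesis using 1 by simp
qed

lemma frechet_derivative_partials:
  assumes "f differentiable (at z)"
  shows "frechet_derivative f (at z) = lin2 (du f z) (dv f z)"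
  using frechet_derivative_at[OF has_derivative_partials[OF assms]] by simp

lemma smooth_on_has_derivative:
  "smooth_on S f \<Longrightarrow> z \<in> S \<Longrightarrow> (f has_derivative lin2 (du f z) (dv f z)) (at z)"
  using has_derivative_partials smooth_on_differentiable by blast

lemma partials_cong:
  assumes "open S" "z \<in> S" "\<And>w. w \<in> S \<Longrightarrow> f w = g w" "f differentiable (at z)"
  shows "du g z = du f z" "dv g z = dv f z"
proof -
  have "(g has_derivative lin2 (du f z) (dv f z)) (at z)"
    by (rule has_derivative_transform_within_open[OF has_derivative_partials[OF assms(4)] assms(1,2)])
      (rule assms(3))
  then show "du g z = du f z" "dv g z = dv f z"
    using has_derivative_lin2D(1,2)[of g "lin2 (du f z) (dv f z)" z] by simp_all
qed

lemma smooth_on_partials: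
  assumes "open S" "smooth_on S f"
  shows "smooth_on S (du f)" "smooth_on S (dv f)"
proof -
  have F: "Ck_on k (\<lambda>x. frechet_derivative f (at x) v) S" for k v
    using assms(2) unfolding smooth_on_def by (metis Ck_on.simps(2))
  have eq: "frechet_derivative f (at x) = lin2 (du f x) (dv f x)" if "x \<in> S" for x
    by (rule frechet_derivative_partials[OF smooth_on_differentiable[OF assms(2) that]])
  show "smooth_on S (du f)" unfolding smooth_on_def
    by (intro allI Ck_on_cong[OF assms(1) _ F[of _ "(1, 0)"]]) (simp add: eq)
  show "smooth_on S (dv f)" unfolding smooth_on_def
    by (intro allI Ck_on_cong[OF assms(1) _ F[of _ "(0, 1)"]]) (simp add: eq)
qed

lemma Ck_on_Suc_lin2I:
  assumes "open S" "\<And>z. z \<in> S \<Longrightarrow> (f has_derivative lin2 (a z) (b z)) (at z)"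
    "Ck_on k a S" "Ck_on k b S"
  shows "Ck_on (Suc k) f S"
proof (rule Ck_on_Suc_derivativeI[OF assms(1,2)])
  show "Ck_on k (\<lambda>x. lin2 (a x) (b x) v) S" for v
    unfolding lin2_def
    by (intro Ck_on_add assms Ck_on_bounded_linear[OF _ bounded_linear_scaleR_right])
qed

text \<open>A primitive of a smooth form is smooth.\<close>

lemma smooth_on_lin2I:
  assumes "open S" "\<And>z. z \<in> S \<Longrightarrow> (f has_derivative lin2 (a z) (b z)) (at z)"
    "smooth_on S a" "smooth_on S b"
  shows "smooth_on S f"
  unfolding smooth_on_def
proof
  fix k show "Ck_on k f S"
    by (rule Ck_on_SucD[OF Ck_on_Suc_lin2I[OF assms(1,2)]]) (use assms(3,4) in \<open>auto simp: smooth_on_def\<close>)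
qed

text \<open>Bootstrapping: the right-hand side of \<open>df = f (a du + b dv)\<close> is as smooth as \<open>f\<close>, so \<open>f\<close> is
  one degree smoother than itself.\<close>

lemma smooth_on_qmul_derivativeI:
  assumes "open S" "\<And>z. z \<in> S \<Longrightarrow> (f has_derivative lin2 (f z \<otimes> a z) (f z \<otimes> b z)) (at z)"
    "smooth_on S a" "smooth_on S b"
  shows "smooth_on S f"
proof -
  have "Ck_on k f S" for k
  proof (induction k)
    case 0
    have "isCont f x" if "x \<in> S" for x
      using assms(2)[OF that] has_derivative_continuous by blast
    then show ?case by (simp add: continuous_at_imp_continuous_on)
  next
    case (Suc k)
    note * = Ck_on_bounded_bilinear[OF assms(1) bounded_bilinear_qmul Suc]
    have "Ck_on k a S" "Ck_on k b S" using assms(3,4) by (auto simp: smooth_on_def)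
    then show ?case
      by (intro Ck_on_Suc_lin2I[OF assms(1,2)] *)
  qed
  then show ?thesis by (simp add: smooth_on_def)
qed

text \<open>Express the increment of \<open>f\<close> in the first variable as an integral of \<open>f_u\<close>, differentiate it in the
  second variable under the integral sign, and then apply the fundamental theorem in the first one.\<close>

lemma mixed_partials:
  fixes f :: "plane \<Rightarrow> 'b::banach"
  assumes "open S" "smooth_on S f" "z \<in> S"
  shows "du (dv f) z = dv (du f) z"
proof -
  obtain u0 v0 where z: "z = (u0, v0)" by fastforce
  obtain A B where AB: "open A" "open B" "u0 \<in> A" "v0 \<in> B" "A \<times> B \<subseteq> S"
    using assms(1,3) z open_prod_elim by (metis mem_Sigma_iff)
  obtain \<delta>1 where d1: "\<delta>1 > 0" "cball u0 \<delta>1 \<subseteq> A" using AB open_contains_cball by metis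
  obtain \<delta>2 where d2: "\<delta>2 > 0" "cball v0 \<delta>2 \<subseteq> B" using AB open_contains_cball by metis
  define V where "V = cball v0 \<delta>2"
  define a where "a = u0 - \<delta>1"
  define b where "b = u0 + \<delta>1"
  have ab: "a < u0" "u0 < b" using d1 by (auto simp: a_def b_def)
  have sub: "{a..b} \<times> V \<subseteq> S"
    using d1 d2 AB by (force simp: V_def a_def b_def cball_eq_atLeastAtMost)
  have v0: "v0 \<in> V" "v0 \<in> interior V" using d2 by (auto simp: V_def interior_cball)
  have atV: "at v0 within V = at v0" by (rule at_within_interior[OF v0(2)])
  note sm = smooth_on_partials[OF assms(1)]
  have c: "continuous_on S (dv (du f))" "continuous_on S (du f)"
    using sm assms(2) smooth_on_continuous by blast+
  have slices: "((\<lambda>u. g (u, v)) has_vector_derivative du g (u, v)) (at u)"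
    "((\<lambda>v. g (u, v)) has_vector_derivative dv g (u, v)) (at v)"
    if "smooth_on S g" "u \<in> {a..b}" "v \<in> V" for g :: "plane \<Rightarrow> 'b" and u v
  proof -
    have "(u, v) \<in> S" using sub that by auto
    from has_derivative_lin2D(3,4)[OF smooth_on_has_derivative[OF that(1) this]]
    show "((\<lambda>u. g (u, v)) has_vector_derivative du g (u, v)) (at u)"
      "((\<lambda>v. g (u, v)) has_vector_derivative dv g (u, v)) (at v)"
      by simp_all
  qed
  have FTC: "f (u, v) - f (a, v) = integral (cbox a u) (\<lambda>s. du f (s, v))"
    if "u \<in> {a..b}" "v \<in> V" for u v
  proof -
    have "((\<lambda>s. du f (s, v)) has_integral f (u, v) - f (a, v)) {a..u}"
      by (rule fundamental_theorem_of_calculus)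
        (use that slices(1)[OF assms(2)] in \<open>auto intro: has_vector_derivative_at_within\<close>)
    then show ?thesis by (simp add: integral_unique)
  qed
  have key: "dv f (u, v0) - dv f (a, v0) = integral {a..u} (\<lambda>s. dv (du f) (s, v0))" if u: "u \<in> {a..b}" for u
  proof -
    have "((\<lambda>v. integral (cbox a u) (\<lambda>s. du f (s, v))) has_vector_derivative
        integral (cbox a u) (\<lambda>s. dv (du f) (s, v0))) (at v0 within V)"
    proof (rule leibniz_rule_vector_derivative)
      show "((\<lambda>x. du f (t, x)) has_vector_derivative dv (du f) (t, x)) (at x within V)"
        if "x \<in> V" "t \<in> cbox a u" for x t
        using slices(2)[OF sm(1)[OF assms(2)], of t x] that u
        by (auto intro: has_vector_derivative_at_within)
      show "(\<lambda>s. du f (s, x)) integrable_on cbox a u" if "x \<in> V" for x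
        using that u sub
        by (auto intro!: integrable_continuous_interval continuous_on_compose2[OF c(2)] continuous_intros)
      show "continuous_on (V \<times> cbox a u) (\<lambda>(x, t). dv (du f) (t, x))"
        unfolding case_prod_unfold
        by (rule continuous_on_compose2[OF c(1)]) (use u sub in \<open>auto intro!: continuous_intros\<close>)
    qed (use v0 in \<open>auto simp: V_def\<close>)
    then have "((\<lambda>v. f (u, v) - f (a, v)) has_vector_derivative
        integral (cbox a u) (\<lambda>s. dv (du f) (s, v0))) (at v0 within V)"
      by (rule has_vector_derivative_transform[OF v0(1), rotated]) (use FTC u in auto)
    then have 1: "((\<lambda>v. f (u, v) - f (a, v)) has_vector_derivative
        integral (cbox a u) (\<lambda>s. dv (du f) (s, v0))) (at v0)" using atV by simp
    have 2: "((\<lambda>v. f (u, v) - f (a, v)) has_vector_derivative dv f (u, v0) - dv f (a, v0)) (at v0)"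
      using slices(2)[OF assms(2)] u v0 ab by (auto intro!: has_vector_derivative_diff)
    show ?thesis using vector_derivative_unique_at[OF 2 1] by simp
  qed
  have "continuous_on {a..b} (\<lambda>s. dv (du f) (s, v0))"
    by (rule continuous_on_compose2[OF c(1)]) (use sub v0 in \<open>auto intro!: continuous_intros\<close>)
  then have "((\<lambda>u. integral {a..u} (\<lambda>s. dv (du f) (s, v0))) has_vector_derivative dv (du f) (u0, v0))
      (at u0 within {a..b})"
    by (rule integral_has_vector_derivative) (use ab in auto)
  then have "((\<lambda>u. dv f (u, v0) - dv f (a, v0)) has_vector_derivative dv (du f) (u0, v0)) (at u0 within {a..b})"
    by (rule has_vector_derivative_transform[rotated 2]) (use ab key in auto)
  then have "((\<lambda>u. dv f (u, v0) - dv f (a, v0)) has_vector_derivative dv (du f) (u0, v0)) (at u0)"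
    using ab at_within_interior[of u0 "{a..b}"] by simp
  moreover have "((\<lambda>u. dv f (u, v0) - dv f (a, v0)) has_vector_derivative du (dv f) (u0, v0) - 0) (at u0)"
    using slices(1)[OF sm(2)[OF assms(2)], of u0 v0] ab v0
    by (intro has_vector_derivative_diff) auto
  ultimately show ?thesis using vector_derivative_unique_at z by fastforce
qed

section \<open>One-forms along the rays of a disc\<close>

lemma norm_lin2_le: "norm (lin2 a b \<zeta>) \<le> (norm a + norm b) * norm \<zeta>"
proof -
  have "norm (lin2 a b \<zeta>) \<le> \<bar>fst \<zeta>\<bar> * norm a + \<bar>snd \<zeta>\<bar> * norm b"
    unfolding lin2_def by (rule order_trans[OF norm_triangle_ineq]) simp
  also have "\<dots> \<le> norm \<zeta> * norm a + norm \<zeta> * norm b"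
    using norm_fst_le[of "fst \<zeta>" "snd \<zeta>"] norm_snd_le[of "snd \<zeta>" "fst \<zeta>"] by (intro add_mono mult_right_mono) auto
  finally show ?thesis by (simp add: algebra_simps)
qed

lemma lin2_diff: "lin2 a b \<zeta> - lin2 c d \<zeta> = lin2 (a - c) (b - d) \<zeta>"
  by (simp add: lin2_def algebra_simps)

lemma lin2_scale: "lin2 a b (t *\<^sub>R \<zeta>) = t *\<^sub>R lin2 a b \<zeta>"
  by (simp add: lin2_def algebra_simps)

lemma smooth_on_compact_bounded:
  assumes "smooth_on S f" "compact K" "K \<subseteq> S"
  obtains B where "B \<ge> 0" "\<And>x. x \<in> K \<Longrightarrow> norm (f x) \<le> B"
proof -
  have "compact (f ` K)"
    using assms smooth_on_continuous compact_continuous_image continuous_on_subset by metis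
  then have "bounded (f ` K)" by (rule compact_imp_bounded)
  then obtain B where "B > 0" "\<And>y. y \<in> f ` K \<Longrightarrow> norm y \<le> B" unfolding bounded_pos by blast
  then show ?thesis by (intro that[of B]) auto
qed

lemma smooth_on_compact_Lipschitz:
  fixes f :: "plane \<Rightarrow> 'b::real_normed_vector"
  assumes "open S" "smooth_on S f" "compact K" "convex K" "K \<subseteq> S"
  obtains L where "L \<ge> 0" "\<And>x y. x \<in> K \<Longrightarrow> y \<in> K \<Longrightarrow> norm (f y - f x) \<le> L * norm (y - x)"
proof -
  obtain B1 where B1: "B1 \<ge> 0" "\<And>x. x \<in> K \<Longrightarrow> norm (du f x) \<le> B1"
    using smooth_on_compact_bounded[OF smooth_on_partials(1)[OF assms(1,2)] assms(3,5)] by blast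
  obtain B2 where B2: "B2 \<ge> 0" "\<And>x. x \<in> K \<Longrightarrow> norm (dv f x) \<le> B2"
    using smooth_on_compact_bounded[OF smooth_on_partials(2)[OF assms(1,2)] assms(3,5)] by blast
  have "norm (f y - f x) \<le> (B1 + B2) * norm (y - x)" if xy: "x \<in> K" "y \<in> K" for x y
  proof (rule differentiable_bound[OF assms(4) _ _ xy(2,1)])
    show "(f has_derivative lin2 (du f x) (dv f x)) (at x within K)" if "x \<in> K" for x
      using smooth_on_has_derivative[OF assms(2)] that assms(5)
      by (meson has_derivative_at_withinI subsetD)
    show "onorm (lin2 (du f x) (dv f x)) \<le> B1 + B2" if "x \<in> K" for x
    proof (rule onorm_bound)
      show "norm (lin2 (du f x) (dv f x) \<zeta>) \<le> (B1 + B2) * norm \<zeta>" for \<zeta>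
        by (rule order_trans[OF norm_lin2_le mult_right_mono])
          (use B1(2)[OF that] B2(2)[OF that] in auto)
    qed (use B1 B2 in simp)
  qed
  then show ?thesis using B1 B2 by (intro that[of "B1 + B2"]) auto
qed

lemma smooth_on_compact_Taylor:
  fixes f :: "plane \<Rightarrow> 'b::real_normed_vector"
  assumes "open S" "smooth_on S f" "compact K" "convex K" "K \<subseteq> S"
  obtains C where "C \<ge> 0" "\<And>x y. x \<in> K \<Longrightarrow> y \<in> K \<Longrightarrow>
    norm (f y - f x - lin2 (du f x) (dv f x) (y - x)) \<le> C * (norm (y - x))\<^sup>2"
proof -
  note sm = smooth_on_partials[OF assms(1,2)]
  obtain L1 where L1: "L1 \<ge> 0" "\<And>x y. x \<in> K \<Longrightarrow> y \<in> K \<Longrightarrow> norm (du f y - du f x) \<le> L1 * norm (y - x)"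
    using smooth_on_compact_Lipschitz[OF assms(1) sm(1) assms(3-5)] by blast
  obtain L2 where L2: "L2 \<ge> 0" "\<And>x y. x \<in> K \<Longrightarrow> y \<in> K \<Longrightarrow> norm (dv f y - dv f x) \<le> L2 * norm (y - x)"
    using smooth_on_compact_Lipschitz[OF assms(1) sm(2) assms(3-5)] by blast
  have "norm (f y - f x - lin2 (du f x) (dv f x) (y - x)) \<le> (L1 + L2) * (norm (y - x))\<^sup>2"
    if xy: "x \<in> K" "y \<in> K" for x y
  proof -
    have sub: "closed_segment x y \<subseteq> K" using assms(4) xy by (simp add: closed_segment_subset)
    have "norm (f y - f x - lin2 (du f x) (dv f x) (y - x)) \<le> norm (y - x) * ((L1 + L2) * norm (y - x))"
    proof (rule differentiable_bound_linearization[where S = "closed_segment x y"])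
      show "x + t *\<^sub>R (y - x) \<in> closed_segment x y" if "t \<in> {0..1}" for t
        using that by (auto simp: in_segment algebra_simps intro!: exI[of _ t])
      show "(f has_derivative lin2 (du f w) (dv f w)) (at w within closed_segment x y)"
        if "w \<in> closed_segment x y" for w
        using smooth_on_has_derivative[OF assms(2)] that assms(5) sub
        by (meson has_derivative_at_withinI subsetD)
      show "onorm (lin2 (du f w) (dv f w) - lin2 (du f x) (dv f x)) \<le> (L1 + L2) * norm (y - x)"
        if w: "w \<in> closed_segment x y" for w
      proof (rule onorm_bound)
        have wx: "norm (w - x) \<le> norm (y - x)" using segment_bound1[OF w] .
        have "norm (du f w - du f x) \<le> L1 * norm (y - x)" "norm (dv f w - dv f x) \<le> L2 * norm (y - x)"
          using L1 L2 wx w sub xy by (meson order_trans mult_left_mono subsetD)+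
        then have "norm (du f w - du f x) + norm (dv f w - dv f x) \<le> (L1 + L2) * norm (y - x)"
          by (simp add: algebra_simps)
        then show "norm ((lin2 (du f w) (dv f w) - lin2 (du f x) (dv f x)) \<zeta>)
            \<le> ((L1 + L2) * norm (y - x)) * norm \<zeta>" for \<zeta>
          unfolding minus_apply lin2_diff by (rule order_trans[OF norm_lin2_le mult_right_mono]) simp
      qed (use L1 L2 in simp)
    qed auto
    then show ?thesis by (simp add: power2_eq_square algebra_simps)
  qed
  then show ?thesis using L1 L2 by (intro that[of "L1 + L2"]) auto
qed

text \<open>The pull-back of \<open>a du + b dv\<close> to the ray from \<open>z0\<close> to \<open>z\<close>, parametrised by \<open>t\<close> in \<open>[0, 1]\<close>.\<close>

definition radial :: "plane \<Rightarrow> (plane \<Rightarrow> 'b::real_normed_vector) \<Rightarrow> (plane \<Rightarrow> 'b) \<Rightarrow> plane \<Rightarrow> real \<Rightarrow> 'b" where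
  "radial z0 a b z t = lin2 (a (z0 + t *\<^sub>R (z - z0))) (b (z0 + t *\<^sub>R (z - z0))) (z - z0)"

text \<open>The derivative with respect to \<open>t\<close> of \<open>t (a du + b dv) (\<zeta>)\<close> at the point with parameter \<open>t\<close> of the ray.\<close>

definition radial_drift :: "plane \<Rightarrow> (plane \<Rightarrow> 'b::real_normed_vector) \<Rightarrow> (plane \<Rightarrow> 'b) \<Rightarrow> plane \<Rightarrow> plane \<Rightarrow> real \<Rightarrow> 'b" where
  "radial_drift z0 a b z \<zeta> t = (let x = z0 + t *\<^sub>R (z - z0) in
     lin2 (a x) (b x) \<zeta> + t *\<^sub>R lin2 (lin2 (du a x) (dv a x) (z - z0)) (lin2 (du b x) (dv b x) (z - z0)) \<zeta>)"

lemma radial_point_in_ball: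
  fixes z :: "'a::real_normed_vector"
  assumes "z \<in> ball z0 r" "t \<in> {0..1}"
  shows "z0 + t *\<^sub>R (z - z0) \<in> ball z0 r"
proof -
  have "norm (t *\<^sub>R (z - z0)) \<le> norm (z - z0)"
    using assms(2) by (simp add: mult_left_le_one_le)
  then show ?thesis using assms(1) by (simp add: dist_norm norm_minus_commute)
qed

lemma radial_drift_has_primitive:
  assumes "smooth_on (ball z0 r) a" "smooth_on (ball z0 r) b" "z \<in> ball z0 r" "t \<in> {0..1}"
  shows "((\<lambda>t. t *\<^sub>R lin2 (a (z0 + t *\<^sub>R (z - z0))) (b (z0 + t *\<^sub>R (z - z0))) \<zeta>)
    has_vector_derivative radial_drift z0 a b z \<zeta> t) (at t)"
proof -
  have x: "z0 + t *\<^sub>R (z - z0) \<in> ball z0 r" using radial_point_in_ball assms(3,4) .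
  have d: "((\<lambda>t. f (z0 + t *\<^sub>R (z - z0))) has_vector_derivative
      lin2 (du f (z0 + t *\<^sub>R (z - z0))) (dv f (z0 + t *\<^sub>R (z - z0))) (z - z0)) (at t)"
    if "smooth_on (ball z0 r) f" for f :: "plane \<Rightarrow> 'a"
  proof -
    have 1: "((\<lambda>t. z0 + t *\<^sub>R (z - z0)) has_vector_derivative (z - z0)) (at t)"
      unfolding has_vector_derivative_def by (auto intro!: derivative_eq_intros)
    show ?thesis
      by (rule vector_derivative_diff_chain_within[OF 1 has_derivative_at_withinI, unfolded o_def])
        (rule smooth_on_has_derivative[OF that x])
  qed
  have "((\<lambda>t. lin2 (a (z0 + t *\<^sub>R (z - z0))) (b (z0 + t *\<^sub>R (z - z0))) \<zeta>) has_vector_derivative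
      fst \<zeta> *\<^sub>R lin2 (du a (z0 + t *\<^sub>R (z - z0))) (dv a (z0 + t *\<^sub>R (z - z0))) (z - z0) +
      snd \<zeta> *\<^sub>R lin2 (du b (z0 + t *\<^sub>R (z - z0))) (dv b (z0 + t *\<^sub>R (z - z0))) (z - z0)) (at t)"
    unfolding lin2_def[of _ _ \<zeta>]
    by (intro has_vector_derivative_add bounded_linear.has_vector_derivative[OF bounded_linear_scaleR_right]
        d assms(1,2))
  from has_vector_derivative_scaleR[OF DERIV_ident this]
  show ?thesis
    by (rule has_vector_derivative_eq_rhs) (simp add: radial_drift_def Let_def lin2_def[of _ _ \<zeta>])
qed

text \<open>Poincare's homotopy formula to first order in the end point of the ray. The vector \<open>t \<zeta>\<close>, with
  \<open>\<zeta> = w - z\<close>, is the displacement of the point with parameter \<open>t\<close>; the first-order change of the radial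
  form is the \<open>t\<close>-derivative of the form on this displacement plus the exterior derivative of the form
  on the pair \<open>t \<zeta>\<close>, \<open>z - z0\<close>. The error is quadratic uniformly in \<open>t\<close>, so that it survives
  integration along the ray.\<close>

lemma radial_expansion:
  assumes a: "smooth_on (ball z0 r) a" and b: "smooth_on (ball z0 r) b" and z: "z \<in> ball z0 r"
  obtains C \<delta> where "C \<ge> 0" "\<delta> > 0" "ball z \<delta> \<subseteq> ball z0 r"
    "\<And>w t. w \<in> ball z \<delta> \<Longrightarrow> t \<in> {0..1} \<Longrightarrow>
      norm (radial z0 a b w t - radial z0 a b z t) \<le> C * norm (w - z)"
    "\<And>w t. w \<in> ball z \<delta> \<Longrightarrow> t \<in> {0..1} \<Longrightarrow>
      norm (radial z0 a b w t - radial z0 a b z t - (radial_drift z0 a b z (w - z) t +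
        (t * (fst (z - z0) * snd (w - z) - snd (z - z0) * fst (w - z))) *\<^sub>R
          (dv a (z0 + t *\<^sub>R (z - z0)) - du b (z0 + t *\<^sub>R (z - z0)))))
      \<le> C * (norm (w - z))\<^sup>2"
proof -
  obtain \<rho> where \<rho>: "dist z0 z < \<rho>" "\<rho> < r" using z dense by auto
  define K where "K = cball z0 \<rho>"
  have K: "compact K" "convex K" "K \<subseteq> ball z0 r" using \<rho> by (auto simp: K_def)
  define \<delta> where "\<delta> = \<rho> - dist z0 z"
  have \<delta>: "\<delta> > 0" using \<rho> by (simp add: \<delta>_def)
  have inK: "w \<in> K" if "w \<in> ball z \<delta>" for w
    using that dist_triangle[of z0 w z] by (simp add: K_def \<delta>_def)
  obtain Ba where Ba: "Ba \<ge> 0" "\<And>x. x \<in> K \<Longrightarrow> norm (a x) \<le> Ba"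
    using smooth_on_compact_bounded[OF a K(1,3)] by blast
  obtain Bb where Bb: "Bb \<ge> 0" "\<And>x. x \<in> K \<Longrightarrow> norm (b x) \<le> Bb"
    using smooth_on_compact_bounded[OF b K(1,3)] by blast
  obtain La where La: "La \<ge> 0" "\<And>x y. x \<in> K \<Longrightarrow> y \<in> K \<Longrightarrow> norm (a y - a x) \<le> La * norm (y - x)"
    using smooth_on_compact_Lipschitz[OF _ a K] by blast
  obtain Lb where Lb: "Lb \<ge> 0" "\<And>x y. x \<in> K \<Longrightarrow> y \<in> K \<Longrightarrow> norm (b y - b x) \<le> Lb * norm (y - x)"
    using smooth_on_compact_Lipschitz[OF _ b K] by blast
  obtain Ta where Ta: "Ta \<ge> 0" "\<And>x y. x \<in> K \<Longrightarrow> y \<in> K \<Longrightarrow>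
      norm (a y - a x - lin2 (du a x) (dv a x) (y - x)) \<le> Ta * (norm (y - x))\<^sup>2"
    using smooth_on_compact_Taylor[OF _ a K] by blast
  obtain Tb where Tb: "Tb \<ge> 0" "\<And>x y. x \<in> K \<Longrightarrow> y \<in> K \<Longrightarrow>
      norm (b y - b x - lin2 (du b x) (dv b x) (y - x)) \<le> Tb * (norm (y - x))\<^sup>2"
    using smooth_on_compact_Taylor[OF _ b K] by blast
  have \<rho>0: "\<rho> > 0" using \<rho>(1) zero_le_dist[of z0 z] by linarith
  define C where "C = (La + Lb) * \<rho> + (Ba + Bb) + (La + Lb) + (Ta + Tb) * \<rho>"
  have C: "C \<ge> 0" "C \<ge> (La + Lb) * \<rho> + (Ba + Bb)" "C \<ge> (La + Lb) + (Ta + Tb) * \<rho>"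
    using La Lb Ba Bb Ta Tb \<rho>0 by (simp_all add: C_def)
  have main: "norm (radial z0 a b w t - radial z0 a b z t) \<le> C * norm (w - z) \<and>
      norm (radial z0 a b w t - radial z0 a b z t - (radial_drift z0 a b z (w - z) t +
        (t * (fst (z - z0) * snd (w - z) - snd (z - z0) * fst (w - z))) *\<^sub>R
          (dv a (z0 + t *\<^sub>R (z - z0)) - du b (z0 + t *\<^sub>R (z - z0)))))
      \<le> C * (norm (w - z))\<^sup>2"
    if w: "w \<in> ball z \<delta>" and t: "t \<in> {0..1}" for w t
  proof -
    define x where "x = z0 + t *\<^sub>R (z - z0)"
    define y where "y = z0 + t *\<^sub>R (w - z0)"
    define \<zeta> where "\<zeta> = w - z"
    define \<eta> where "\<eta> = z - z0"
    have yx: "y - x = t *\<^sub>R \<zeta>" by (simp add: x_def y_def \<zeta>_def algebra_simps)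
    have n: "norm (y - x) \<le> norm \<zeta>" using t by (simp add: yx mult_left_le_one_le)
    have n2: "(norm (y - x))\<^sup>2 \<le> (norm \<zeta>)\<^sup>2" using n by (simp add: power_mono)
    have w\<rho>: "norm (w - z0) \<le> \<rho>" "norm \<eta> \<le> \<rho>"
      using inK[OF w] \<rho> by (simp_all add: K_def \<eta>_def dist_norm norm_minus_commute)
    have "norm (t *\<^sub>R v) \<le> norm v" for v :: plane
      using t by (simp add: mult_left_le_one_le)
    from order_trans[OF this w\<rho>(1)] order_trans[OF this w\<rho>(2)]
    have xy: "x \<in> K" "y \<in> K"
      by (simp_all add: x_def y_def K_def dist_norm \<eta>_def)
    have da: "norm (a y - a x) \<le> La * norm \<zeta>" "norm (b y - b x) \<le> Lb * norm \<zeta>"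
      using La Lb xy n by (meson order_trans mult_left_mono)+
    then have dab: "norm (a y - a x) + norm (b y - b x) \<le> (La + Lb) * norm \<zeta>"
      by (simp add: algebra_simps)
    have ta: "norm (a y - a x - t *\<^sub>R lin2 (du a x) (dv a x) \<zeta>) \<le> Ta * (norm \<zeta>)\<^sup>2"
      "norm (b y - b x - t *\<^sub>R lin2 (du b x) (dv b x) \<zeta>) \<le> Tb * (norm \<zeta>)\<^sup>2"
      using Ta Tb xy n2 unfolding lin2_scale[symmetric] yx[symmetric]
      by (meson order_trans mult_left_mono)+
    then have tab: "norm (a y - a x - t *\<^sub>R lin2 (du a x) (dv a x) \<zeta>) +
        norm (b y - b x - t *\<^sub>R lin2 (du b x) (dv b x) \<zeta>) \<le> (Ta + Tb) * (norm \<zeta>)\<^sup>2"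
      by (simp add: algebra_simps)
    have e1: "radial z0 a b w t - radial z0 a b z t =
        lin2 (a y - a x) (b y - b x) (w - z0) + lin2 (a x) (b x) \<zeta>"
      unfolding radial_def x_def[symmetric] y_def[symmetric] by (simp add: \<zeta>_def lin2_def algebra_simps)
    have "norm (radial z0 a b w t - radial z0 a b z t) \<le>
        ((La + Lb) * norm \<zeta>) * \<rho> + (Ba + Bb) * norm \<zeta>"
      unfolding e1
      using dab w\<rho>(1) Ba(1) Bb(1) Ba(2)[OF xy(1)] Bb(2)[OF xy(1)] La(1) Lb(1)
      by (intro order_trans[OF norm_triangle_ineq] add_mono order_trans[OF norm_lin2_le] mult_mono) auto
    also have "\<dots> \<le> C * norm \<zeta>"
      using mult_right_mono[OF C(2), of "norm \<zeta>"] by (simp add: algebra_simps)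
    finally have 1: "norm (radial z0 a b w t - radial z0 a b z t) \<le> C * norm (w - z)"
      by (simp add: \<zeta>_def)
    have e2: "radial z0 a b w t - radial z0 a b z t - (radial_drift z0 a b z \<zeta> t +
        (t * (fst \<eta> * snd \<zeta> - snd \<eta> * fst \<zeta>)) *\<^sub>R (dv a x - du b x)) =
        lin2 (a y - a x) (b y - b x) \<zeta> +
        lin2 (a y - a x - t *\<^sub>R lin2 (du a x) (dv a x) \<zeta>) (b y - b x - t *\<^sub>R lin2 (du b x) (dv b x) \<zeta>) \<eta>"
    proof -
      have "w - z0 = \<zeta> + \<eta>" by (simp add: \<zeta>_def \<eta>_def)
      then show ?thesis
        unfolding e1 radial_drift_def Let_def x_def[symmetric]
        unfolding \<eta>_def[symmetric]
        by (simp add: lin2_def algebra_simps)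
    qed
    have "norm (radial z0 a b w t - radial z0 a b z t - (radial_drift z0 a b z \<zeta> t +
        (t * (fst \<eta> * snd \<zeta> - snd \<eta> * fst \<zeta>)) *\<^sub>R (dv a x - du b x)))
        \<le> ((La + Lb) * norm \<zeta>) * norm \<zeta> + ((Ta + Tb) * (norm \<zeta>)\<^sup>2) * \<rho>"
      unfolding e2
      using dab tab w\<rho>(2) La(1) Lb(1) Ta(1) Tb(1)
      by (intro order_trans[OF norm_triangle_ineq] add_mono order_trans[OF norm_lin2_le] mult_mono) auto
    also have "\<dots> \<le> C * (norm \<zeta>)\<^sup>2"
      using mult_right_mono[OF C(3), of "(norm \<zeta>)\<^sup>2"] by (simp add: algebra_simps power2_eq_square)
    finally have 2: "norm (radial z0 a b w t - radial z0 a b z t - (radial_drift z0 a b z \<zeta> t +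
        (t * (fst \<eta> * snd \<zeta> - snd \<eta> * fst \<zeta>)) *\<^sub>R (dv a x - du b x))) \<le> C * (norm \<zeta>)\<^sup>2" .
    show ?thesis using 1 2 unfolding \<zeta>_def \<eta>_def x_def by blast
  qed
  have "ball z \<delta> \<subseteq> ball z0 r" using inK K(3) by blast
  from that[OF C(1) \<delta> this] main show ?thesis by blast
qed

section \<open>Primitives of closed forms and linear differential equations\<close>

lemma norm_bound_from_derivative:
  fixes Y :: "real \<Rightarrow> 'b::real_normed_vector"
  assumes "\<And>s. s \<in> {0..1} \<Longrightarrow> (Y has_vector_derivative Y' s) (at s within {0..1})"
    "\<And>s. s \<in> {0..1} \<Longrightarrow> norm (Y' s) \<le> B" "t \<in> {0..1}"
  shows "norm (Y t - Y 0) \<le> B"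
proof -
  have "norm (Y t - Y 0) \<le> B * norm (t - 0)"
  proof (rule differentiable_bound[where S = "{0..1}"])
    show "(Y has_derivative (\<lambda>h. h *\<^sub>R Y' s)) (at s within {0..1})" if "s \<in> {0..1}" for s
      using assms(1)[OF that] by (simp add: has_vector_derivative_def)
    show "onorm (\<lambda>h. h *\<^sub>R Y' s) \<le> B" if "s \<in> {0..1}" for s
    proof (rule onorm_bound)
      show "0 \<le> B" using assms(2)[OF that] norm_ge_zero order_trans by blast
      show "norm (h *\<^sub>R Y' s) \<le> B * norm h" for h
        using mult_left_mono[OF assms(2)[OF that], of "\<bar>h\<bar>"] by (simp add: mult.commute)
    qed
  qed (use assms(3) in auto)
  also have "\<dots> \<le> B * 1"
    using assms(3) order_trans[OF norm_ge_zero assms(2)[OF assms(3)]] by (intro mult_left_mono) auto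
  finally show ?thesis by simp
qed

text \<open>An error bounded by the square of the increment is more than differentiability requires; it is
  what the estimates along rays provide.\<close>

lemma has_derivative_quadraticI:
  fixes f :: "'a::real_normed_vector \<Rightarrow> 'b::real_normed_vector"
  assumes "bounded_linear h" "\<delta> > 0" "C \<ge> 0"
    "\<And>w. w \<in> ball z \<delta> \<Longrightarrow> norm (f w - f z - h (w - z)) \<le> C * (norm (w - z))\<^sup>2"
  shows "(f has_derivative h) (at z)"
  unfolding has_derivative_at_alt
proof (intro conjI allI impI)
  fix e :: real assume e: "e > 0"
  define d where "d = min \<delta> (e / (C + 1))"
  have "norm (f w - f z - h (w - z)) \<le> e * norm (w - z)" if w: "norm (w - z) < d" for w
  proof -
    have "C * norm (w - z) \<le> (C + 1) * (e / (C + 1))"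
      using w assms(3) by (intro mult_mono) (auto simp: d_def)
    then have "C * norm (w - z) \<le> e" using assms(3) by simp
    then have "(C * norm (w - z)) * norm (w - z) \<le> e * norm (w - z)" by (rule mult_right_mono) simp
    moreover have "w \<in> ball z \<delta>" using w by (simp add: d_def dist_norm norm_minus_commute)
    ultimately show ?thesis using assms(4) by (fastforce simp: power2_eq_square mult.assoc)
  qed
  moreover have "d > 0" using e assms by (simp add: d_def)
  ultimately show "\<exists>d>0. \<forall>y. norm (y - z) < d \<longrightarrow> norm (f y - f z - h (y - z)) \<le> e * norm (y - z)"
    by blast
qed (rule assms(1))

lemma radial_continuous:
  assumes "smooth_on (ball z0 r) a" "smooth_on (ball z0 r) b" "z \<in> ball z0 r"
  shows "continuous_on {0..1} (radial z0 a b z)"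
proof -
  have "continuous_on {0..1} (\<lambda>t. f (z0 + t *\<^sub>R (z - z0)))" if "smooth_on (ball z0 r) f" for f :: "plane \<Rightarrow> 'a"
    by (rule continuous_on_compose2[OF smooth_on_continuous[OF that]])
      (use radial_point_in_ball[OF assms(3)] in \<open>auto intro!: continuous_intros\<close>)
  then show ?thesis
    unfolding radial_def lin2_def using assms by (intro continuous_intros) auto
qed

text \<open>The primitive is the integral of the radial form: the exterior derivative in \<open>radial_expansion\<close> vanishes, and what
  is left is the integral of a \<open>t\<close>-derivative.\<close>

lemma closed_form_primitive_on_ball:
  fixes a b :: "plane \<Rightarrow> 'b::banach"
  assumes a: "smooth_on (ball z0 r) a" and b: "smooth_on (ball z0 r) b"
    and closed: "\<And>z. z \<in> ball z0 r \<Longrightarrow> dv a z = du b z"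
  obtains f where "\<And>z. z \<in> ball z0 r \<Longrightarrow> (f has_derivative lin2 (a z) (b z)) (at z)"
proof -
  define f where "f z = integral {0..1} (radial z0 a b z)" for z
  have "(f has_derivative lin2 (a z) (b z)) (at z)" if z: "z \<in> ball z0 r" for z
  proof -
    obtain C \<delta> where C: "C \<ge> 0" "\<delta> > 0" "ball z \<delta> \<subseteq> ball z0 r"
      and est: "\<And>w t. w \<in> ball z \<delta> \<Longrightarrow> t \<in> {0..1} \<Longrightarrow>
        norm (radial z0 a b w t - radial z0 a b z t - (radial_drift z0 a b z (w - z) t +
        (t * (fst (z - z0) * snd (w - z) - snd (z - z0) * fst (w - z))) *\<^sub>R
          (dv a (z0 + t *\<^sub>R (z - z0)) - du b (z0 + t *\<^sub>R (z - z0))))) \<le> C * (norm (w - z))\<^sup>2"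
      using radial_expansion[OF a b z] by metis
    have "norm (f w - f z - lin2 (a z) (b z) (w - z)) \<le> C * (norm (w - z))\<^sup>2" if w: "w \<in> ball z \<delta>" for w
    proof -
      define Y where "Y t = integral {0..t} (radial z0 a b w) - integral {0..t} (radial z0 a b z)
        - t *\<^sub>R lin2 (a (z0 + t *\<^sub>R (z - z0))) (b (z0 + t *\<^sub>R (z - z0))) (w - z)" for t
      have wb: "w \<in> ball z0 r" using w C by blast
      have "norm (Y 1 - Y 0) \<le> C * (norm (w - z))\<^sup>2"
      proof (rule norm_bound_from_derivative)
        fix s :: real assume s: "s \<in> {0..1}"
        show "(Y has_vector_derivative radial z0 a b w s - radial z0 a b z s
            - radial_drift z0 a b z (w - z) s) (at s within {0..1})"
          unfolding Y_def
          by (intro has_vector_derivative_diff integral_has_vector_derivative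
              radial_continuous[OF a b wb] radial_continuous[OF a b z] s
              has_vector_derivative_at_within[OF radial_drift_has_primitive[OF a b z s]])
        show "norm (radial z0 a b w s - radial z0 a b z s - radial_drift z0 a b z (w - z) s)
            \<le> C * (norm (w - z))\<^sup>2"
          using est[OF w s] closed[OF radial_point_in_ball[OF z s]] by simp
      qed simp
      then show ?thesis by (simp add: Y_def f_def)
    qed
    then show ?thesis
      by (rule has_derivative_quadraticI[OF bounded_linear_lin2 C(2,1)])
  qed
  then show ?thesis using that by blast
qed

text \<open>Picard's operator, conjugated by an exponential weight, is a contraction on the whole interval, so no
  patching of short-time solutions is necessary.\<close>

lemma linear_ode_exists:
  fixes prod :: "'b::banach \<Rightarrow> 'c::real_normed_vector \<Rightarrow> 'b"
  assumes "bounded_bilinear prod" and a: "continuous_on {0..1} a"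
  obtains Q where "Q 0 = x0"
    "\<And>t. t \<in> {0..1} \<Longrightarrow> (Q has_vector_derivative prod (Q t) (a t)) (at t within {0..1::real})"
proof -
  interpret bounded_bilinear prod by fact
  obtain K where K: "K > 0" "\<And>x y. norm (prod x y) \<le> norm x * norm y * K"
    using pos_bounded by blast
  have "bounded (a ` {0..1})"
    using a compact_continuous_image compact_imp_bounded compact_Icc by blast
  then obtain N where N: "N > 0" "\<And>t. t \<in> {0..1} \<Longrightarrow> norm (a t) \<le> N"
    unfolding bounded_pos by auto
  define C where "C = N * K"
  have C: "C > 0" using K N by (simp add: C_def)
  have pC: "norm (prod x (a t)) \<le> C * norm x" if "t \<in> {0..1}" for x t
  proof -
    have "norm x * norm (a t) * K \<le> norm x * N * K"
      using N(2)[OF that] K(1) by (intro mult_right_mono mult_left_mono) auto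
    then show ?thesis using K(2)[of x "a t"] by (simp add: C_def algebra_simps)
  qed
  \<comment> \<open>With this rate the weighted Picard operator has Lipschitz constant \<open>C / L = 1 / 2\<close>.\<close>
  define L where "L = 2 * C"
  \<comment> \<open>Bounded continuous functions live on the whole line, so everything is extended by constants beyond \<open>[0, 1]\<close>.\<close>
  define cl where "cl t = max 0 (min 1 t)" for t :: real
  have cl: "cl t \<in> {0..1}" for t by (simp add: cl_def)
  have clid: "cl t = t" if "t \<in> {0..1}" for t using that by (simp add: cl_def)
  define h where "h R s = exp (L * s) *\<^sub>R prod (R s) (a s)" for R s
  define g where "g R t = exp (- L * t) *\<^sub>R (x0 + integral {0..t} (h R))" for R t
  have hc: "continuous_on {0..1} (h (apply_bcontfun R))" for R
    unfolding h_def by (intro continuous_intros continuous_on a continuous_on_apply_bcontfun)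
  have hi: "h (apply_bcontfun R) integrable_on {0..t}" if "t \<in> {0..1}" for R t
    using that by (intro integrable_continuous_interval continuous_on_subset[OF hc]) auto
  have gc: "continuous_on {0..1} (g (apply_bcontfun R))" for R
    unfolding g_def
    by (intro continuous_intros indefinite_integral_continuous_1 integrable_continuous_interval hc)
  have gb: "(\<lambda>t. g (apply_bcontfun R) (cl t)) \<in> bcontfun" for R
  proof -
    have "continuous_on UNIV (\<lambda>t. g (apply_bcontfun R) (cl t))"
      by (rule continuous_on_compose2[OF gc])
        (use cl in \<open>auto simp: cl_def intro!: continuous_intros\<close>)
    moreover have "bounded (g (apply_bcontfun R) ` {0..1})"
      using gc compact_continuous_image compact_imp_bounded compact_Icc by blast
    then have "bounded (range (\<lambda>t. g (apply_bcontfun R) (cl t)))"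
      by (rule bounded_subset) (use cl in auto)
    ultimately show ?thesis by (simp add: bcontfun_def)
  qed
  define \<Phi> where "\<Phi> R = Bcontfun (\<lambda>t. g (apply_bcontfun R) (cl t))" for R
  have \<Phi>: "apply_bcontfun (\<Phi> R) t = g (apply_bcontfun R) (cl t)" for R t
    using gb by (simp add: \<Phi>_def Bcontfun_inverse)
  have contr: "dist (\<Phi> R) (\<Phi> S) \<le> 1 / 2 * dist R S" for R S
  proof (rule dist_bound)
    fix t
    define s where "s = cl t"
    define d where "d = dist R S"
    have s: "s \<in> {0..1}" using cl by (simp add: s_def)
    have "((\<lambda>u. C * d * exp (L * u)) has_integral exp (L * s) * d / 2 - exp (L * 0) * d / 2) {0..s}"
      by (rule fundamental_theorem_of_calculus)
        (use s C in \<open>auto intro!: derivative_eq_intros simp: has_real_derivative_iff_has_vector_derivative[symmetric] L_def\<close>)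
    then have "((\<lambda>u. C * d * exp (L * u)) has_integral exp (L * s) * d / 2 - d / 2) {0..s}" by simp
    then have i: "(\<lambda>u. C * d * exp (L * u)) integrable_on {0..s}"
      "integral {0..s} (\<lambda>u. C * d * exp (L * u)) = exp (L * s) * d / 2 - d / 2"
      by (rule has_integral_integrable, rule integral_unique)
    have "g (apply_bcontfun R) s - g (apply_bcontfun S) s =
        exp (- L * s) *\<^sub>R (integral {0..s} (h (apply_bcontfun R)) - integral {0..s} (h (apply_bcontfun S)))"
      by (simp add: g_def algebra_simps)
    also have "\<dots> = exp (- L * s) *\<^sub>R integral {0..s} (\<lambda>u. h (apply_bcontfun R) u - h (apply_bcontfun S) u)"
      using hi[OF s] by (simp add: Henstock_Kurzweil_Integration.integral_diff)
    finally have e: "norm (g (apply_bcontfun R) s - g (apply_bcontfun S) s) =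
        exp (- L * s) * norm (integral {0..s} (\<lambda>u. h (apply_bcontfun R) u - h (apply_bcontfun S) u))"
      by simp
    have "norm (integral {0..s} (\<lambda>u. h (apply_bcontfun R) u - h (apply_bcontfun S) u))
        \<le> integral {0..s} (\<lambda>u. C * d * exp (L * u))"
    proof (rule integral_norm_bound_integral)
      show "(\<lambda>u. h (apply_bcontfun R) u - h (apply_bcontfun S) u) integrable_on {0..s}"
        by (intro integrable_diff hi s)
      fix u assume u: "u \<in> {0..s}"
      have "h (apply_bcontfun R) u - h (apply_bcontfun S) u =
          exp (L * u) *\<^sub>R prod (apply_bcontfun R u - apply_bcontfun S u) (a u)"
        by (simp add: h_def diff_left algebra_simps)
      also have "norm \<dots> \<le> exp (L * u) * (C * norm (apply_bcontfun R u - apply_bcontfun S u))"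
        using pC[of u] u s by simp
      also have "\<dots> \<le> exp (L * u) * (C * d)"
        using C dist_bounded[of R u S] by (intro mult_left_mono) (auto simp: d_def dist_norm)
      finally show "norm (h (apply_bcontfun R) u - h (apply_bcontfun S) u) \<le> C * d * exp (L * u)"
        by (simp add: mult_ac)
    qed (rule i(1))
    also have "\<dots> \<le> exp (L * s) * d / 2" unfolding i(2) by (simp add: d_def)
    finally have "exp (- L * s) * norm (integral {0..s} (\<lambda>u. h (apply_bcontfun R) u - h (apply_bcontfun S) u))
        \<le> exp (- L * s) * (exp (L * s) * d / 2)"
      by (rule mult_left_mono) simp
    also have "\<dots> = d / 2" by (simp add: exp_minus field_simps)
    finally show "dist (apply_bcontfun (\<Phi> R) t) (apply_bcontfun (\<Phi> S) t) \<le> 1 / 2 * dist R S"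
      using e by (simp add: \<Phi> s_def dist_norm d_def)
  qed
  then obtain R where R: "\<Phi> R = R"
    using banach_fix_type[of "1/2" \<Phi>] by auto
  define Q where "Q t = exp (L * t) *\<^sub>R apply_bcontfun R t" for t
  have Q: "Q t = x0 + integral {0..t} (\<lambda>s. prod (Q s) (a s))" if "t \<in> {0..1}" for t
  proof -
    have "apply_bcontfun R t = g (apply_bcontfun R) t" using \<Phi>[of R t] R clid[OF that] by simp
    then have "Q t = (exp (L * t) * exp (- L * t)) *\<^sub>R (x0 + integral {0..t} (h (apply_bcontfun R)))"
      by (simp add: Q_def g_def)
    moreover have "h (apply_bcontfun R) = (\<lambda>s. prod (Q s) (a s))"
      by (simp add: fun_eq_iff h_def Q_def scaleR_left)
    ultimately show ?thesis by (simp flip: exp_add)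
  qed
  have Qc: "continuous_on {0..1} Q"
    unfolding Q_def by (intro continuous_intros continuous_on_apply_bcontfun)
  have "(Q has_vector_derivative prod (Q t) (a t)) (at t within {0..1})" if t: "t \<in> {0..1}" for t
  proof -
    have "((\<lambda>t. x0 + integral {0..t} (\<lambda>s. prod (Q s) (a s))) has_vector_derivative 0 + prod (Q t) (a t))
        (at t within {0..1})"
      by (intro has_vector_derivative_add has_vector_derivative_const integral_has_vector_derivative
          continuous_on Qc a t)
    then show ?thesis
      using has_vector_derivative_transform[OF t Q] by simp
  qed
  moreover have "Q 0 = x0" using Q[of 0] by simp
  ultimately show ?thesis using that by blast
qed

section \<open>The Maurer--Cartan equation of the 3-sphere\<close>

lemmas qmul_simps = qm.add_left qm.add_right qm.diff_left qm.diff_right qm.minus_left qm.minus_right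
  qm.scaleR_left qm.scaleR_right qm.zero_left qm.zero_right qmul_assoc

lemma qmul_lin2: "x \<otimes> lin2 a b \<zeta> = lin2 (x \<otimes> a) (x \<otimes> b) \<zeta>"
  by (rule linear_lin2[OF qm.bounded_linear_right])

lemma qcnj_imaginary: "fst x = 0 \<Longrightarrow> qcnj x = - x"
  by (simp add: qcnj_def prod_eq_iff)

lemmas qmul_has_vector_derivative = bounded_bilinear.has_vector_derivative[OF bounded_bilinear_qmul]
lemmas qcnj_has_vector_derivative = bounded_linear.has_vector_derivative[OF bounded_linear_qcnj]

text \<open>Solve \<open>Q' = Q R\<close> along every ray, where \<open>R\<close> is the radial form, and take the value at the end point.
  The solutions have norm 1 because the form is imaginary, so products of them with small quantities
  stay small. For end points \<open>w\<close> and \<open>z\<close> the quotient \<open>X\<close> of the two solutions satisfies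
  \<open>X' = Q_w (R_w - R_z) Q_z\<^sup>-\<^sup>1\<close>. By \<open>radial_expansion\<close> and the structure equation,
  \<open>R_w - R_z\<close> is \<open>G' + R_z G - G R_z\<close> up to a quadratic error, with \<open>G\<close> the value of the form on
  the displacement of the point on the ray. This is exactly what makes \<open>Q_z G Q_z\<^sup>-\<^sup>1\<close> a first-order
  approximation of \<open>X - 1\<close>.\<close>

lemma Maurer_Cartan_integrable:
  assumes a: "smooth_on (ball z0 r) a" and b: "smooth_on (ball z0 r) b"
    and im: "\<And>z. z \<in> ball z0 r \<Longrightarrow> fst (a z) = 0 \<and> fst (b z) = 0"
    and MC: "\<And>z. z \<in> ball z0 r \<Longrightarrow> dv a z - du b z = a z \<otimes> b z - b z \<otimes> a z"
  obtains p where "\<And>z. z \<in> ball z0 r \<Longrightarrow> norm (p z) = 1"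
    "\<And>z. z \<in> ball z0 r \<Longrightarrow> (p has_derivative lin2 (p z \<otimes> a z) (p z \<otimes> b z)) (at z)"
proof -
  define R where "R = radial z0 a b"
  have "\<exists>Q. Q 0 = (1, 0) \<and> (\<forall>t\<in>{0..1}. (Q has_vector_derivative Q t \<otimes> R z t) (at t within {0..1}))"
    if "z \<in> ball z0 r" for z
    unfolding R_def using linear_ode_exists[OF bounded_bilinear_qmul radial_continuous[OF a b that]] by metis
  then obtain Q where Q0: "\<And>z. z \<in> ball z0 r \<Longrightarrow> Q z 0 = (1, 0)"
    and Q': "\<And>z t. z \<in> ball z0 r \<Longrightarrow> t \<in> {0..1} \<Longrightarrow>
      (Q z has_vector_derivative Q z t \<otimes> R z t) (at t within {0..1})"
    by metis
  have Rim: "qcnj (R z t) = - R z t" if "z \<in> ball z0 r" "t \<in> {0..1}" for z t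
    using im[OF radial_point_in_ball[OF that]]
    by (intro qcnj_imaginary) (simp add: R_def radial_def lin2_def)
  define X where "X w z t = Q w t \<otimes> qcnj (Q z t)" for w z t
  have X': "(X w z has_vector_derivative Q w t \<otimes> ((R w t - R z t) \<otimes> qcnj (Q z t))) (at t within {0..1})"
    if "w \<in> ball z0 r" "z \<in> ball z0 r" "t \<in> {0..1}" for w z t
    unfolding X_def
    by (rule has_vector_derivative_eq_rhs[OF qmul_has_vector_derivative[OF Q'[OF that(1,3)]
          qcnj_has_vector_derivative[OF Q'[OF that(2,3)]]]])
      (simp add: qcnj_qmul Rim[OF that(2,3)] qmul_simps)
  have X0: "X w z 0 = (1, 0)" if "w \<in> ball z0 r" "z \<in> ball z0 r" for w z
    using Q0[OF that(1)] Q0[OF that(2)] by (simp add: X_def qcnj_def)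
  have Q1: "norm (Q z t) = 1" if z: "z \<in> ball z0 r" and t: "t \<in> {0..1}" for z t
  proof -
    have "norm (X z z t - X z z 0) \<le> 0"
      by (rule norm_bound_from_derivative[OF X'[OF z z] _ t]) (simp_all add: qm.zero_left qm.zero_right)
    then have "X z z t = (1, 0)" using X0[OF z z] by simp
    then have "(norm (Q z t))\<^sup>2 = 1" by (simp add: X_def qmul_qcnj)
    then show ?thesis using power2_eq_imp_eq[of "norm (Q z t)" 1] by simp
  qed
  define p where "p z = Q z 1" for z
  have "(p has_derivative lin2 (p z \<otimes> a z) (p z \<otimes> b z)) (at z)" if z: "z \<in> ball z0 r" for z
  proof -
    obtain C \<delta> where C: "C \<ge> 0" "\<delta> > 0" "ball z \<delta> \<subseteq> ball z0 r"
      and est1: "\<And>w t. w \<in> ball z \<delta> \<Longrightarrow> t \<in> {0..1} \<Longrightarrow> norm (R w t - R z t) \<le> C * norm (w - z)"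
      and est2: "\<And>w t. w \<in> ball z \<delta> \<Longrightarrow> t \<in> {0..1} \<Longrightarrow>
        norm (R w t - R z t - (radial_drift z0 a b z (w - z) t +
        (t * (fst (z - z0) * snd (w - z) - snd (z - z0) * fst (w - z))) *\<^sub>R
          (dv a (z0 + t *\<^sub>R (z - z0)) - du b (z0 + t *\<^sub>R (z - z0))))) \<le> C * (norm (w - z))\<^sup>2"
      unfolding R_def using radial_expansion[OF a b z] by metis
    have "norm (p w - p z - lin2 (p z \<otimes> a z) (p z \<otimes> b z) (w - z)) \<le> (C * C + C) * (norm (w - z))\<^sup>2"
      if w: "w \<in> ball z \<delta>" for w
    proof -
      have wb: "w \<in> ball z0 r" using w C by blast
      have Xnear: "norm (X w z t - (1, 0)) \<le> C * norm (w - z)" if "t \<in> {0..1}" for t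
      proof -
        have "norm (X w z t - X w z 0) \<le> C * norm (w - z)"
          by (rule norm_bound_from_derivative[OF X'[OF wb z] _ that])
            (simp_all add: norm_qmul Q1[OF wb] Q1[OF z] est1[OF w])
        then show ?thesis using X0[OF wb z] by simp
      qed
      define G where "G t = t *\<^sub>R lin2 (a (z0 + t *\<^sub>R (z - z0))) (b (z0 + t *\<^sub>R (z - z0))) (w - z)" for t
      define G' where "G' t = radial_drift z0 a b z (w - z) t" for t
      have G: "(G has_vector_derivative G' t) (at t within {0..1})" if "t \<in> {0..1}" for t
        unfolding G_def G'_def
        by (rule has_vector_derivative_at_within[OF radial_drift_has_primitive[OF a b z that]])
      \<comment> \<open>The part of \<open>X - 1\<close> that is of second order in \<open>w - z\<close>, up to the constant 1.\<close>
      define Y where "Y t = X w z t - Q z t \<otimes> (G t \<otimes> qcnj (Q z t))" for t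
      define E where "E t = R w t - R z t - (G' t + (R z t \<otimes> G t - G t \<otimes> R z t))" for t
      have E: "norm (E t) \<le> C * (norm (w - z))\<^sup>2" if t: "t \<in> {0..1}" for t
      proof -
        have "R z t \<otimes> G t - G t \<otimes> R z t = (t * (fst (z - z0) * snd (w - z) - snd (z - z0) * fst (w - z))) *\<^sub>R
          (dv a (z0 + t *\<^sub>R (z - z0)) - du b (z0 + t *\<^sub>R (z - z0)))"
          unfolding MC[OF radial_point_in_ball[OF z t]] R_def radial_def G_def
          by (simp add: lin2_def qmul_simps algebra_simps)
        then show ?thesis using est2[OF w t] by (simp add: E_def G'_def)
      qed
      have "norm (Y 1 - Y 0) \<le> (C * C + C) * (norm (w - z))\<^sup>2"
      proof (rule norm_bound_from_derivative)
        fix t :: real assume t: "t \<in> {0..1}"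
        have Qw: "Q w t = X w z t \<otimes> Q z t" by (simp add: X_def qmul_assoc Q1[OF z t])
        show "(Y has_vector_derivative (X w z t - (1, 0)) \<otimes> (Q z t \<otimes> ((R w t - R z t) \<otimes> qcnj (Q z t)))
            + Q z t \<otimes> (E t \<otimes> qcnj (Q z t))) (at t within {0..1})"
          unfolding Y_def
          by (rule has_vector_derivative_eq_rhs[OF has_vector_derivative_diff[OF X'[OF wb z t]
                qmul_has_vector_derivative[OF Q'[OF z t] qmul_has_vector_derivative[OF G[OF t]
                  qcnj_has_vector_derivative[OF Q'[OF z t]]]]]])
            (simp add: qcnj_qmul Rim[OF z t] Qw E_def qmul_simps)
        have "norm ((X w z t - (1, 0)) \<otimes> (Q z t \<otimes> ((R w t - R z t) \<otimes> qcnj (Q z t)))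
            + Q z t \<otimes> (E t \<otimes> qcnj (Q z t))) \<le>
            norm (X w z t - (1, 0)) * norm (R w t - R z t) + norm (E t)"
          by (rule order_trans[OF norm_triangle_ineq]) (simp add: norm_qmul Q1[OF z t])
        also have "\<dots> \<le> (C * norm (w - z)) * (C * norm (w - z)) + C * (norm (w - z))\<^sup>2"
          using C(1) by (intro add_mono mult_mono Xnear est1[OF w] E t) auto
        finally show "norm ((X w z t - (1, 0)) \<otimes> (Q z t \<otimes> ((R w t - R z t) \<otimes> qcnj (Q z t)))
            + Q z t \<otimes> (E t \<otimes> qcnj (Q z t))) \<le> (C * C + C) * (norm (w - z))\<^sup>2"
          by (simp add: power2_eq_square algebra_simps)
      qed simp
      moreover have "Y 0 = (1, 0)" by (simp add: Y_def G_def X0[OF wb z] qm.zero_left qm.zero_right)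
      moreover have "(Y 1 - (1, 0)) \<otimes> p z = p w - p z - lin2 (p z \<otimes> a z) (p z \<otimes> b z) (w - z)"
        using Q1[OF z] by (simp add: Y_def G_def X_def p_def qmul_simps flip: qmul_lin2)
      moreover have "norm ((Y 1 - (1, 0)) \<otimes> p z) = norm (Y 1 - (1, 0))"
        using Q1[OF z] by (simp add: norm_qmul p_def)
      ultimately show ?thesis by simp
    qed
    moreover have "C * C + C \<ge> 0" using C(1) by simp
    ultimately show ?thesis
      by (intro has_derivative_quadraticI[OF bounded_linear_lin2 C(2)])
  qed
  moreover have "norm (p z) = 1" if "z \<in> ball z0 r" for z
    using Q1[OF that] by (simp add: p_def)
  ultimately show ?thesis using that by blast
qed

text \<open>The quotient of two solutions has zero derivative.\<close>

lemma Maurer_Cartan_unique: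
  assumes "convex S"
    and p: "\<And>z. z \<in> S \<Longrightarrow> norm (p z) = 1"
      "\<And>z. z \<in> S \<Longrightarrow> (p has_derivative lin2 (p z \<otimes> a z) (p z \<otimes> b z)) (at z)"
    and p': "\<And>z. z \<in> S \<Longrightarrow> norm (p' z) = 1"
      "\<And>z. z \<in> S \<Longrightarrow> (p' has_derivative lin2 (p' z \<otimes> a z) (p' z \<otimes> b z)) (at z)"
    and im: "\<And>z. z \<in> S \<Longrightarrow> fst (a z) = 0 \<and> fst (b z) = 0"
  shows "\<exists>c\<in>S3. \<forall>z\<in>S. p' z = c \<otimes> p z"
proof -
  have "((\<lambda>z. p' z \<otimes> qcnj (p z)) has_derivative (\<lambda>h. 0)) (at z within S)" if z: "z \<in> S" for z
  proof -
    have "((\<lambda>z. p' z \<otimes> qcnj (p z)) has_derivative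
      (\<lambda>h. p' z \<otimes> qcnj (lin2 (p z \<otimes> a z) (p z \<otimes> b z) h) + lin2 (p' z \<otimes> a z) (p' z \<otimes> b z) h \<otimes> qcnj (p z)))
      (at z within S)"
      by (rule bounded_bilinear.FDERIV[OF bounded_bilinear_qmul has_derivative_at_withinI[OF p'(2)[OF z]]
          bounded_linear.has_derivative[OF bounded_linear_qcnj has_derivative_at_withinI[OF p(2)[OF z]]]])
    moreover have "qcnj (lin2 (a z) (b z) h) = - lin2 (a z) (b z) h" for h
      using im[OF z] by (intro qcnj_imaginary) (simp add: lin2_def)
    ultimately show ?thesis by (simp flip: qmul_lin2 add: qcnj_qmul qmul_simps)
  qed
  then have "\<exists>c. \<forall>z\<in>S. p' z \<otimes> qcnj (p z) = c"
    by (intro has_derivative_zero_constant[OF assms(1)])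
  then obtain c where c: "\<And>z. z \<in> S \<Longrightarrow> p' z \<otimes> qcnj (p z) = c"
    by auto
  show ?thesis
  proof (cases "S = {}")
    case True
    moreover have "(1, 0) \<in> S3" by (simp add: S3_iff)
    ultimately show ?thesis by blast
  next
    case False
    then obtain z where z: "z \<in> S" by blast
    then have "norm c = 1" using c[OF z] p(1)[OF z] p'(1)[OF z] by (metis norm_qmul norm_qcnj mult_1)
    moreover have "p' z = c \<otimes> p z" if "z \<in> S" for z
      using c[OF that, symmetric] p(1)[OF that] by (simp add: qmul_assoc)
    ultimately show ?thesis by (auto simp: S3_iff)
  qed
qed

text \<open>Differentiate \<open>p_v = p b\<close> and \<open>p_u = p a\<close> once more and compare the mixed derivatives.\<close>

lemma Maurer_Cartan_equation:
  assumes S: "open S" and p: "smooth_on S p" "\<And>z. z \<in> S \<Longrightarrow> norm (p z) = 1"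
      "\<And>z. z \<in> S \<Longrightarrow> (p has_derivative lin2 (p z \<otimes> a z) (p z \<otimes> b z)) (at z)"
    and a: "smooth_on S a" and b: "smooth_on S b" and z: "z \<in> S"
  shows "dv a z - du b z = a z \<otimes> b z - b z \<otimes> a z"
proof -
  have eq: "du p w = p w \<otimes> a w" "dv p w = p w \<otimes> b w" if "w \<in> S" for w
    using has_derivative_lin2D(1,2)[OF p(3)[OF that]] by simp_all
  have D: "((\<lambda>w. p w \<otimes> f w) has_derivative
      (\<lambda>h. p z \<otimes> lin2 (du f z) (dv f z) h + lin2 (p z \<otimes> a z) (p z \<otimes> b z) h \<otimes> f z)) (at z)"
    if "smooth_on S f" for f
    by (rule bounded_bilinear.FDERIV[OF bounded_bilinear_qmul p(3)[OF z] smooth_on_has_derivative[OF that z]])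
  have "du (dv p) z = du (\<lambda>w. p w \<otimes> b w) z"
    by (rule partials_cong(1)[OF S z]) (use eq D[OF b] in \<open>auto simp: differentiable_def\<close>)
  also have "\<dots> = p z \<otimes> du b z + (p z \<otimes> a z) \<otimes> b z"
    using has_derivative_lin2D(1)[OF D[OF b]] by simp
  finally have 1: "du (dv p) z = p z \<otimes> du b z + (p z \<otimes> a z) \<otimes> b z" .
  have "dv (du p) z = dv (\<lambda>w. p w \<otimes> a w) z"
    by (rule partials_cong(2)[OF S z]) (use eq D[OF a] in \<open>auto simp: differentiable_def\<close>)
  also have "\<dots> = p z \<otimes> dv a z + (p z \<otimes> b z) \<otimes> a z"
    using has_derivative_lin2D(2)[OF D[OF a]] by simp
  finally have "p z \<otimes> (du b z + a z \<otimes> b z) = p z \<otimes> (dv a z + b z \<otimes> a z)"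
    using 1 mixed_partials[OF S p(1) z] by (simp add: qmul_simps)
  then have "qcnj (p z) \<otimes> (p z \<otimes> (du b z + a z \<otimes> b z)) = qcnj (p z) \<otimes> (p z \<otimes> (dv a z + b z \<otimes> a z))"
    by simp
  then have "du b z + a z \<otimes> b z = dv a z + b z \<otimes> a z"
    using p(2)[OF z] by simp
  then show ?thesis by (simp add: algebra_simps)
qed

text \<open>The real part of \<open>p\<^sup>-\<^sup>1dp\<close> is the inner product of \<open>p\<close> and \<open>dp\<close>, which vanishes on the sphere.\<close>

lemma Maurer_Cartan_form:
  assumes S: "open S" and p: "smooth_on S p" "\<And>z. z \<in> S \<Longrightarrow> norm (p z) = 1"
  shows "smooth_on S (\<lambda>z. qcnj (p z) \<otimes> du p z)" "smooth_on S (\<lambda>z. qcnj (p z) \<otimes> dv p z)"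
    "z \<in> S \<Longrightarrow> fst (qcnj (p z) \<otimes> du p z) = 0 \<and> fst (qcnj (p z) \<otimes> dv p z) = 0"
    "z \<in> S \<Longrightarrow> du p z = p z \<otimes> (qcnj (p z) \<otimes> du p z) \<and> dv p z = p z \<otimes> (qcnj (p z) \<otimes> dv p z)"
proof -
  show "smooth_on S (\<lambda>z. qcnj (p z) \<otimes> du p z)" "smooth_on S (\<lambda>z. qcnj (p z) \<otimes> dv p z)"
    by (intro smooth_on_qmul smooth_on_bounded_linear[OF _ bounded_linear_qcnj] smooth_on_partials S p)+
  assume z: "z \<in> S"
  have f: "fst (qcnj x \<otimes> y) = x \<bullet> y" for x y
    by (simp add: qcnj_def qmul_def inner_prod_def)
  have "((\<lambda>z. p z \<bullet> p z) has_derivative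
      (\<lambda>h. p z \<bullet> lin2 (du p z) (dv p z) h + lin2 (du p z) (dv p z) h \<bullet> p z)) (at z)"
    by (rule bounded_bilinear.FDERIV[OF bounded_bilinear_inner]) (rule smooth_on_has_derivative[OF p(1) z])+
  moreover have "((\<lambda>z. p z \<bullet> p z) has_derivative (\<lambda>h. 0)) (at z)"
    by (rule has_derivative_transform_within_open[OF has_derivative_const[of 1] S z])
      (use p(2) in \<open>simp add: norm_eq_1\<close>)
  ultimately have "(\<lambda>h. p z \<bullet> lin2 (du p z) (dv p z) h + lin2 (du p z) (dv p z) h \<bullet> p z) = (\<lambda>h. 0)"
    by (rule has_derivative_unique)
  then have "p z \<bullet> lin2 (du p z) (dv p z) h = 0" for h
    by (drule_tac fun_cong[of _ _ h]) (simp add: inner_commute)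
  from this[of "(1, 0)"] this[of "(0, 1)"]
  show "fst (qcnj (p z) \<otimes> du p z) = 0 \<and> fst (qcnj (p z) \<otimes> dv p z) = 0"
    by (simp add: f)
  show "du p z = p z \<otimes> (qcnj (p z) \<otimes> du p z) \<and> dv p z = p z \<otimes> (qcnj (p z) \<otimes> dv p z)"
    using p(2)[OF z] by simp
qed

section \<open>Gluing local primitives on a simply connected space\<close>

text \<open>The function \<open>f\<close> changes along \<open>h\<close> in the same way as the local primitives \<open>F i\<close> do; it is a
  primitive of the form pulled back by \<open>h\<close>. Only differences of values occur, hence the notion does not
  see the additive constants in the \<open>F i\<close>.\<close>

definition develops :: "'i set \<Rightarrow> ('i \<Rightarrow> 'm set) \<Rightarrow> ('i \<Rightarrow> 'm \<Rightarrow> 'b::real_normed_vector) \<Rightarrow>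
    'a::topological_space set \<Rightarrow> ('a \<Rightarrow> 'm) \<Rightarrow> ('a \<Rightarrow> 'b) \<Rightarrow> bool" where
  "develops I U F T h f \<longleftrightarrow> (\<forall>x\<in>T. \<forall>i\<in>I. h x \<in> U i \<longrightarrow>
     (\<forall>\<^sub>F y in at x within T. f y - f x = F i (h y) - F i (h x)))"

lemma developsD:
  "develops I U F T h f \<Longrightarrow> x \<in> T \<Longrightarrow> i \<in> I \<Longrightarrow> h x \<in> U i \<Longrightarrow>
     \<forall>\<^sub>F y in at x within T. f y - f x = F i (h y) - F i (h x)"
  by (auto simp: develops_def)

text \<open>The property is required at \<open>k x\<close> itself because \<open>k\<close> may take that value at points different from \<open>x\<close>.\<close>

lemma eventually_at_within_compose:
  assumes "\<forall>\<^sub>F y in at (k x) within T. P y" "continuous_on T' k" "k ` T' \<subseteq> T" "x \<in> T'" "P (k x)"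
  shows "\<forall>\<^sub>F y in at x within T'. P (k y)"
proof -
  obtain W where W: "open W" "k x \<in> W" "\<And>y. y \<in> W \<Longrightarrow> y \<noteq> k x \<Longrightarrow> y \<in> T \<Longrightarrow> P y"
    using assms(1) unfolding eventually_at_topological by auto
  have "(k \<longlongrightarrow> k x) (at x within T')"
    using assms(2,4) by (simp add: continuous_on_def)
  then have "\<forall>\<^sub>F y in at x within T'. k y \<in> W"
    by (rule topological_tendstoD) (rule W)+
  moreover have "\<forall>\<^sub>F y in at x within T'. y \<in> T'"
    by (simp add: eventually_at_filter)
  ultimately show ?thesis
  proof eventually_elim
    case (elim y)
    then have "k y \<in> T" using assms(3) by blast
    then show ?case using W(3)[of "k y"] elim assms(5) by (cases "k y = k x") auto
  qed
qed

lemma develops_compose: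
  assumes "develops I U F T h f" "continuous_on T' k" "k ` T' \<subseteq> T"
  shows "develops I U F T' (\<lambda>x. h (k x)) (\<lambda>x. f (k x))"
  unfolding develops_def
proof (intro ballI impI)
  fix x i assume x: "x \<in> T'" "i \<in> I" "h (k x) \<in> U i"
  then have "\<forall>\<^sub>F y in at (k x) within T. f y - f (k x) = F i (h y) - F i (h (k x))"
    using assms(3) by (intro developsD[OF assms(1)]) auto
  from eventually_at_within_compose[OF this assms(2,3) x(1)]
  show "\<forall>\<^sub>F y in at x within T'. f (k y) - f (k x) = F i (h (k y)) - F i (h (k x))"
    by simp
qed

lemma develops_subset:
  "develops I U F T h f \<Longrightarrow> T' \<subseteq> T \<Longrightarrow> develops I U F T' h f"
  using develops_compose[of I U F T h f T' "\<lambda>x. x"] by auto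

lemma develops_cong:
  assumes "develops I U F T h f" "\<And>x. x \<in> T \<Longrightarrow> h x = h' x" "\<And>x. x \<in> T \<Longrightarrow> f x = f' x"
  shows "develops I U F T h' f'"
  unfolding develops_def
proof (intro ballI impI)
  fix x i assume x: "x \<in> T" "i \<in> I" "h' x \<in> U i"
  have "\<forall>\<^sub>F y in at x within T. y \<in> T" by (simp add: eventually_at_filter)
  with developsD[OF assms(1) x(1,2)] x assms(2,3)
  show "\<forall>\<^sub>F y in at x within T. f' y - f' x = F i (h' y) - F i (h' x)"
    by (auto elim: eventually_elim2)
qed

lemma develops_shift: "develops I U F T h f \<Longrightarrow> develops I U F T h (\<lambda>x. f x + c)"
  by (simp add: develops_def)

lemma develops_glue:
  assumes "develops I U F S h f" "develops I U F T h f" "closed S" "closed T"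
  shows "develops I U F (S \<union> T) h f"
  unfolding develops_def
proof (intro ballI impI)
  fix x i assume x: "x \<in> S \<union> T" "i \<in> I" "h x \<in> U i"
  have "\<forall>\<^sub>F y in at x within A. f y - f x = F i (h y) - F i (h x)"
    if "develops I U F A h f" "closed A" for A
  proof (cases "x \<in> A")
    case True
    then show ?thesis using developsD[OF that(1)] x by blast
  next
    case False
    then have "\<forall>\<^sub>F y in at x within A. False"
      unfolding eventually_at_topological using that(2) by (intro exI[of _ "- A"]) auto
    then show ?thesis by (rule eventually_mono) simp
  qed
  then show "\<forall>\<^sub>F y in at x within S \<union> T. f y - f x = F i (h y) - F i (h x)"
    using assms by (simp add: at_within_union eventually_sup)
qed

text \<open>Two developments of the same map differ by a locally constant function.\<close>

lemma develops_unique: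
  assumes "develops I U F T h f" "develops I U F T h g" "connected T" "h ` T \<subseteq> (\<Union>i\<in>I. U i)"
    "x \<in> T" "y \<in> T"
  shows "f y - f x = g y - g x"
proof -
  have "f x - g x = f y - g y"
  proof (rule connected_local_const[OF assms(3,5,6)])
    show "\<forall>a\<in>T. \<forall>\<^sub>F b in at a within T. f a - g a = f b - g b"
    proof
      fix a assume a: "a \<in> T"
      then obtain i where i: "i \<in> I" "h a \<in> U i" using assms(4) by blast
      show "\<forall>\<^sub>F b in at a within T. f a - g a = f b - g b"
        using developsD[OF assms(1) a i] developsD[OF assms(2) a i]
      proof eventually_elim
        case (elim b)
        then have "f b - f a = g b - g a" by simp
        then show ?case by (simp add: algebra_simps)
      qed
    qed
  qed
  then show ?thesis by (simp add: algebra_simps)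
qed

text \<open>One of the two developments is shifted by a constant so that they agree at one point of the intersection;
  by connectedness they then agree on all of it.\<close>

lemma develops_glue_connected:
  assumes f: "develops I U F S h f" and g: "develops I U F T h g" and "closed S" "closed T"
    and con: "connected (S \<inter> T)" and ne: "S \<inter> T \<noteq> {}" and cov: "h ` (S \<union> T) \<subseteq> (\<Union>i\<in>I. U i)"
  shows "\<exists>f. develops I U F (S \<union> T) h f"
proof -
  obtain x0 where x0: "x0 \<in> S \<inter> T" using ne by blast
  define g' where "g' x = g x + (f x0 - g x0)" for x
  have g': "develops I U F T h g'" unfolding g'_def by (rule develops_shift[OF g])
  have eq: "f x = g' x" if x: "x \<in> S \<inter> T" for x
  proof -
    have "h ` (S \<inter> T) \<subseteq> (\<Union>i\<in>I. U i)" using cov by blast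
    from develops_unique[OF develops_subset[OF f] develops_subset[OF g'] con this x0 x]
    show ?thesis by (simp add: g'_def algebra_simps)
  qed
  define k where "k x = (if x \<in> S then f x else g' x)" for x
  have "develops I U F S h k" by (rule develops_cong[OF f]) (auto simp: k_def)
  moreover have "develops I U F T h k" by (rule develops_cong[OF g']) (use eq in \<open>auto simp: k_def\<close>)
  ultimately show ?thesis using develops_glue assms(3,4) by blast
qed

text \<open>The sets \<open>U i\<close> cover \<open>M\<close>, and on overlaps the functions \<open>F i\<close> differ by locally constant functions:
  the data of a closed form on \<open>M\<close>, described by its primitives.\<close>

locale local_primitives =
  fixes M :: "'m::topological_space set" and I :: "'i set" and U :: "'i \<Rightarrow> 'm set"
    and F :: "'i \<Rightarrow> 'm \<Rightarrow> 'b::real_normed_vector"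
  assumes open_U: "\<And>i. i \<in> I \<Longrightarrow> openin (top_of_set M) (U i)"
    and cover: "M = (\<Union>i\<in>I. U i)"
    and compatible: "\<And>i. i \<in> I \<Longrightarrow> develops I U F (U i) (\<lambda>x. x) (F i)"
begin

lemma develops_local:
  assumes "continuous_on T h" "h ` T \<subseteq> U i" "i \<in> I"
  shows "develops I U F T h (\<lambda>x. F i (h x))"
  using develops_compose[OF compatible[OF assms(3)] assms(1,2)] .

text \<open>Small rectangles are mapped into a single \<open>U i\<close>, and two rectangles with a common side can be glued. The
  bisection principle, applied in one variable after the other, reaches the full rectangle.\<close>

lemma develops_rectangle:
  fixes h :: "real \<times> real \<Rightarrow> 'm"
  assumes h: "continuous_on ({a..b} \<times> {c..d}) h" "h ` ({a..b} \<times> {c..d}) \<subseteq> M" and "a \<le> b" "c \<le> d"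
  shows "\<exists>f. develops I U F ({a..b} \<times> {c..d}) h f"
proof -
  define P where "P s t u v \<longleftrightarrow> {s..t} \<times> {u..v} \<subseteq> {a..b} \<times> {c..d} \<longrightarrow>
    (\<exists>f. develops I U F ({s..t} \<times> {u..v}) h f)" for s t u v
  have glue: "P s t u v"
    if P: "P s1 t1 u1 v1" "P s2 t2 u2 v2"
      and un: "{s..t} \<times> {u..v} = {s1..t1} \<times> {u1..v1} \<union> {s2..t2} \<times> {u2..v2}"
      and ne: "({s1..t1} \<times> {u1..v1}) \<inter> ({s2..t2} \<times> {u2..v2}) \<noteq> {}"
    for s t u v s1 t1 u1 v1 s2 t2 u2 v2
    unfolding P_def
  proof
    assume sub: "{s..t} \<times> {u..v} \<subseteq> {a..b} \<times> {c..d}"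
    obtain f g where fg: "develops I U F ({s1..t1} \<times> {u1..v1}) h f"
      "develops I U F ({s2..t2} \<times> {u2..v2}) h g"
      using P sub unfolding P_def un by blast
    have "connected (({s1..t1} \<times> {u1..v1}) \<inter> ({s2..t2} \<times> {u2..v2}))"
      by (intro convex_connected convex_Int convex_Times convex_real_interval)
    then show "\<exists>f. develops I U F ({s..t} \<times> {u..v}) h f"
      unfolding un using image_mono[OF sub, of h] h(2) cover
      by (intro develops_glue_connected[OF fg _ _ _ ne] closed_Times closed_atLeastAtMost) (simp_all add: un)
  qed
  have loc: "\<exists>\<delta>>0. \<forall>s t u v. s \<le> x \<and> x \<le> t \<and> t - s < \<delta> \<and> u \<le> y \<and> y \<le> v \<and> v - u < \<delta> \<longrightarrow> P s t u v"
    for x y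
  proof (cases "(x, y) \<in> {a..b} \<times> {c..d}")
    case True
    then obtain i where i: "i \<in> I" "h (x, y) \<in> U i" using h(2) cover by blast
    obtain V where V: "open V" "U i = M \<inter> V" using open_U[OF i(1)] by (auto simp: openin_open)
    obtain W where W: "open W" "(x, y) \<in> W" "\<And>w. w \<in> W \<Longrightarrow> w \<in> {a..b} \<times> {c..d} \<Longrightarrow> h w \<in> V"
      using h(1) True V i(2) unfolding continuous_on_topological by (metis IntD2)
    obtain A B where AB: "open A" "open B" "x \<in> A" "y \<in> B" "A \<times> B \<subseteq> W"
      using W(1,2) open_prod_elim by (metis mem_Sigma_iff)
    obtain d1 where d1: "d1 > 0" "ball x d1 \<subseteq> A" using AB open_contains_ball by metis
    obtain d2 where d2: "d2 > 0" "ball y d2 \<subseteq> B" using AB open_contains_ball by metis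
    have "P s t u v"
      if st: "s \<le> x \<and> x \<le> t \<and> t - s < min d1 d2 \<and> u \<le> y \<and> y \<le> v \<and> v - u < min d1 d2" for s t u v
      unfolding P_def
    proof
      assume sub: "{s..t} \<times> {u..v} \<subseteq> {a..b} \<times> {c..d}"
      have "{s..t} \<subseteq> ball x d1" "{u..v} \<subseteq> ball y d2"
        using st by (auto simp: dist_real_def)
      then have "{s..t} \<times> {u..v} \<subseteq> W" using AB d1 d2 by blast
      then have "h ` ({s..t} \<times> {u..v}) \<subseteq> U i" using W(3) h(2) sub V(2) by blast
      then show "\<exists>f. develops I U F ({s..t} \<times> {u..v}) h f"
        using develops_local[OF continuous_on_subset[OF h(1) sub] _ i(1)] by blast
    qed
    then show ?thesis using d1 d2 by (intro exI[of _ "min d1 d2"]) auto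
  next
    case False
    have "P s t u v" if "s \<le> x \<and> x \<le> t \<and> u \<le> y \<and> y \<le> v" for s t u v
    proof -
      have "(x, y) \<in> {s..t} \<times> {u..v}" using that by auto
      then show ?thesis using False unfolding P_def by blast
    qed
    then show ?thesis by (intro exI[of _ 1]) auto
  qed
  \<comment> \<open>Thin strips around a vertical segment, by bisection in the second variable.\<close>
  have strip: "\<exists>\<delta>>0. \<forall>s t. s \<le> x \<and> x \<le> t \<and> t - s < \<delta> \<longrightarrow> P s t c d" for x
    using \<open>c \<le> d\<close>
  proof (induction rule: Bolzano)
    case (trans u v w)
    then obtain d1 d2 where "d1 > 0" "d2 > 0"
      and P1: "\<And>s t. s \<le> x \<and> x \<le> t \<and> t - s < d1 \<Longrightarrow> P s t u v"
      and P2: "\<And>s t. s \<le> x \<and> x \<le> t \<and> t - s < d2 \<Longrightarrow> P s t v w" by blast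
    moreover have "P s t u w" if "s \<le> x \<and> x \<le> t \<and> t - s < min d1 d2" for s t
    proof (rule glue[OF P1 P2, of s t s t])
      have "(x, v) \<in> ({s..t} \<times> {u..v}) \<inter> ({s..t} \<times> {v..w})" using that trans by auto
      then show "({s..t} \<times> {u..v}) \<inter> ({s..t} \<times> {v..w}) \<noteq> {}" by blast
    qed (use that trans in auto)
    ultimately show ?case by (intro exI[of _ "min d1 d2"]) auto
  next
    case (local y)
    show ?case using loc[of x y] by metis
  qed
  have "P a b c d"
    using \<open>a \<le> b\<close>
  proof (induction rule: Bolzano)
    case (trans s t w)
    show ?case
    proof (rule glue[OF trans(1,2)])
      have "(t, c) \<in> ({s..t} \<times> {c..d}) \<inter> ({t..w} \<times> {c..d})" using trans \<open>c \<le> d\<close> by auto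
      then show "({s..t} \<times> {c..d}) \<inter> ({t..w} \<times> {c..d}) \<noteq> {}" by blast
    qed (use trans in auto)
  next
    case (local x)
    show ?case using strip[of x] by auto
  qed
  then show ?thesis by (simp add: P_def)
qed

lemma develops_path:
  assumes "path g" "path_image g \<subseteq> M"
  shows "\<exists>f. develops I U F {0..1} g f"
proof -
  \<comment> \<open>A path is a map on a degenerate rectangle.\<close>
  have "continuous_on ({0..1} \<times> {0..0::real}) (\<lambda>x. g (fst x))"
    by (rule continuous_on_compose2[of "{0..1}" g]) (use assms in \<open>auto simp: path_def intro: continuous_intros\<close>)
  moreover have "(\<lambda>x. g (fst x)) ` ({0..1} \<times> {0..0::real}) \<subseteq> M"
    using assms by (auto simp: path_image_def)
  ultimately obtain f where "develops I U F ({0..1} \<times> {0..0::real}) (\<lambda>x. g (fst x)) f"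
    using develops_rectangle[of 0 1 0 0] by (metis order_refl zero_le_one)
  then have "develops I U F {0..1} (\<lambda>t. g (fst (t, 0::real))) (\<lambda>t. f (t, 0))"
    by (rule develops_compose) (auto intro!: continuous_intros)
  then show ?thesis by auto
qed

lemma develops_path_unique:
  assumes "path g" "path_image g \<subseteq> M" "develops I U F {0..1} g f" "develops I U F {0..1} g f'"
    "s \<in> {0..1}" "t \<in> {0..1}"
  shows "f t - f s = f' t - f' s"
  using develops_unique[OF assms(3,4) _ _ assms(5,6)] assms(2) cover by (auto simp: path_image_def)

text \<open>Develop the homotopy over the square. Both vertical sides of the square are mapped to the same path, so the
  development has the same increment on them, and hence also on the two horizontal sides.\<close>

lemma homotopic_loops_develop:
  assumes "homotopic_loops M p q" "develops I U F {0..1} p f" "develops I U F {0..1} q g"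
  shows "f 1 - f 0 = g 1 - g 0"
proof -
  obtain h where h: "continuous_on ({0..1::real} \<times> {0..1}) h" "h \<in> ({0..1} \<times> {0..1}) \<rightarrow> M"
    "\<forall>x \<in> {0..1}. h (0, x) = p x" "\<forall>x \<in> {0..1}. h (1, x) = q x"
    "\<forall>t \<in> {0..1}. pathfinish (h \<circ> Pair t) = pathstart (h \<circ> Pair t)"
    using assms(1) unfolding homotopic_loops by blast
  obtain k where k: "develops I U F ({0..1} \<times> {0..1}) h k"
    using develops_rectangle[OF h(1)] h(2) by fastforce
  have sides: "h (t, 1) = h (t, 0)" if "t \<in> {0..1}" for t
    using h(5) that by (simp add: pathfinish_def pathstart_def)
  have hM: "h (t, s) \<in> M" if "t \<in> {0..1}" "s \<in> {0..1}" for t s using h(2) that by auto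
  have vert: "develops I U F {0..1} (\<lambda>t. h (t, s)) (\<lambda>t. k (t, s))" if "s \<in> {0..1}" for s
    by (rule develops_compose[OF k, of "{0..1}" "\<lambda>t. (t, s)"]) (use that in \<open>auto intro!: continuous_intros\<close>)
  have "develops I U F {0..1} (\<lambda>t. h (t, 0)) (\<lambda>t. k (t, 1))"
    by (rule develops_cong[OF vert[of 1]]) (auto simp: sides)
  then have "k (1, 1) - k (0, 1) = k (1, 0) - k (0, 0)"
    using develops_unique[of I U F "{0..1}" "\<lambda>t. h (t, 0)" "\<lambda>t. k (t, 1)" "\<lambda>t. k (t, 0)" 0 1]
      vert[of 0] hM cover by fastforce
  moreover have horiz: "develops I U F {0..1} (\<lambda>s. h (t, s)) (\<lambda>s. k (t, s))" if "t \<in> {0..1}" for t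
    by (rule develops_compose[OF k, of "{0..1}" "\<lambda>s. (t, s)"]) (use that in \<open>auto intro!: continuous_intros\<close>)
  have "develops I U F {0..1} p (\<lambda>s. k (0, s))" "develops I U F {0..1} q (\<lambda>s. k (1, s))"
    by (rule develops_cong[OF horiz[of 0]] develops_cong[OF horiz[of 1]]; use h(3,4) in simp)+
  moreover have "p ` {0..1} \<subseteq> (\<Union>i\<in>I. U i)" "q ` {0..1} \<subseteq> (\<Union>i\<in>I. U i)"
    using h(3,4) hM cover by (metis image_subsetI atLeastAtMost_iff order_refl zero_le_one)+
  ultimately have "f 1 - f 0 = k (0, 1) - k (0, 0)" "g 1 - g 0 = k (1, 1) - k (1, 0)"
    using develops_unique[OF assms(2), of "\<lambda>s. k (0, s)" 0 1]
      develops_unique[OF assms(3), of "\<lambda>s. k (1, s)" 0 1] by auto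
  moreover have "k (1, 1) - k (1, 0) = k (0, 1) - k (0, 0)"
    using \<open>k (1, 1) - k (0, 1) = k (1, 0) - k (0, 0)\<close> by (simp add: algebra_simps)
  ultimately show ?thesis by simp
qed

lemma loop_develops_trivial:
  assumes "simply_connected M" "path g" "path_image g \<subseteq> M" "pathfinish g = pathstart g"
    "develops I U F {0..1} g f"
  shows "f 1 = f 0"
proof -
  have "path (\<lambda>t::real. g 0)" by (simp add: path_def)
  moreover have "path_image (\<lambda>t::real. g 0) \<subseteq> M"
    using assms(3) by (auto simp: path_image_def)
  ultimately have "homotopic_loops M g (\<lambda>t. g 0)"
    using assms(1-4) unfolding simply_connected_def by (auto simp: pathfinish_def pathstart_def)
  moreover have "develops I U F {0..1} (\<lambda>t. g 0) (\<lambda>t. 0)"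
    by (simp add: develops_def)
  ultimately have "f 1 - f 0 = 0 - 0"
    using homotopic_loops_develop[OF _ assms(5)] by blast
  then show ?thesis by simp
qed

text \<open>Constant loops at two points are homotopic, and any point of the loop moves along a path from one to the other.\<close>

lemma simply_connected_joined:
  assumes "simply_connected M" "x \<in> M" "y \<in> M"
  shows "\<exists>g. path g \<and> path_image g \<subseteq> M \<and> pathstart g = x \<and> pathfinish g = y"
proof -
  have "homotopic_loops M (\<lambda>t. x) (\<lambda>t. y)"
    using assms(2,3) assms(1)[unfolded simply_connected_def, rule_format, of "\<lambda>t. x" "\<lambda>t. y"]
    by (simp add: path_def path_image_def pathfinish_def pathstart_def)
  then obtain h where h: "continuous_on ({0..1::real} \<times> {0..1::real}) h" "h \<in> ({0..1} \<times> {0..1}) \<rightarrow> M"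
    "\<forall>s \<in> {0..1}. h (0, s) = x" "\<forall>s \<in> {0..1}. h (1, s) = y"
    unfolding homotopic_loops by blast
  have "continuous_on {0..1} (\<lambda>t. h (t, 0))"
    by (rule continuous_on_compose2[OF h(1)]) (auto intro!: continuous_intros)
  then show ?thesis
    using h by (intro exI[of _ "\<lambda>t. h (t, 0)"])
      (auto simp: path_def path_image_def pathstart_def pathfinish_def)
qed

lemma develops_join_halves:
  assumes "develops I U F {0..1} (g +++ k) f" "pathfinish g = pathstart k"
  shows "develops I U F {0..1} g (\<lambda>t. f (t / 2))" "develops I U F {0..1} k (\<lambda>t. f ((1 + t) / 2))"
proof -
  have "develops I U F {0..1} (\<lambda>t. (g +++ k) (t / 2)) (\<lambda>t. f (t / 2))"
    by (rule develops_compose[OF assms(1), of "{0..1}" "\<lambda>t. t / 2"]) (auto intro!: continuous_intros)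
  then show "develops I U F {0..1} g (\<lambda>t. f (t / 2))"
    by (rule develops_cong) (auto simp: joinpaths_def)
  have "develops I U F {0..1} (\<lambda>t. (g +++ k) ((1 + t) / 2)) (\<lambda>t. f ((1 + t) / 2))"
    by (rule develops_compose[OF assms(1), of "{0..1}" "\<lambda>t. (1 + t) / 2"]) (auto intro!: continuous_intros)
  then show "develops I U F {0..1} k (\<lambda>t. f ((1 + t) / 2))"
    by (rule develops_cong)
      (use assms(2) in \<open>auto simp: joinpaths_def pathfinish_def pathstart_def field_simps\<close>)
qed

lemma same_ends_develop:
  assumes "simply_connected M" "path g" "path_image g \<subseteq> M" "path k" "path_image k \<subseteq> M"
    "pathstart g = pathstart k" "pathfinish g = pathfinish k"
    "develops I U F {0..1} g f" "develops I U F {0..1} k f'"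
  shows "f 1 - f 0 = f' 1 - f' 0"
proof -
  \<comment> \<open>The increment along a closed loop is zero.\<close>
  let ?l = "g +++ reversepath k"
  have l: "path ?l" "path_image ?l \<subseteq> M" "pathfinish ?l = pathstart ?l"
    using assms by (auto simp: path_image_join)
  obtain e where e: "develops I U F {0..1} ?l e" using develops_path[OF l(1,2)] by blast
  have "e 1 = e 0" using loop_develops_trivial[OF assms(1) l e] .
  note halves = develops_join_halves[OF e]
  have 1: "f 1 - f 0 = e (1 / 2) - e 0"
    using develops_path_unique[OF assms(2,3,8) halves(1), of 0 1] assms(7) by simp
  have "develops I U F {0..1} (\<lambda>t. reversepath k (1 - t)) (\<lambda>t. e ((1 + (1 - t)) / 2))"
    by (rule develops_compose[OF halves(2)]) (use assms(7) in \<open>auto intro!: continuous_intros\<close>)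
  then have "develops I U F {0..1} k (\<lambda>t. e ((1 + (1 - t)) / 2))"
    by (rule develops_cong) (auto simp: reversepath_def)
  from develops_path_unique[OF assms(4,5,9) this, of 0 1]
  have "f' 1 - f' 0 = e (1 / 2) - e 1" by simp
  then show ?thesis using 1 \<open>e 1 = e 0\<close> by simp
qed

text \<open>Continue the local primitives along paths from a base point. On a path inside \<open>U i\<close> the continuation is \<open>F i\<close>
  up to a constant, so the end values on \<open>U i\<close> differ by the increments of \<open>F i\<close>.\<close>

lemma global_primitive:
  assumes sc: "simply_connected M" and pc: "\<And>i. i \<in> I \<Longrightarrow> path_connected (U i)"
  shows "\<exists>f. \<forall>i\<in>I. \<forall>x\<in>U i. \<forall>y\<in>U i. f y - f x = F i y - F i x"
proof (cases "M = {}")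
  case True
  then show ?thesis using cover by auto
next
  case False
  then obtain x0 where x0: "x0 \<in> M" by blast
  have "\<exists>g d. path g \<and> path_image g \<subseteq> M \<and> pathstart g = x0 \<and> pathfinish g = x \<and> develops I U F {0..1} g d"
    if "x \<in> M" for x
    using simply_connected_joined[OF sc x0 that] develops_path by blast
  then obtain g d where g: "\<And>x. x \<in> M \<Longrightarrow> path (g x)" "\<And>x. x \<in> M \<Longrightarrow> path_image (g x) \<subseteq> M"
    "\<And>x. x \<in> M \<Longrightarrow> pathstart (g x) = x0" "\<And>x. x \<in> M \<Longrightarrow> pathfinish (g x) = x"
    "\<And>x. x \<in> M \<Longrightarrow> develops I U F {0..1} (g x) (d x)"
    by metis
  define f where "f x = d x 1 - d x 0" for x
  have "f y - f x = F i y - F i x" if i: "i \<in> I" and x: "x \<in> U i" and y: "y \<in> U i" for i x y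
  proof -
    have UM: "U i \<subseteq> M" using i cover by blast
    have xM: "x \<in> M" and yM: "y \<in> M" using x y UM by auto
    obtain k where k: "path k" "path_image k \<subseteq> U i" "pathstart k = x" "pathfinish k = y"
      using pc[OF i] x y unfolding path_connected_def by blast
    have kM: "path_image k \<subseteq> M" using k(2) UM by blast
    let ?l = "g x +++ k"
    have l: "path ?l" "path_image ?l \<subseteq> M" "pathstart ?l = x0" "pathfinish ?l = y"
      using g[OF xM] k kM by (auto simp: path_image_join)
    obtain e where e: "develops I U F {0..1} ?l e" using develops_path[OF l(1,2)] by blast
    have j: "pathfinish (g x) = pathstart k" using g(4)[OF xM] k(3) by simp
    note halves = develops_join_halves[OF e j]
    have "f y = e 1 - e 0"
      unfolding f_def
      by (rule same_ends_develop[OF sc g(1,2)[OF yM] l(1,2) _ _ g(5)[OF yM] e])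
        (use g(3,4)[OF yM] l in auto)
    moreover have "f x = e (1 / 2) - e 0"
      using develops_path_unique[OF g(1,2)[OF xM] g(5)[OF xM] halves(1), of 0 1]
      by (simp add: f_def)
    moreover have "develops I U F {0..1} k (\<lambda>t. F i (k t))"
      by (rule develops_local[OF _ _ i]) (use k in \<open>auto simp: path_def path_image_def\<close>)
    from develops_path_unique[OF k(1) kM this halves(2), of 0 1]
    have "F i y - F i x = e 1 - e (1 / 2)"
      using k(3,4) by (simp add: pathstart_def pathfinish_def)
    ultimately show ?thesis by simp
  qed
  then show ?thesis by blast
qed

end

section \<open>Almost complex maps in terms of left logarithmic derivatives\<close>

lemma S3_times_S3_iff: "x \<in> S3 \<times> S3 \<longleftrightarrow> norm (fst x) = 1 \<and> norm (snd x) = 1"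
  by (cases x) (auto simp: S3_iff)

text \<open>In the left trivialisation \<open>J\<close> does not depend on the base point.\<close>

lemma J_left_translate:
  assumes "norm p = 1" "norm q = 1"
  shows "J (p, q) (p \<otimes> x, q \<otimes> y) =
    (p \<otimes> ((1 / sqrt 3) *\<^sub>R (2 *\<^sub>R y - x)), q \<otimes> ((1 / sqrt 3) *\<^sub>R (y - 2 *\<^sub>R x)))"
  using assms by (simp add: J_def qinv_S3 qmul_simps)

lemma bounded_linear_J: "bounded_linear (J x)"
proof -
  obtain p q where x: "x = (p, q)" using surj_pair[of x] by blast
  have "linear (J (p, q))"
    unfolding linear_iff J_def by (auto simp: qmul_simps algebra_simps)
  then show ?thesis using x linear_conv_bounded_linear by blast
qed

text \<open>Writing a vector as a left translate is possible for all vectors and not just for tangent ones, so the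
  identity holds on the whole ambient space.\<close>

lemma J_J:
  assumes "x \<in> S3 \<times> S3"
  shows "J x (J x X) = - X"
proof -
  obtain p q where x: "x = (p, q)" using surj_pair[of x] by blast
  have n: "norm p = 1" "norm q = 1" using assms x by (auto simp: S3_iff)
  define a where "a = qcnj p \<otimes> fst X"
  define b where "b = qcnj q \<otimes> snd X"
  define s where "s = 1 / sqrt 3"
  have s: "s * s = 1 / 3" by (simp add: s_def)
  have X: "X = (p \<otimes> a, q \<otimes> b)" using n by (simp add: a_def b_def)
  have "s *\<^sub>R (2 *\<^sub>R (s *\<^sub>R (b - 2 *\<^sub>R a)) - s *\<^sub>R (2 *\<^sub>R b - a)) = (s * s) *\<^sub>R ((-3) *\<^sub>R a)"
    "s *\<^sub>R (s *\<^sub>R (b - 2 *\<^sub>R a) - 2 *\<^sub>R (s *\<^sub>R (2 *\<^sub>R b - a))) = (s * s) *\<^sub>R ((-3) *\<^sub>R b)"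
    by (simp_all add: algebra_simps) (simp_all flip: scaleR_add_left)
  then show ?thesis
    unfolding x X J_left_translate[OF n] s_def[symmetric] s by (simp add: qm.minus_right)
qed

text \<open>Coordinates with \<open>J \<phi>_u = \<phi>_v\<close> are therefore isothermal.\<close>

lemma nk_metric_J:
  assumes "x \<in> S3 \<times> S3"
  shows "nk_metric x (J x X) (J x X) = nk_metric x X X" "nk_metric x X (J x X) = 0"
  by (simp_all add: nk_metric_def J_J[OF assms] inner_commute)

text \<open>The components of \<open>p\<^sup>-\<^sup>1dp\<close>, of which only the imaginary part is kept since the real part vanishes for maps
  into the sphere.\<close>

definition mc_u :: "(plane \<Rightarrow> quat) \<Rightarrow> plane \<Rightarrow> real^3" where
  "mc_u p z = snd (qcnj (p z) \<otimes> du p z)"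

definition mc_v :: "(plane \<Rightarrow> quat) \<Rightarrow> plane \<Rightarrow> real^3" where
  "mc_v p z = snd (qcnj (p z) \<otimes> dv p z)"

definition S3_map :: "plane set \<Rightarrow> (plane \<Rightarrow> quat) \<Rightarrow> bool" where
  "S3_map D p \<longleftrightarrow> open D \<and> smooth_on D p \<and> (\<forall>z\<in>D. norm (p z) = 1)"

lemma S3_map_partials:
  assumes "z \<in> D" "S3_map D p"
  shows "du p z = p z \<otimes> (0, mc_u p z)" "dv p z = p z \<otimes> (0, mc_v p z)"
proof -
  have p: "open D" "smooth_on D p" "\<And>z. z \<in> D \<Longrightarrow> norm (p z) = 1"
    using assms(2) by (auto simp: S3_map_def)
  note MC = Maurer_Cartan_form(3,4)[OF p assms(1)]
  have "(0, mc_u p z) = qcnj (p z) \<otimes> du p z" "(0, mc_v p z) = qcnj (p z) \<otimes> dv p z"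
    using MC(1) by (simp_all add: mc_u_def mc_v_def prod_eq_iff)
  then show "du p z = p z \<otimes> (0, mc_u p z)" "dv p z = p z \<otimes> (0, mc_v p z)"
    using MC(2) by simp_all
qed

lemma smooth_mc:
  assumes "S3_map D p"
  shows "smooth_on D (mc_u p)" "smooth_on D (mc_v p)"
proof -
  have p: "open D" "smooth_on D p" "\<And>z. z \<in> D \<Longrightarrow> norm (p z) = 1"
    using assms by (auto simp: S3_map_def)
  show "smooth_on D (mc_u p)" "smooth_on D (mc_v p)"
    using smooth_on_bounded_linear[OF p(1) bounded_linear_snd Maurer_Cartan_form(1)[OF p]]
      smooth_on_bounded_linear[OF p(1) bounded_linear_snd Maurer_Cartan_form(2)[OF p]]
    by (simp_all add: mc_u_def[abs_def] mc_v_def[abs_def])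
qed

lemma S3_map_has_derivative:
  assumes "S3_map D p" "z \<in> D"
  shows "(p has_derivative lin2 (p z \<otimes> (0, mc_u p z)) (p z \<otimes> (0, mc_v p z))) (at z)"
proof -
  have "smooth_on D p" using assms(1) by (auto simp: S3_map_def)
  from smooth_on_has_derivative[OF this assms(2)] show ?thesis
    by (simp add: S3_map_partials[OF assms(2,1)])
qed

lemma mc_eqI:
  assumes "norm (p z) = 1" "(p has_derivative lin2 (p z \<otimes> (0, a)) (p z \<otimes> (0, b))) (at z)"
  shows "mc_u p z = a" "mc_v p z = b"
  using has_derivative_lin2D(1,2)[OF assms(2)] assms(1) by (simp_all add: mc_u_def mc_v_def)

lemma S3_map_left_translate:
  assumes "S3_map D p" "norm c = 1" "\<And>z. z \<in> D \<Longrightarrow> p' z = c \<otimes> p z"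
  shows "S3_map D p'" "z \<in> D \<Longrightarrow> mc_u p' z = mc_u p z" "z \<in> D \<Longrightarrow> mc_v p' z = mc_v p z"
proof -
  have p: "open D" "smooth_on D p" "\<And>z. z \<in> D \<Longrightarrow> norm (p z) = 1"
    using assms by (auto simp: S3_map_def)
  have "smooth_on D (\<lambda>z. c \<otimes> p z)"
    by (rule smooth_on_bounded_linear[OF p(1) qm.bounded_linear_right p(2)])
  then have "smooth_on D p'"
    by (rule smooth_on_cong[OF p(1), rotated]) (simp add: assms(3))
  then show "S3_map D p'"
    using p assms by (simp add: S3_map_def norm_qmul)
  assume z: "z \<in> D"
  have "((\<lambda>z. c \<otimes> p z) has_derivative (\<lambda>h. c \<otimes> lin2 (p z \<otimes> (0, mc_u p z)) (p z \<otimes> (0, mc_v p z)) h)) (at z)"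
    by (rule bounded_linear.has_derivative[OF qm.bounded_linear_right S3_map_has_derivative[OF assms(1) z]])
  then have "(p' has_derivative lin2 (p' z \<otimes> (0, mc_u p z)) (p' z \<otimes> (0, mc_v p z))) (at z)"
    by (rule has_derivative_transform_within_open[THEN has_derivative_eq_rhs, OF _ p(1) z])
      (simp_all add: assms(3) z qmul_lin2 qmul_assoc)
  then show "mc_u p' z = mc_u p z" "mc_v p' z = mc_v p z"
    using mc_eqI[of p' z] p(3)[OF z] assms(2) by (simp_all add: assms(3)[OF z] norm_qmul)
qed

lemma S3_map_unique:
  assumes "S3_map D p" "S3_map D p'" "convex D"
    "\<And>z. z \<in> D \<Longrightarrow> mc_u p' z = mc_u p z" "\<And>z. z \<in> D \<Longrightarrow> mc_v p' z = mc_v p z"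
  shows "\<exists>c\<in>S3. \<forall>z\<in>D. p' z = c \<otimes> p z"
  using assms(1,2) S3_map_has_derivative[OF assms(1)] S3_map_has_derivative[OF assms(2)] assms(4,5)
  by (intro Maurer_Cartan_unique[OF assms(3), where a = "\<lambda>z. (0, mc_u p z)" and b = "\<lambda>z. (0, mc_v p z)"])
    (auto simp: S3_map_def)

lemma imag_commutator: "(0, x) \<otimes> (0, y) - (0, y) \<otimes> (0, x) = (0, 2 *\<^sub>R cross3 x y)"
  by (rule quat_eqI; simp add: qmul_def cross3_simps)

lemma partials_bounded_linear:
  assumes "smooth_on D f" "z \<in> D" "bounded_linear h"
  shows "du (\<lambda>w. h (f w)) z = h (du f z)" "dv (\<lambda>w. h (f w)) z = h (dv f z)"
  using has_derivative_lin2D(1,2)[OF bounded_linear.has_derivative[OF assms(3)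
        smooth_on_has_derivative[OF assms(1,2)]]] by simp_all

lemma partials_combination:
  assumes "smooth_on D f" "smooth_on D g" "z \<in> D"
  shows "du (\<lambda>w. c *\<^sub>R f w + d *\<^sub>R g w) z = c *\<^sub>R du f z + d *\<^sub>R du g z"
    "dv (\<lambda>w. c *\<^sub>R f w + d *\<^sub>R g w) z = c *\<^sub>R dv f z + d *\<^sub>R dv g z"
  using has_derivative_lin2D(1,2)[OF has_derivative_add[OF
        bounded_linear.has_derivative[OF bounded_linear_scaleR_right smooth_on_has_derivative[OF assms(1,3)]]
        bounded_linear.has_derivative[OF bounded_linear_scaleR_right smooth_on_has_derivative[OF assms(2,3)]]]]
  by simp_all

lemma smooth_combination:
  assumes "open D" "smooth_on D f" "smooth_on D g"
  shows "smooth_on D (\<lambda>w. c *\<^sub>R f w + d *\<^sub>R g w)"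
  by (intro smooth_on_add smooth_on_scaleR assms)

lemma bounded_linear_imag: "bounded_linear (\<lambda>x::real^3. (0::real, x))"
  by (intro bounded_linear_Pair bounded_linear_zero bounded_linear_ident)

text \<open>The equation \<open>Maurer_Cartan_equation\<close> in vector notation: the commutator of imaginary quaternions is twice the
  cross product.\<close>

lemma S3_map_structure_equation:
  assumes "S3_map D p" "z \<in> D"
  shows "dv (mc_u p) z - du (mc_v p) z = 2 *\<^sub>R cross3 (mc_u p z) (mc_v p z)"
proof -
  have p: "open D" "smooth_on D p" "\<And>z. z \<in> D \<Longrightarrow> norm (p z) = 1"
    using assms by (auto simp: S3_map_def)
  note sm = smooth_mc[OF assms(1)]
  have "dv (\<lambda>z. (0, mc_u p z)) z - du (\<lambda>z. (0, mc_v p z)) z =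
      (0::real, mc_u p z) \<otimes> (0, mc_v p z) - (0, mc_v p z) \<otimes> (0, mc_u p z)"
    by (rule Maurer_Cartan_equation[OF p S3_map_has_derivative[OF assms(1)] _ _ assms(2)])
      (auto intro: smooth_on_bounded_linear[OF p(1) bounded_linear_imag] sm)
  then show ?thesis
    by (simp add: partials_bounded_linear[OF sm(1) assms(2) bounded_linear_imag]
        partials_bounded_linear[OF sm(2) assms(2) bounded_linear_imag] imag_commutator)
qed

lemma S3_map_exists:
  assumes a: "smooth_on (ball z0 r) a" and b: "smooth_on (ball z0 r) b"
    and MC: "\<And>z. z \<in> ball z0 r \<Longrightarrow> dv a z - du b z = 2 *\<^sub>R cross3 (a z) (b z)"
  obtains p where "S3_map (ball z0 r) p"
    "\<And>z. z \<in> ball z0 r \<Longrightarrow> mc_u p z = a z" "\<And>z. z \<in> ball z0 r \<Longrightarrow> mc_v p z = b z"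
proof -
  let ?a = "\<lambda>z. (0::real, a z)" and ?b = "\<lambda>z. (0::real, b z)"
  have sm: "smooth_on (ball z0 r) ?a" "smooth_on (ball z0 r) ?b"
    by (intro smooth_on_bounded_linear[OF _ bounded_linear_imag] a b open_ball)+
  have "dv ?a z - du ?b z = ?a z \<otimes> ?b z - ?b z \<otimes> ?a z" if z: "z \<in> ball z0 r" for z
    using MC[OF z] by (simp add: partials_bounded_linear[OF a z bounded_linear_imag]
        partials_bounded_linear[OF b z bounded_linear_imag] imag_commutator)
  then obtain p where p: "\<And>z. z \<in> ball z0 r \<Longrightarrow> norm (p z) = 1"
    "\<And>z. z \<in> ball z0 r \<Longrightarrow> (p has_derivative lin2 (p z \<otimes> ?a z) (p z \<otimes> ?b z)) (at z)"
    using Maurer_Cartan_integrable[OF sm] by auto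
  have "smooth_on (ball z0 r) p"
    by (rule smooth_on_qmul_derivativeI[OF open_ball p(2) sm])
  then have "S3_map (ball z0 r) p" using p(1) by (simp add: S3_map_def)
  then show ?thesis using that mc_eqI p by blast
qed

definition S3_pair_map :: "plane set \<Rightarrow> (plane \<Rightarrow> quat \<times> quat) \<Rightarrow> bool" where
  "S3_pair_map D \<phi> \<longleftrightarrow> S3_map D (\<lambda>z. fst (\<phi> z)) \<and> S3_map D (\<lambda>z. snd (\<phi> z))"

lemma S3_pair_map_iff:
  assumes "open D"
  shows "S3_pair_map D \<phi> \<longleftrightarrow> smooth_on D \<phi> \<and> \<phi> ` D \<subseteq> S3 \<times> S3"
proof
  assume l: "S3_pair_map D \<phi>"
  then have "smooth_on D (\<lambda>z. (fst (\<phi> z), snd (\<phi> z)))"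
    unfolding S3_pair_map_def S3_map_def by (intro smooth_on_Pair) auto
  moreover have "\<phi> z \<in> S3 \<times> S3" if "z \<in> D" for z
    using l that unfolding S3_times_S3_iff by (simp add: S3_pair_map_def S3_map_def)
  ultimately show "smooth_on D \<phi> \<and> \<phi> ` D \<subseteq> S3 \<times> S3" by (simp add: image_subsetI)
next
  assume r: "smooth_on D \<phi> \<and> \<phi> ` D \<subseteq> S3 \<times> S3"
  then have "smooth_on D (\<lambda>z. fst (\<phi> z))" "smooth_on D (\<lambda>z. snd (\<phi> z))"
    by (auto intro: smooth_on_bounded_linear[OF assms] bounded_linear_fst bounded_linear_snd)
  moreover have "norm (fst (\<phi> z)) = 1 \<and> norm (snd (\<phi> z)) = 1" if "z \<in> D" for z
    using r that S3_times_S3_iff by blast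
  ultimately show "S3_pair_map D \<phi>" using assms by (simp add: S3_pair_map_def S3_map_def)
qed

lemma S3_pair_map_partials:
  assumes "S3_pair_map D \<phi>" "z \<in> D"
  defines "p \<equiv> \<lambda>z. fst (\<phi> z)" and "q \<equiv> \<lambda>z. snd (\<phi> z)"
  shows "(\<phi> has_derivative lin2 (p z \<otimes> (0, mc_u p z), q z \<otimes> (0, mc_u q z))
      (p z \<otimes> (0, mc_v p z), q z \<otimes> (0, mc_v q z))) (at z)"
    "du \<phi> z = (p z \<otimes> (0, mc_u p z), q z \<otimes> (0, mc_u q z))"
    "dv \<phi> z = (p z \<otimes> (0, mc_v p z), q z \<otimes> (0, mc_v q z))"
    "alpha \<phi> z = mc_u p z" "beta \<phi> z = mc_v p z"
proof -
  have S: "S3_map D p" "S3_map D q" using assms by (auto simp: S3_pair_map_def)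
  have "((\<lambda>z. (p z, q z)) has_derivative (\<lambda>h. (lin2 (p z \<otimes> (0, mc_u p z)) (p z \<otimes> (0, mc_v p z)) h,
      lin2 (q z \<otimes> (0, mc_u q z)) (q z \<otimes> (0, mc_v q z)) h))) (at z)"
    by (intro has_derivative_Pair S3_map_has_derivative[OF _ assms(2)] S)
  moreover have "(\<lambda>z. (p z, q z)) = \<phi>" by (simp add: p_def q_def)
  moreover have "(\<lambda>h. (lin2 (p z \<otimes> (0, mc_u p z)) (p z \<otimes> (0, mc_v p z)) h,
      lin2 (q z \<otimes> (0, mc_u q z)) (q z \<otimes> (0, mc_v q z)) h)) =
      lin2 (p z \<otimes> (0, mc_u p z), q z \<otimes> (0, mc_u q z)) (p z \<otimes> (0, mc_v p z), q z \<otimes> (0, mc_v q z))"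
    by (simp add: fun_eq_iff lin2_def)
  ultimately show d: "(\<phi> has_derivative lin2 (p z \<otimes> (0, mc_u p z), q z \<otimes> (0, mc_u q z))
      (p z \<otimes> (0, mc_v p z), q z \<otimes> (0, mc_v q z))) (at z)"
    by simp
  show "du \<phi> z = (p z \<otimes> (0, mc_u p z), q z \<otimes> (0, mc_u q z))"
    "dv \<phi> z = (p z \<otimes> (0, mc_v p z), q z \<otimes> (0, mc_v q z))"
    using has_derivative_lin2D(1,2)[OF d] by simp_all
  have "norm (fst (\<phi> z)) = 1" using S assms(2) by (simp add: S3_map_def p_def)
  then show "alpha \<phi> z = mc_u p z" "beta \<phi> z = mc_v p z"
    unfolding alpha_def beta_def mc_u_def mc_v_def p_def by (simp_all only: qinv_S3)
qed

lemma qmul_left_cancel: "norm p = 1 \<Longrightarrow> p \<otimes> x = p \<otimes> y \<longleftrightarrow> x = y"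
  by (metis qcancel(4))

lemma J_du_eq_dv_iff:
  assumes "S3_pair_map D \<phi>" "z \<in> D"
  defines "p \<equiv> \<lambda>z. fst (\<phi> z)" and "q \<equiv> \<lambda>z. snd (\<phi> z)"
  shows "J (\<phi> z) (du \<phi> z) = dv \<phi> z \<longleftrightarrow>
    mc_v p z = (1 / sqrt 3) *\<^sub>R (2 *\<^sub>R mc_u q z - mc_u p z) \<and>
    mc_v q z = (1 / sqrt 3) *\<^sub>R (mc_u q z - 2 *\<^sub>R mc_u p z)"
proof -
  have n: "norm (p z) = 1" "norm (q z) = 1"
    using assms by (auto simp: S3_pair_map_def S3_map_def)
  have "\<phi> z = (p z, q z)" by (simp add: p_def q_def)
  moreover note S3_pair_map_partials(2,3)[OF assms(1,2), folded p_def q_def]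
  ultimately show ?thesis
    by (simp add: J_left_translate[OF n] qmul_left_cancel n eq_commute)
qed

lemma tilde_components:
  assumes "S3_pair_map D \<phi>" "z \<in> D" "J (\<phi> z) (du \<phi> z) = dv \<phi> z"
  defines "p \<equiv> \<lambda>z. fst (\<phi> z)" and "q \<equiv> \<lambda>z. snd (\<phi> z)"
  shows "alpha_tilde \<phi> z = mc_u q z - mc_u p z" "beta_tilde \<phi> z = mc_v q z - mc_v p z"
    "alpha_tilde \<phi> z = (1 / sqrt 3) *\<^sub>R (mc_v p z + mc_v q z)"
    "beta_tilde \<phi> z = - (1 / sqrt 3) *\<^sub>R (mc_u p z + mc_u q z)"
proof -
  note b = assms(3)[unfolded J_du_eq_dv_iff[OF assms(1,2)], folded p_def q_def]
  note ab = S3_pair_map_partials(4,5)[OF assms(1,2), folded p_def]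
  \<comment> \<open>With \<open>t = 1 / sqrt 3\<close> and \<open>sqrt 3 = 3 t\<close>, the only quadratic relation needed is \<open>t\<^sup>2 = 1 / 3\<close>.\<close>
  define t where "t = 1 / sqrt 3"
  have t: "sqrt 3 = 3 * t" "t * t = 1 / 3"
    by (simp_all add: t_def real_div_sqrt)
  have e: "mc_v p z $ i = t * (2 * mc_u q z $ i - mc_u p z $ i)"
    "mc_v q z $ i = t * (mc_u q z $ i - 2 * mc_u p z $ i)" for i
    using b by (simp_all add: t_def)
  have tt: "t * (t * x) = x / 3" for x using t(2) by (simp flip: mult.assoc)
  show "alpha_tilde \<phi> z = mc_u q z - mc_u p z" "beta_tilde \<phi> z = mc_v q z - mc_v p z"
    "alpha_tilde \<phi> z = (1 / sqrt 3) *\<^sub>R (mc_v p z + mc_v q z)"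
    "beta_tilde \<phi> z = - (1 / sqrt 3) *\<^sub>R (mc_u p z + mc_u q z)"
    unfolding t_def[symmetric]
    unfolding alpha_tilde_def beta_tilde_def ab t(1) vec_eq_iff
    by (simp_all add: e algebra_simps tt)
qed

text \<open>The inverse of the linear relations \<open>tilde_components\<close>. It is the reason why an H-surface determines both
  \<open>p\<^sup>-\<^sup>1dp\<close> and \<open>q\<^sup>-\<^sup>1dq\<close>.\<close>

lemma components_from_tilde:
  assumes "S3_pair_map D \<phi>" "z \<in> D" "J (\<phi> z) (du \<phi> z) = dv \<phi> z"
  defines "p \<equiv> \<lambda>z. fst (\<phi> z)" and "q \<equiv> \<lambda>z. snd (\<phi> z)"
  defines "x \<equiv> alpha_tilde \<phi> z" and "y \<equiv> beta_tilde \<phi> z"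
  shows "mc_u p z = (- 1 / 2) *\<^sub>R x + (- sqrt 3 / 2) *\<^sub>R y" "mc_v p z = (sqrt 3 / 2) *\<^sub>R x + (- 1 / 2) *\<^sub>R y"
    "mc_u q z = (1 / 2) *\<^sub>R x + (- sqrt 3 / 2) *\<^sub>R y" "mc_v q z = (sqrt 3 / 2) *\<^sub>R x + (1 / 2) *\<^sub>R y"
proof -
  note T = tilde_components[OF assms(1-3), folded p_def q_def x_def y_def]
  have "sqrt 3 *\<^sub>R x = mc_v p z + mc_v q z" unfolding T(3) by simp
  then have 1: "(sqrt 3 / 2) *\<^sub>R x = (1 / 2) *\<^sub>R (mc_v p z + mc_v q z)"
    by (metis (no_types) divide_inverse inverse_eq_divide mult.commute scaleR_scaleR)
  have "sqrt 3 *\<^sub>R y = - (mc_u p z + mc_u q z)" unfolding T(4) by simp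
  then have 2: "(sqrt 3 / 2) *\<^sub>R y = - (1 / 2) *\<^sub>R (mc_u p z + mc_u q z)"
    by (metis (no_types) divide_inverse inverse_eq_divide mult.commute scaleR_scaleR scaleR_minus_left scaleR_minus_right)
  have 2: "(- sqrt 3 / 2) *\<^sub>R y = (1 / 2) *\<^sub>R (mc_u p z + mc_u q z)"
    using 2 by simp
  show "mc_u p z = (- 1 / 2) *\<^sub>R x + (- sqrt 3 / 2) *\<^sub>R y" "mc_u q z = (1 / 2) *\<^sub>R x + (- sqrt 3 / 2) *\<^sub>R y"
    unfolding 2 T(1) by (simp_all add: vec_eq_iff algebra_simps)
  show "mc_v p z = (sqrt 3 / 2) *\<^sub>R x + (- 1 / 2) *\<^sub>R y" "mc_v q z = (sqrt 3 / 2) *\<^sub>R x + (1 / 2) *\<^sub>R y"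
    unfolding 1 T(2) by (simp_all add: vec_eq_iff algebra_simps)
qed

section \<open>The local correspondence with H-surfaces\<close>

lemma J_holomorphic_iff:
  assumes "open D"
  shows "J_holomorphic D \<phi> \<longleftrightarrow> S3_pair_map D \<phi> \<and> (\<forall>z\<in>D. J (\<phi> z) (du \<phi> z) = dv \<phi> z)"
  by (simp add: J_holomorphic_def S3_pair_map_iff[OF assms] conj_assoc)

lemma cross_combination:
  fixes x y :: "real^3"
  shows "cross3 (a *\<^sub>R x + b *\<^sub>R y) (c *\<^sub>R x + d *\<^sub>R y) = (a * d - b * c) *\<^sub>R cross3 x y"
  unfolding vec_eq_iff forall_3 by (simp add: cross3_simps)

text \<open>The difference of the structure equations of the two factors is closedness, their sum is the equation for
  the Laplacian; the linear relations between the components make the two cross products equal.\<close>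

lemma tilde_form_integrability:
  assumes D: "open D" and \<phi>: "J_holomorphic D \<phi>"
  shows "smooth_on D (alpha_tilde \<phi>)" "smooth_on D (beta_tilde \<phi>)"
    "z \<in> D \<Longrightarrow> dv (alpha_tilde \<phi>) z = du (beta_tilde \<phi>) z"
    "z \<in> D \<Longrightarrow> du (alpha_tilde \<phi>) z + dv (beta_tilde \<phi>) z =
       (- 4 / sqrt 3) *\<^sub>R cross3 (alpha_tilde \<phi> z) (beta_tilde \<phi> z)"
proof -
  define p where "p z = fst (\<phi> z)" for z
  define q where "q z = snd (\<phi> z)" for z
  have ac: "S3_pair_map D \<phi>" and J: "\<And>z. z \<in> D \<Longrightarrow> J (\<phi> z) (du \<phi> z) = dv \<phi> z"
    using \<phi> by (auto simp: J_holomorphic_iff[OF D])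
  have S: "S3_map D p" "S3_map D q" using ac by (auto simp: S3_pair_map_def p_def[abs_def] q_def[abs_def])
  note sm = smooth_mc[OF S(1)] smooth_mc[OF S(2)]
  note T = tilde_components[OF ac _ J, folded p_def q_def]
  have T1: "alpha_tilde \<phi> w = 1 *\<^sub>R mc_u q w + (-1) *\<^sub>R mc_u p w"
    "beta_tilde \<phi> w = 1 *\<^sub>R mc_v q w + (-1) *\<^sub>R mc_v p w"
    "alpha_tilde \<phi> w = (1 / sqrt 3) *\<^sub>R mc_v p w + (1 / sqrt 3) *\<^sub>R mc_v q w"
    "beta_tilde \<phi> w = (- 1 / sqrt 3) *\<^sub>R mc_u p w + (- 1 / sqrt 3) *\<^sub>R mc_u q w" if "w \<in> D" for w
    using T(1,2)[OF that that] T(3,4)[OF that that] by (simp_all add: algebra_simps)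
  show sma: "smooth_on D (alpha_tilde \<phi>)"
    by (rule smooth_on_cong[OF D _ smooth_combination[OF D sm(3,1)]]) (simp only: T1(1))
  show smb: "smooth_on D (beta_tilde \<phi>)"
    by (rule smooth_on_cong[OF D _ smooth_combination[OF D sm(4,2)]]) (simp only: T1(2))
  assume z: "z \<in> D"
  have cong: "du f z = du g z" "dv f z = dv g z" if "smooth_on D g" "\<And>w. w \<in> D \<Longrightarrow> f w = g w"
    for f g :: "plane \<Rightarrow> real^3"
    using partials_cong[OF D z _ smooth_on_differentiable[OF that(1) z], of f] that(2) by auto
  note str = S3_map_structure_equation[OF S(1) z] S3_map_structure_equation[OF S(2) z]
  let ?\<alpha> = "mc_u p z" and ?\<gamma> = "mc_u q z"
  have \<beta>\<delta>: "mc_v p z = (1 / sqrt 3) *\<^sub>R (2 *\<^sub>R ?\<gamma> - ?\<alpha>)" "mc_v q z = (1 / sqrt 3) *\<^sub>R (?\<gamma> - 2 *\<^sub>R ?\<alpha>)"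
    using J[OF z] J_du_eq_dv_iff[OF ac z] by (simp_all add: p_def[abs_def] q_def[abs_def])
  have cross: "cross3 ?\<alpha> (mc_v p z) = (2 / sqrt 3) *\<^sub>R cross3 ?\<alpha> ?\<gamma>"
    "cross3 ?\<gamma> (mc_v q z) = (2 / sqrt 3) *\<^sub>R cross3 ?\<alpha> ?\<gamma>"
    unfolding \<beta>\<delta> using cross_skew[of ?\<gamma> ?\<alpha>]
    by (simp_all add: cross_mult_right Cross3.right_diff_distrib)
  have tilde: "cross3 (alpha_tilde \<phi> z) (beta_tilde \<phi> z) = (2 / sqrt 3) *\<^sub>R cross3 ?\<alpha> ?\<gamma>"
    unfolding T1(1)[OF z] T1(4)[OF z] add.commute[of "1 *\<^sub>R ?\<gamma>"] cross_combination by simp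
  have "dv (alpha_tilde \<phi>) z = dv (mc_u q) z - dv (mc_u p) z"
    using cong(2)[OF smooth_combination[OF D sm(3,1), of 1 "-1"] T1(1)]
      partials_combination(2)[OF sm(3,1) z, of 1 "-1"] by simp
  moreover have "du (beta_tilde \<phi>) z = du (mc_v q) z - du (mc_v p) z"
    using cong(1)[OF smooth_combination[OF D sm(4,2), of 1 "-1"] T1(2)]
      partials_combination(1)[OF sm(4,2) z, of 1 "-1"] by simp
  ultimately have "dv (alpha_tilde \<phi>) z - du (beta_tilde \<phi>) z =
      (dv (mc_u q) z - du (mc_v q) z) - (dv (mc_u p) z - du (mc_v p) z)" by simp
  also have "\<dots> = 0" unfolding str cross by simp
  finally show "dv (alpha_tilde \<phi>) z = du (beta_tilde \<phi>) z" by simp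
  have A: "du (alpha_tilde \<phi>) z = (1 / sqrt 3) *\<^sub>R du (mc_v p) z + (1 / sqrt 3) *\<^sub>R du (mc_v q) z"
    using cong(1)[OF smooth_combination[OF D sm(2,4), of "1 / sqrt 3" "1 / sqrt 3"] T1(3)]
      partials_combination(1)[OF sm(2,4) z, of "1 / sqrt 3" "1 / sqrt 3"] by simp
  have B: "dv (beta_tilde \<phi>) z = (- 1 / sqrt 3) *\<^sub>R dv (mc_u p) z + (- 1 / sqrt 3) *\<^sub>R dv (mc_u q) z"
    using cong(2)[OF smooth_combination[OF D sm(1,3), of "- 1 / sqrt 3" "- 1 / sqrt 3"] T1(4)]
      partials_combination(2)[OF sm(1,3) z, of "- 1 / sqrt 3" "- 1 / sqrt 3"] by simp
  have "du (alpha_tilde \<phi>) z + dv (beta_tilde \<phi>) z =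
      (- 1 / sqrt 3) *\<^sub>R ((dv (mc_u p) z - du (mc_v p) z) + (dv (mc_u q) z - du (mc_v q) z))"
    unfolding A B by (simp add: algebra_simps)
  also have "\<dots> = (- 4 / sqrt 3) *\<^sub>R ((2 / sqrt 3) *\<^sub>R cross3 ?\<alpha> ?\<gamma>)"
    unfolding str cross by (simp flip: scaleR_add_left)
  finally show "du (alpha_tilde \<phi>) z + dv (beta_tilde \<phi>) z =
       (- 4 / sqrt 3) *\<^sub>R cross3 (alpha_tilde \<phi> z) (beta_tilde \<phi> z)"
    by (simp only: tilde)
qed

lemma primitive_is_H_surface:
  assumes D: "open D" and \<phi>: "J_holomorphic D \<phi>"
    and \<epsilon>: "\<And>z. z \<in> D \<Longrightarrow> (\<epsilon> has_derivative lin2 (alpha_tilde \<phi> z) (beta_tilde \<phi> z)) (at z)"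
  shows "H_surface D \<epsilon>" "associated D \<phi> \<epsilon>"
proof -
  note I = tilde_form_integrability[OF D \<phi>]
  have eq: "du \<epsilon> z = alpha_tilde \<phi> z" "dv \<epsilon> z = beta_tilde \<phi> z" if "z \<in> D" for z
    using has_derivative_lin2D(1,2)[OF \<epsilon>[OF that]] by simp_all
  then show "associated D \<phi> \<epsilon>" by (simp add: associated_def)
  have "du (du \<epsilon>) z = du (alpha_tilde \<phi>) z" "dv (dv \<epsilon>) z = dv (beta_tilde \<phi>) z" if z: "z \<in> D" for z
    using partials_cong(1)[OF D z _ smooth_on_differentiable[OF I(1) z], of "du \<epsilon>"]
      partials_cong(2)[OF D z _ smooth_on_differentiable[OF I(2) z], of "dv \<epsilon>"] eq by simp_all
  then show "H_surface D \<epsilon>"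
    unfolding H_surface_def using smooth_on_lin2I[OF D \<epsilon> I(1,2)] I(4) eq by simp
qed

lemma associated_has_derivative:
  assumes "H_surface D \<epsilon>" "associated D \<phi> \<epsilon>" "z \<in> D"
  shows "(\<epsilon> has_derivative lin2 (alpha_tilde \<phi> z) (beta_tilde \<phi> z)) (at z)"
  using smooth_on_has_derivative[of D \<epsilon> z] assms by (simp add: H_surface_def associated_def)

lemma inj_lin2_iff: "inj (lin2 a b) \<longleftrightarrow> (\<forall>\<zeta>. lin2 a b \<zeta> = 0 \<longrightarrow> \<zeta> = 0)"
  by (rule linear_injective_0) (rule bounded_linear.linear[OF bounded_linear_lin2])

lemma immersed_at_iff:
  assumes "(f has_derivative lin2 a b) (at z)"
  shows "immersed_at f z \<longleftrightarrow> (\<forall>\<zeta>. lin2 a b \<zeta> = 0 \<longrightarrow> \<zeta> = 0)"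
proof -
  have "frechet_derivative f (at z) = lin2 a b" "f differentiable (at z)"
    using frechet_derivative_at[OF assms] assms by (auto simp: differentiable_def)
  then show ?thesis unfolding immersed_at_def by (simp only: inj_lin2_iff simp_thms)
qed

lemma J_lin2:
  assumes "x \<in> S3 \<times> S3" "J x X = Y"
  shows "J x (lin2 X Y \<zeta>) = lin2 X Y (- snd \<zeta>, fst \<zeta>)"
proof -
  have "J x Y = - X" using assms J_J by blast
  then show ?thesis
    using linear_lin2[OF bounded_linear_J, of x X Y] assms(2) by (simp add: lin2_def)
qed

text \<open>A nontrivial relation between \<open>X\<close> and \<open>J X\<close> forces \<open>X = 0\<close>, since \<open>J\<close> has no real eigenvalue.\<close>

lemma J_holomorphic_immersed_iff:
  assumes D: "open D" and \<phi>: "J_holomorphic D \<phi>" and z: "z \<in> D"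
  shows "immersed_at \<phi> z \<longleftrightarrow> alpha_tilde \<phi> z \<noteq> 0 \<or> beta_tilde \<phi> z \<noteq> 0"
proof -
  have ac: "S3_pair_map D \<phi>" and J: "J (\<phi> z) (du \<phi> z) = dv \<phi> z"
    using \<phi> z by (auto simp: J_holomorphic_iff[OF D])
  have x: "\<phi> z \<in> S3 \<times> S3" using \<phi> z by (auto simp: J_holomorphic_def)
  have n: "norm (fst (\<phi> z)) = 1" "norm (snd (\<phi> z)) = 1"
    using x unfolding S3_times_S3_iff by auto
  have d: "(\<phi> has_derivative lin2 (du \<phi> z) (dv \<phi> z)) (at z)"
    using \<phi> z by (intro smooth_on_has_derivative) (auto simp: J_holomorphic_def)
  have "du \<phi> z = 0" if "lin2 (du \<phi> z) (dv \<phi> z) \<zeta> = 0" "\<zeta> \<noteq> 0" for \<zeta>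
  proof -
    let ?X = "du \<phi> z" and ?Y = "dv \<phi> z"
    have 0: "lin2 ?X ?Y (- snd \<zeta>, fst \<zeta>) = 0"
      using J_lin2[OF x J, of \<zeta>] that(1) linear_0[OF bounded_linear.linear[OF bounded_linear_J]] by simp
    \<comment> \<open>Eliminate \<open>?Y = J ?X\<close> from the relation and from its image under \<open>J\<close>.\<close>
    have "((fst \<zeta>)\<^sup>2 + (snd \<zeta>)\<^sup>2) *\<^sub>R ?X =
        fst \<zeta> *\<^sub>R lin2 ?X ?Y \<zeta> - snd \<zeta> *\<^sub>R lin2 ?X ?Y (- snd \<zeta>, fst \<zeta>)"
      by (simp add: lin2_def power2_eq_square algebra_simps)
    also have "\<dots> = 0" using 0 that(1) by simp
    finally show ?thesis using that(2) by (auto simp: prod_eq_iff sum_power2_eq_zero_iff)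
  qed
  moreover have "dv \<phi> z = 0" if "du \<phi> z = 0"
    using J that linear_0[OF bounded_linear.linear[OF bounded_linear_J]] by metis
  ultimately have "immersed_at \<phi> z \<longleftrightarrow> du \<phi> z \<noteq> 0"
    unfolding immersed_at_iff[OF d]
  proof (intro iffI notI)
    assume "\<forall>\<zeta>. lin2 (du \<phi> z) (dv \<phi> z) \<zeta> = 0 \<longrightarrow> \<zeta> = 0" "du \<phi> z = 0"
    from this(1)[rule_format, of "(1, 0)"] this(2) show False by (simp add: prod_eq_iff)
  qed blast
  also have "\<dots> \<longleftrightarrow> mc_u (\<lambda>z. fst (\<phi> z)) z \<noteq> 0 \<or> mc_u (\<lambda>z. snd (\<phi> z)) z \<noteq> 0"
  proof -
    have "x \<otimes> (0, y) = 0 \<longleftrightarrow> y = 0" if "norm x = 1" for x y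
      using qmul_left_cancel[OF that, of "(0, y)" 0] by (simp add: qm.zero_right prod_eq_iff)
    then show ?thesis using n by (simp add: S3_pair_map_partials(2)[OF ac z] zero_prod_def[symmetric]) (simp add: zero_prod_def)
  qed
  also have "\<dots> \<longleftrightarrow> alpha_tilde \<phi> z \<noteq> 0 \<or> beta_tilde \<phi> z \<noteq> 0"
  proof -
    note T = tilde_components(1,4)[OF ac z J] and C = components_from_tilde(1,3)[OF ac z J]
    have "alpha_tilde \<phi> z = 0 \<and> beta_tilde \<phi> z = 0"
      if "mc_u (\<lambda>z. fst (\<phi> z)) z = 0" "mc_u (\<lambda>z. snd (\<phi> z)) z = 0"
      unfolding T that by simp
    moreover have "mc_u (\<lambda>z. fst (\<phi> z)) z = 0 \<and> mc_u (\<lambda>z. snd (\<phi> z)) z = 0"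
      if "alpha_tilde \<phi> z = 0" "beta_tilde \<phi> z = 0"
      unfolding C that by simp
    ultimately show ?thesis by blast
  qed
  finally show ?thesis .
qed

lemma J_holomorphic_patch_iff:
  assumes D: "open D" and \<phi>: "J_holomorphic D \<phi>"
  shows "almost_complex_patch D \<phi> \<and> isothermal_coords D \<phi> \<longleftrightarrow>
    (\<forall>z\<in>D. alpha_tilde \<phi> z \<noteq> 0 \<or> beta_tilde \<phi> z \<noteq> 0)"
proof -
  have sm: "smooth_on D \<phi>" and im: "\<phi> ` D \<subseteq> S3 \<times> S3"
    and J: "\<And>z. z \<in> D \<Longrightarrow> J (\<phi> z) (du \<phi> z) = dv \<phi> z"
    using \<phi> by (auto simp: J_holomorphic_def)
  have x: "\<phi> z \<in> S3 \<times> S3" if "z \<in> D" for z using im that by blast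
  have "J (\<phi> z) ` range (frechet_derivative \<phi> (at z)) \<subseteq> range (frechet_derivative \<phi> (at z))"
    if z: "z \<in> D" for z
    unfolding frechet_derivative_partials[OF smooth_on_differentiable[OF sm z]]
    using J_lin2[OF x[OF z] J[OF z]] by auto
  moreover have "isothermal_coords D \<phi>"
    unfolding isothermal_coords_def using J nk_metric_J[OF x] by metis
  ultimately show ?thesis
    using J_holomorphic_immersed_iff[OF D \<phi>] sm im by (simp add: almost_complex_patch_def)
qed

lemma patch_is_J_holomorphic:
  "almost_complex_patch D \<phi> \<Longrightarrow> isothermal_coords D \<phi> \<Longrightarrow> J_holomorphic D \<phi>"
  by (simp add: almost_complex_patch_def isothermal_coords_def J_holomorphic_def)

lemma patch_to_H_surface:
  assumes \<psi>: "almost_complex_patch (ball z0 r) \<psi>" "isothermal_coords (ball z0 r) \<psi>"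
  shows "\<exists>\<epsilon>. H_surface (ball z0 r) \<epsilon> \<and> associated (ball z0 r) \<psi> \<epsilon> \<and>
    (\<forall>z\<in>ball z0 r. du \<epsilon> z \<noteq> 0 \<or> dv \<epsilon> z \<noteq> 0) \<and>
    (\<forall>\<epsilon>'. H_surface (ball z0 r) \<epsilon>' \<and> associated (ball z0 r) \<psi> \<epsilon>' \<longleftrightarrow>
      (\<exists>w. \<forall>z\<in>ball z0 r. \<epsilon>' z = \<epsilon> z + w))"
proof -
  note hol = patch_is_J_holomorphic[OF \<psi>]
  note I = tilde_form_integrability[OF open_ball hol]
  obtain \<epsilon> where \<epsilon>: "\<And>z. z \<in> ball z0 r \<Longrightarrow>
      (\<epsilon> has_derivative lin2 (alpha_tilde \<psi> z) (beta_tilde \<psi> z)) (at z)"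
    using closed_form_primitive_on_ball[OF I(1,2,3)] by blast
  note H = primitive_is_H_surface[OF open_ball hol \<epsilon>]
  have "du \<epsilon> z \<noteq> 0 \<or> dv \<epsilon> z \<noteq> 0" if "z \<in> ball z0 r" for z
    using J_holomorphic_patch_iff[OF open_ball hol] \<psi> H(2) that by (simp add: associated_def)
  moreover have "H_surface (ball z0 r) \<epsilon>' \<and> associated (ball z0 r) \<psi> \<epsilon>' \<longleftrightarrow>
      (\<exists>w. \<forall>z\<in>ball z0 r. \<epsilon>' z = \<epsilon> z + w)" for \<epsilon>'
  proof
    assume l: "H_surface (ball z0 r) \<epsilon>' \<and> associated (ball z0 r) \<psi> \<epsilon>'"
    have "((\<lambda>z. \<epsilon>' z - \<epsilon> z) has_derivative (\<lambda>h. 0)) (at z within ball z0 r)" if z: "z \<in> ball z0 r" for z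
      using has_derivative_at_withinI[OF has_derivative_diff[OF
            associated_has_derivative[OF conjunct1[OF l] conjunct2[OF l] z] \<epsilon>[OF z]]]
      by simp
    then have "\<exists>w. \<forall>z\<in>ball z0 r. \<epsilon>' z - \<epsilon> z = w"
      by (intro has_derivative_zero_constant convex_ball)
    then show "\<exists>w. \<forall>z\<in>ball z0 r. \<epsilon>' z = \<epsilon> z + w" by (metis add.commute diff_add_cancel)
  next
    assume "\<exists>w. \<forall>z\<in>ball z0 r. \<epsilon>' z = \<epsilon> z + w"
    then obtain w where w: "\<And>z. z \<in> ball z0 r \<Longrightarrow> \<epsilon> z + w = \<epsilon>' z" by auto
    have "(\<epsilon>' has_derivative lin2 (alpha_tilde \<psi> z) (beta_tilde \<psi> z)) (at z)" if z: "z \<in> ball z0 r" for z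
      by (rule has_derivative_transform_within_open[OF has_derivative_add_const[OF \<epsilon>[OF z]] open_ball z])
        (rule w)
    then show "H_surface (ball z0 r) \<epsilon>' \<and> associated (ball z0 r) \<psi> \<epsilon>'"
      using primitive_is_H_surface[OF open_ball hol, of \<epsilon>'] by simp
  qed
  ultimately show ?thesis using H by blast
qed

text \<open>The coefficients of the candidate forms are those of \<open>components_from_tilde\<close>. For both factors the structure
  equation is a multiple of the H-surface equation.\<close>

lemma H_surface_to_map:
  assumes \<epsilon>: "H_surface (ball z0 r) \<epsilon>"
  obtains \<psi> where "J_holomorphic (ball z0 r) \<psi>" "associated (ball z0 r) \<psi> \<epsilon>"
proof -
  let ?B = "ball z0 r"
  have sm: "smooth_on ?B \<epsilon>" using \<epsilon> by (simp add: H_surface_def)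
  note sm1 = smooth_on_partials[OF open_ball sm]
  \<comment> \<open>The map \<open>p\<close> uses \<open>c = - 1 / 2\<close> and \<open>q\<close> uses \<open>c = 1 / 2\<close>; the structure equation depends on \<open>c\<^sup>2\<close> only.\<close>
  define f where "f c d z = c *\<^sub>R du \<epsilon> z + d *\<^sub>R dv \<epsilon> z" for c d z
  have smf: "smooth_on ?B (f c d)" for c d
    unfolding f_def by (rule smooth_combination[OF open_ball sm1])
  have MC: "dv (f c (- sqrt 3 / 2)) z - du (f (sqrt 3 / 2) c) z
      = 2 *\<^sub>R cross3 (f c (- sqrt 3 / 2) z) (f (sqrt 3 / 2) c z)"
    if z: "z \<in> ball z0 r" and c: "c * c = 1 / 4" for c z
  proof -
    have "dv (f c (- sqrt 3 / 2)) z - du (f (sqrt 3 / 2) c) z = (- sqrt 3 / 2) *\<^sub>R (du (du \<epsilon>) z + dv (dv \<epsilon>) z)"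
      unfolding f_def partials_combination[OF sm1 z] mixed_partials[OF open_ball sm z]
      by (simp add: algebra_simps)
    also have "\<dots> = 2 *\<^sub>R cross3 (du \<epsilon> z) (dv \<epsilon> z)"
      using \<epsilon> z by (simp add: H_surface_def)
    also have "\<dots> = 2 *\<^sub>R ((c * c + 3 / 4) *\<^sub>R cross3 (du \<epsilon> z) (dv \<epsilon> z))"
      by (simp add: c)
    also have "(c * c + 3 / 4) *\<^sub>R cross3 (du \<epsilon> z) (dv \<epsilon> z) = cross3 (f c (- sqrt 3 / 2) z) (f (sqrt 3 / 2) c z)"
      unfolding f_def cross_combination by simp
    finally show ?thesis .
  qed
  obtain p where p: "S3_map ?B p" "\<And>z. z \<in> ?B \<Longrightarrow> mc_u p z = f (- 1 / 2) (- sqrt 3 / 2) z"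
    "\<And>z. z \<in> ?B \<Longrightarrow> mc_v p z = f (sqrt 3 / 2) (- 1 / 2) z"
    by (rule S3_map_exists[OF smf[of "- 1 / 2" "- sqrt 3 / 2"] smf[of "sqrt 3 / 2" "- 1 / 2"]])
      (use MC[of _ "- 1 / 2"] in auto)
  obtain q where q: "S3_map ?B q" "\<And>z. z \<in> ?B \<Longrightarrow> mc_u q z = f (1 / 2) (- sqrt 3 / 2) z"
    "\<And>z. z \<in> ?B \<Longrightarrow> mc_v q z = f (sqrt 3 / 2) (1 / 2) z"
    by (rule S3_map_exists[OF smf[of "1 / 2" "- sqrt 3 / 2"] smf[of "sqrt 3 / 2" "1 / 2"]])
      (use MC[of _ "1 / 2"] in auto)
  define \<psi> where "\<psi> z = (p z, q z)" for z
  have pq: "(\<lambda>z. fst (\<psi> z)) = p" "(\<lambda>z. snd (\<psi> z)) = q" by (auto simp: \<psi>_def)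
  have ac: "S3_pair_map ?B \<psi>" using p(1) q(1) by (simp add: S3_pair_map_def pq)
  have J: "J (\<psi> z) (du \<psi> z) = dv \<psi> z" if z: "z \<in> ?B" for z
    unfolding J_du_eq_dv_iff[OF ac z] pq p(2,3)[OF z] q(2,3)[OF z] f_def
    by (simp add: vec_eq_iff field_simps)
  have "J_holomorphic ?B \<psi>" using ac J by (simp add: J_holomorphic_iff)
  moreover have "associated ?B \<psi> \<epsilon>"
    unfolding associated_def
  proof
    fix z assume z: "z \<in> ?B"
    show "du \<epsilon> z = alpha_tilde \<psi> z \<and> dv \<epsilon> z = beta_tilde \<psi> z"
      unfolding tilde_components(1,4)[OF ac z J[OF z]] pq p(2,3)[OF z] q(2,3)[OF z] f_def
      by (simp add: vec_eq_iff field_simps)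
  qed
  ultimately show ?thesis using that by blast
qed

text \<open>Two maps associated to the same \<open>\<epsilon>\<close> have the same left logarithmic derivatives, and these do not change
  under left translations.\<close>

lemma associated_maps_are_translates:
  assumes \<epsilon>: "H_surface (ball z0 r) \<epsilon>"
    and \<psi>: "J_holomorphic (ball z0 r) \<psi>" "associated (ball z0 r) \<psi> \<epsilon>"
  shows "J_holomorphic (ball z0 r) \<psi>' \<and> associated (ball z0 r) \<psi>' \<epsilon> \<longleftrightarrow>
    (\<exists>a\<in>S3. \<exists>b\<in>S3. \<forall>z\<in>ball z0 r. \<psi>' z = (a \<otimes> fst (\<psi> z), b \<otimes> snd (\<psi> z)))"
proof
  let ?B = "ball z0 r"
  have ac: "S3_pair_map ?B \<psi>" and J: "\<And>z. z \<in> ?B \<Longrightarrow> J (\<psi> z) (du \<psi> z) = dv \<psi> z"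
    using \<psi>(1) by (auto simp: J_holomorphic_iff[OF open_ball])
  {
    assume l: "J_holomorphic ?B \<psi>' \<and> associated ?B \<psi>' \<epsilon>"
    then have ac': "S3_pair_map ?B \<psi>'" and J': "\<And>z. z \<in> ?B \<Longrightarrow> J (\<psi>' z) (du \<psi>' z) = dv \<psi>' z"
      by (auto simp: J_holomorphic_iff[OF open_ball])
    have tilde: "alpha_tilde \<psi>' z = alpha_tilde \<psi> z" "beta_tilde \<psi>' z = beta_tilde \<psi> z"
      if "z \<in> ?B" for z
      using l \<psi>(2) that by (auto simp: associated_def)
    note E = components_from_tilde[OF ac _ J] components_from_tilde[OF ac' _ J']
    have "\<exists>a\<in>S3. \<forall>z\<in>?B. fst (\<psi>' z) = a \<otimes> fst (\<psi> z)"
      by (rule S3_map_unique[OF _ _ convex_ball])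
        (use ac ac' E tilde in \<open>auto simp: S3_pair_map_def\<close>)
    moreover have "\<exists>b\<in>S3. \<forall>z\<in>?B. snd (\<psi>' z) = b \<otimes> snd (\<psi> z)"
      by (rule S3_map_unique[OF _ _ convex_ball])
        (use ac ac' E tilde in \<open>auto simp: S3_pair_map_def\<close>)
    ultimately show "\<exists>a\<in>S3. \<exists>b\<in>S3. \<forall>z\<in>?B. \<psi>' z = (a \<otimes> fst (\<psi> z), b \<otimes> snd (\<psi> z))"
      by (metis prod.collapse)
  }
  assume "\<exists>a\<in>S3. \<exists>b\<in>S3. \<forall>z\<in>?B. \<psi>' z = (a \<otimes> fst (\<psi> z), b \<otimes> snd (\<psi> z))"
  then obtain a b where ab: "norm a = 1" "norm b = 1"
    "\<And>z. z \<in> ?B \<Longrightarrow> fst (\<psi>' z) = a \<otimes> fst (\<psi> z)" "\<And>z. z \<in> ?B \<Longrightarrow> snd (\<psi>' z) = b \<otimes> snd (\<psi> z)"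
    unfolding S3_iff[abs_def] by (metis S3_iff fst_conv snd_conv)
  have S: "S3_map ?B (\<lambda>z. fst (\<psi> z))" "S3_map ?B (\<lambda>z. snd (\<psi> z))" using ac by (auto simp: S3_pair_map_def)
  have t1: "S3_map ?B (\<lambda>z. fst (\<psi>' z))"
    "\<And>z. z \<in> ?B \<Longrightarrow> mc_u (\<lambda>z. fst (\<psi>' z)) z = mc_u (\<lambda>z. fst (\<psi> z)) z"
    "\<And>z. z \<in> ?B \<Longrightarrow> mc_v (\<lambda>z. fst (\<psi>' z)) z = mc_v (\<lambda>z. fst (\<psi> z)) z"
    by (rule S3_map_left_translate[OF S(1) ab(1)]; simp add: ab(3))+
  have t2: "S3_map ?B (\<lambda>z. snd (\<psi>' z))"
    "\<And>z. z \<in> ?B \<Longrightarrow> mc_u (\<lambda>z. snd (\<psi>' z)) z = mc_u (\<lambda>z. snd (\<psi> z)) z"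
    "\<And>z. z \<in> ?B \<Longrightarrow> mc_v (\<lambda>z. snd (\<psi>' z)) z = mc_v (\<lambda>z. snd (\<psi> z)) z"
    by (rule S3_map_left_translate[OF S(2) ab(2)]; simp add: ab(4))+
  have ac': "S3_pair_map ?B \<psi>'" using t1(1) t2(1) by (simp add: S3_pair_map_def)
  have J': "J (\<psi>' z) (du \<psi>' z) = dv \<psi>' z" if z: "z \<in> ?B" for z
    using J[OF z] by (simp add: J_du_eq_dv_iff[OF ac z] J_du_eq_dv_iff[OF ac' z] t1(2,3)[OF z] t2(2,3)[OF z])
  have "alpha_tilde \<psi>' z = alpha_tilde \<psi> z" "beta_tilde \<psi>' z = beta_tilde \<psi> z" if z: "z \<in> ?B" for z
    by (simp_all add: tilde_components(1,2)[OF ac z J[OF z]] tilde_components(1,2)[OF ac' z J'[OF z]]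
        t1(2,3)[OF z] t2(2,3)[OF z])
  then show "J_holomorphic ?B \<psi>' \<and> associated ?B \<psi>' \<epsilon>"
    using ac' J' \<psi>(2) by (simp add: J_holomorphic_iff associated_def)
qed

text \<open>In isothermal coordinates \<open>\<epsilon>_u \<times> \<epsilon>_v\<close> is \<open>E\<close> times the unit normal, and the mean curvature is the normal
  component of the Laplacian divided by \<open>2 E\<close>.\<close>

lemma isothermal_H_surface_mean_curvature:
  assumes \<epsilon>: "H_surface D \<epsilon>" and iso: "isothermal_coords_R3 D \<epsilon>" and z: "z \<in> D"
  shows "immersed_at \<epsilon> z" "mean_curvature \<epsilon> z = - 2 / sqrt 3"
proof -
  let ?X = "du \<epsilon> z" and ?Y = "dv \<epsilon> z"
  define E where "E = ?X \<bullet> ?X"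
  have E: "?Y \<bullet> ?Y = E" "E > 0" "?X \<bullet> ?Y = 0" "?X \<bullet> ?X = E"
    using iso z by (auto simp: isothermal_coords_R3_def E_def)
  have d: "(\<epsilon> has_derivative lin2 ?X ?Y) (at z)"
    using \<epsilon> z by (intro smooth_on_has_derivative) (auto simp: H_surface_def)
  have "\<zeta> = 0" if "lin2 ?X ?Y \<zeta> = 0" for \<zeta>
  proof -
    have "lin2 ?X ?Y \<zeta> \<bullet> ?X = fst \<zeta> * E" "lin2 ?X ?Y \<zeta> \<bullet> ?Y = snd \<zeta> * E"
      using E by (simp_all add: lin2_def inner_add_left inner_add_right inner_commute)
    then show ?thesis using that E(2) by (simp add: prod_eq_iff)
  qed
  then show "immersed_at \<epsilon> z" by (simp add: immersed_at_iff[OF d])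
  have "(norm (cross3 ?X ?Y))\<^sup>2 = (norm ?X)\<^sup>2 * (norm ?Y)\<^sup>2"
    using norm_cross_dot[of ?X ?Y] E(3) by (simp add: power_mult_distrib)
  moreover have "(norm ?X)\<^sup>2 = E" "(norm ?Y)\<^sup>2 = E"
    by (simp_all only: power2_norm_eq_inner E)
  ultimately have "(norm (cross3 ?X ?Y))\<^sup>2 = E\<^sup>2"
    by (simp only: power2_eq_square[of E])
  then have nE: "norm (cross3 ?X ?Y) = E" using E(2) by simp
  have "cross3 ?X ?Y \<bullet> unit_normal \<epsilon> z = E"
    unfolding unit_normal_def sgn_div_norm nE using nE E(2)
    by (simp add: power2_norm_eq_inner[symmetric] power2_eq_square)
  moreover have "du (du \<epsilon>) z + dv (dv \<epsilon>) z = (- 4 / sqrt 3) *\<^sub>R cross3 ?X ?Y"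
    using \<epsilon> z by (simp add: H_surface_def)
  ultimately have "du (du \<epsilon>) z \<bullet> unit_normal \<epsilon> z + dv (dv \<epsilon>) z \<bullet> unit_normal \<epsilon> z = (- 4 / sqrt 3) * E"
    by (metis inner_add_left inner_scaleR_left)
  then have "E * (dv (dv \<epsilon>) z \<bullet> unit_normal \<epsilon> z) + E * (du (du \<epsilon>) z \<bullet> unit_normal \<epsilon> z) = (- 4 / sqrt 3) * E * E"
    by (metis add.commute distrib_left mult.commute)
  then have "mean_curvature \<epsilon> z = ((- 4 / sqrt 3) * E * E) / (2 * (E * E))"
    by (simp add: mean_curvature_def Let_def E)
  then show "mean_curvature \<epsilon> z = - 2 / sqrt 3" using E(2) by simp
qed

text \<open>The pair \<open>\<alpha>~, \<beta>~\<close> arises from \<open>\<alpha>, \<beta>\<close> by rotating the tangent vector of the plane, so both pairs have the same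
  linear dependencies.\<close>

lemma primitive_immersed_iff:
  assumes D: "open D" and \<phi>: "J_holomorphic D \<phi>" and z: "z \<in> D"
    and \<epsilon>: "(\<epsilon> has_derivative lin2 (alpha_tilde \<phi> z) (beta_tilde \<phi> z)) (at z)"
  shows "immersed_at \<epsilon> z \<longleftrightarrow> immersed_at (\<lambda>z. fst (\<phi> z)) z"
proof -
  have ac: "S3_pair_map D \<phi>" using \<phi> by (auto simp: J_holomorphic_iff[OF D])
  then have S: "S3_map D (\<lambda>z. fst (\<phi> z))" by (simp add: S3_pair_map_def)
  let ?a = "alpha \<phi> z" and ?b = "beta \<phi> z"
  have d: "((\<lambda>z. fst (\<phi> z)) has_derivative lin2 (fst (\<phi> z) \<otimes> (0, ?a)) (fst (\<phi> z) \<otimes> (0, ?b))) (at z)"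
    using S3_map_has_derivative[OF S z] S3_pair_map_partials(4,5)[OF ac z] by simp
  have n: "norm (fst (\<phi> z)) = 1" using S z by (simp add: S3_map_def)
  have p: "lin2 (fst (\<phi> z) \<otimes> (0, ?a)) (fst (\<phi> z) \<otimes> (0, ?b)) \<zeta> = 0 \<longleftrightarrow> lin2 ?a ?b \<zeta> = 0" for \<zeta>
  proof -
    have "lin2 (0::real, ?a) (0, ?b) \<zeta> = (0, lin2 ?a ?b \<zeta>)" by (simp add: lin2_def)
    moreover have "fst (\<phi> z) \<otimes> (0, lin2 ?a ?b \<zeta>) = 0 \<longleftrightarrow> (0::real, lin2 ?a ?b \<zeta>) = 0"
      using qmul_left_cancel[OF n, of "(0, lin2 ?a ?b \<zeta>)" 0] by (simp only: qm.zero_right)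
    ultimately show ?thesis
      unfolding qmul_lin2[symmetric] by (simp add: zero_prod_def)
  qed
  \<comment> \<open>For \<open>s = 1\<close> and \<open>s = - 1\<close> these are the rotations by \<open>2\<pi> / 3\<close> and \<open>- 2\<pi> / 3\<close>.\<close>
  define \<rho> where "\<rho> s \<zeta> = ((- 1 / 2) * fst \<zeta> - s * (sqrt 3 / 2) * snd \<zeta>, s * (sqrt 3 / 2) * fst \<zeta> + (- 1 / 2) * snd \<zeta>)"
    for s :: real and \<zeta> :: plane
  have \<rho>: "\<rho> (-1) (\<rho> 1 \<zeta>) = \<zeta>" "\<rho> 1 (\<rho> (-1) \<zeta>) = \<zeta>" "\<rho> s 0 = 0" for \<zeta> s
    by (auto simp: \<rho>_def prod_eq_iff field_simps)
  have t: "lin2 (alpha_tilde \<phi> z) (beta_tilde \<phi> z) \<zeta> = lin2 ?a ?b (\<rho> 1 \<zeta>)" for \<zeta>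
    by (simp add: lin2_def \<rho>_def alpha_tilde_def beta_tilde_def algebra_simps)
  have "(\<forall>\<zeta>. lin2 ?a ?b (\<rho> 1 \<zeta>) = 0 \<longrightarrow> \<zeta> = 0) \<longleftrightarrow> (\<forall>\<zeta>. lin2 ?a ?b \<zeta> = 0 \<longrightarrow> \<zeta> = 0)"
    using \<rho> by metis
  then show ?thesis
    unfolding immersed_at_iff[OF \<epsilon>] immersed_at_iff[OF d] t p .
qed

section \<open>The global primitive on a simply connected surface\<close>

text \<open>The form \<open>q\<^sup>-\<^sup>1dq - p\<^sup>-\<^sup>1dp\<close> on \<open>S3 \<times> S3\<close>.\<close>

definition nk_form :: "quat \<times> quat \<Rightarrow> quat \<times> quat \<Rightarrow> real^3" where
  "nk_form x X = snd (qcnj (snd x) \<otimes> snd X - qcnj (fst x) \<otimes> fst X)"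

lemma bounded_linear_nk_form: "bounded_linear (nk_form x)"
  unfolding nk_form_def
  by (intro bounded_linear_compose[OF bounded_linear_snd] bounded_linear_sub
      bounded_linear_compose[OF qm.bounded_linear_right] bounded_linear_fst bounded_linear_snd)

text \<open>The form of the theorem depends on the map alone and not on the coordinates in which it is written.\<close>

lemma tilde_form_pullback:
  assumes D: "open D" and \<phi>: "J_holomorphic D \<phi>" and z: "z \<in> D"
  shows "lin2 (alpha_tilde \<phi> z) (beta_tilde \<phi> z) \<zeta> = nk_form (\<phi> z) (frechet_derivative \<phi> (at z) \<zeta>)"
proof -
  have ac: "S3_pair_map D \<phi>" and J: "J (\<phi> z) (du \<phi> z) = dv \<phi> z"
    using \<phi> z by (auto simp: J_holomorphic_iff[OF D])
  have n: "norm (fst (\<phi> z)) = 1" "norm (snd (\<phi> z)) = 1"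
    using ac z by (auto simp: S3_pair_map_def S3_map_def)
  have "\<phi> differentiable (at z)"
    using \<phi> z by (auto simp: J_holomorphic_def intro: smooth_on_differentiable)
  then have "nk_form (\<phi> z) (frechet_derivative \<phi> (at z) \<zeta>) =
      lin2 (nk_form (\<phi> z) (du \<phi> z)) (nk_form (\<phi> z) (dv \<phi> z)) \<zeta>"
    by (simp add: frechet_derivative_partials linear_lin2[OF bounded_linear_nk_form])
  moreover have "nk_form (\<phi> z) (du \<phi> z) = alpha_tilde \<phi> z" "nk_form (\<phi> z) (dv \<phi> z) = beta_tilde \<phi> z"
    unfolding tilde_components(1,2)[OF ac z J] S3_pair_map_partials(2,3)[OF ac z] nk_form_def
    by (simp_all add: n)
  ultimately show ?thesis by simp
qed

locale isothermal_surface =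
  fixes M :: "'m::topological_space set" and A :: "'m chart set" and \<phi> :: "'m \<Rightarrow> quat \<times> quat"
  assumes surface: "almost_complex_surface M A \<phi>"
    and isothermal: "\<And>c. c \<in> A \<Longrightarrow> isothermal_coords (coord_dom c) (in_coords c \<phi>)"
begin

abbreviation chart_inv :: "'m chart \<Rightarrow> plane \<Rightarrow> 'm" where
  "chart_inv c \<equiv> inv_into (fst c) (snd c)"

lemma chart:
  assumes "c \<in> A"
  shows "openin (top_of_set M) (fst c)" "open (coord_dom c)"
    "homeomorphism (fst c) (coord_dom c) (snd c) (chart_inv c)"
  using surface assms by (auto simp: almost_complex_surface_def smooth_surface_def)

lemma chart_holomorphic:
  assumes "c \<in> A"
  shows "J_holomorphic (coord_dom c) (in_coords c \<phi>)"
  using surface assms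
  by (intro patch_is_J_holomorphic isothermal) (simp_all add: almost_complex_surface_def)

lemma chart_simps:
  assumes "c \<in> A"
  shows "x \<in> fst c \<Longrightarrow> chart_inv c (snd c x) = x" "x \<in> fst c \<Longrightarrow> snd c x \<in> coord_dom c"
    "z \<in> coord_dom c \<Longrightarrow> snd c (chart_inv c z) = z" "z \<in> coord_dom c \<Longrightarrow> chart_inv c z \<in> fst c"
  using chart(3)[OF assms] by (auto simp: homeomorphism_def)

text \<open>Both sides are pull-backs of the same form \<open>nk_form\<close> by the surface, so the chain rule suffices.\<close>

lemma transition_form:
  assumes c: "c \<in> A" and c': "c' \<in> A" and N: "open N" "N \<subseteq> coord_dom c"
    and N': "\<And>w. w \<in> N \<Longrightarrow> chart_inv c w \<in> fst c'" and z: "z \<in> N"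
  defines "\<tau> \<equiv> in_coords c (snd c')"
  shows "(\<tau> has_derivative frechet_derivative \<tau> (at z)) (at z)"
    "lin2 (alpha_tilde (in_coords c \<phi>) z) (beta_tilde (in_coords c \<phi>) z) \<zeta> =
     lin2 (alpha_tilde (in_coords c' \<phi>) (\<tau> z)) (beta_tilde (in_coords c' \<phi>) (\<tau> z))
       (frechet_derivative \<tau> (at z) \<zeta>)"
proof -
  have zD: "z \<in> coord_dom c" using z N by blast
  have \<tau>: "\<tau> w = snd c' (chart_inv c w)" for w by (simp add: \<tau>_def in_coords_def)
  have "smooth_on (snd c ` (fst c \<inter> fst c')) \<tau>"
    using surface c c' by (auto simp: almost_complex_surface_def smooth_surface_def \<tau>_def)
  moreover have "z \<in> snd c ` (fst c \<inter> fst c')"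
    using chart_simps(3,4)[OF c zD] N'[OF z] by (metis IntI imageI)
  ultimately show d: "(\<tau> has_derivative frechet_derivative \<tau> (at z)) (at z)"
    using smooth_on_differentiable frechet_derivative_works by blast
  have \<tau>D: "\<tau> z \<in> coord_dom c'" using chart_simps(2)[OF c' N'[OF z]] by (simp add: \<tau>)
  have eq: "in_coords c' \<phi> (\<tau> w) = in_coords c \<phi> w" if "w \<in> N" for w
    using chart_simps(1)[OF c' N'[OF that]] by (simp add: \<tau> in_coords_def)
  have D: "(in_coords k \<phi> has_derivative frechet_derivative (in_coords k \<phi>) (at w)) (at w)"
    if "k \<in> A" "w \<in> coord_dom k" for k w
    using chart_holomorphic[OF that(1)] smooth_on_differentiable that(2) frechet_derivative_works
    unfolding J_holomorphic_def by blast
  have "((\<lambda>w. in_coords c' \<phi> (\<tau> w)) has_derivative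
      (\<lambda>h. frechet_derivative (in_coords c' \<phi>) (at (\<tau> z)) (frechet_derivative \<tau> (at z) h))) (at z)"
    by (rule has_derivative_compose[OF d D[OF c' \<tau>D]])
  then have "(in_coords c \<phi> has_derivative
      (\<lambda>h. frechet_derivative (in_coords c' \<phi>) (at (\<tau> z)) (frechet_derivative \<tau> (at z) h))) (at z)"
    by (rule has_derivative_transform_within_open[OF _ N(1) z]) (rule eq)
  then have "frechet_derivative (in_coords c \<phi>) (at z) =
      (\<lambda>h. frechet_derivative (in_coords c' \<phi>) (at (\<tau> z)) (frechet_derivative \<tau> (at z) h))"
    using frechet_derivative_at by metis
  then show "lin2 (alpha_tilde (in_coords c \<phi>) z) (beta_tilde (in_coords c \<phi>) z) \<zeta> =
     lin2 (alpha_tilde (in_coords c' \<phi>) (\<tau> z)) (beta_tilde (in_coords c' \<phi>) (\<tau> z))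
       (frechet_derivative \<tau> (at z) \<zeta>)"
    unfolding tilde_form_pullback[OF chart(2)[OF c] chart_holomorphic[OF c] zD]
      tilde_form_pullback[OF chart(2)[OF c'] chart_holomorphic[OF c'] \<tau>D]
    by (simp add: eq[OF z])
qed

text \<open>Discs are named by a chart, a centre and a radius in the chart; those of radius at most 0 are empty.\<close>

definition discs :: "('m chart \<times> plane \<times> real) set" where
  "discs = {(c, z, r). c \<in> A \<and> ball z r \<subseteq> coord_dom c}"

definition disc :: "'m chart \<times> plane \<times> real \<Rightarrow> 'm set" where
  "disc = (\<lambda>(c, z, r). {x \<in> fst c. snd c x \<in> ball z r})"

lemma ball_primitives:
  obtains e where "\<And>c z r w. (c, z, r) \<in> discs \<Longrightarrow> w \<in> ball z r \<Longrightarrow>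
    (e (c, z, r) has_derivative lin2 (alpha_tilde (in_coords c \<phi>) w) (beta_tilde (in_coords c \<phi>) w)) (at w)"
proof -
  have "\<exists>f. \<forall>w\<in>ball z r.
      (f has_derivative lin2 (alpha_tilde (in_coords c \<phi>) w) (beta_tilde (in_coords c \<phi>) w)) (at w)"
    if "(c, z, r) \<in> discs" for c z r
  proof -
    have c: "c \<in> A" "ball z r \<subseteq> coord_dom c" using that by (auto simp: discs_def)
    have "J_holomorphic (ball z r) (in_coords c \<phi>)"
      using chart_holomorphic[OF c(1)] c(2) chart(2)[OF c(1)]
      by (auto simp: J_holomorphic_iff S3_pair_map_def S3_map_def intro: smooth_on_subset)
    note I = tilde_form_integrability[OF open_ball this]
    show ?thesis using closed_form_primitive_on_ball[OF I(1,2,3)] by metis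
  qed
  then have "\<forall>i\<in>discs. \<exists>f. case i of (c, z, r) \<Rightarrow> \<forall>w\<in>ball z r.
      (f has_derivative lin2 (alpha_tilde (in_coords c \<phi>) w) (beta_tilde (in_coords c \<phi>) w)) (at w)"
    by auto
  then obtain e where "\<forall>i\<in>discs. case i of (c, z, r) \<Rightarrow> \<forall>w\<in>ball z r.
      (e i has_derivative lin2 (alpha_tilde (in_coords c \<phi>) w) (beta_tilde (in_coords c \<phi>) w)) (at w)"
    by (auto dest: bchoice)
  then show ?thesis by (intro that[of e]) auto
qed

lemma disc_openin:
  assumes "(c, z, r) \<in> discs"
  shows "openin (top_of_set M) (disc (c, z, r))"
proof -
  have c: "c \<in> A" using assms by (auto simp: discs_def)
  have "openin (top_of_set (fst c)) (fst c \<inter> snd c -` ball z r)"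
    using chart(3)[OF c] by (intro continuous_openin_preimage_gen open_ball) (auto simp: homeomorphism_def)
  moreover have "fst c \<inter> snd c -` ball z r = disc (c, z, r)" by (auto simp: disc_def)
  ultimately show ?thesis using chart(1)[OF c] openin_trans by metis
qed

lemma disc_path_connected:
  assumes "(c, z, r) \<in> discs"
  shows "path_connected (disc (c, z, r))"
proof -
  have c: "c \<in> A" "ball z r \<subseteq> coord_dom c" using assms by (auto simp: discs_def)
  have "continuous_on (ball z r) (chart_inv c)"
    using chart(3)[OF c(1)] c(2) by (auto simp: homeomorphism_def intro: continuous_on_subset)
  then have "path_connected (chart_inv c ` ball z r)"
    by (intro path_connected_continuous_image convex_imp_path_connected convex_ball)
  moreover have "chart_inv c ` ball z r = disc (c, z, r)"
  proof
    show "chart_inv c ` ball z r \<subseteq> disc (c, z, r)"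
    proof
      fix x assume "x \<in> chart_inv c ` ball z r"
      then obtain w where w: "w \<in> ball z r" "x = chart_inv c w" by blast
      then have "w \<in> coord_dom c" using c(2) by blast
      then show "x \<in> disc (c, z, r)" using chart_simps(3,4)[OF c(1)] w by (simp add: disc_def)
    qed
    show "disc (c, z, r) \<subseteq> chart_inv c ` ball z r"
    proof
      fix x assume "x \<in> disc (c, z, r)"
      then have x: "x \<in> fst c" "snd c x \<in> ball z r" by (simp_all add: disc_def)
      then show "x \<in> chart_inv c ` ball z r"
        using chart_simps(1)[OF c(1) x(1)] by (metis imageI)
    qed
  qed
  ultimately show ?thesis by simp
qed

text \<open>In the first of two charts, the difference of the two primitives has zero derivative by
  \<open>transition_form\<close>, and so it is constant near every point of the overlap.\<close>

lemma local_primitives_discs: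
  assumes e: "\<And>c z r w. (c, z, r) \<in> discs \<Longrightarrow> w \<in> ball z r \<Longrightarrow>
    (e (c, z, r) has_derivative lin2 (alpha_tilde (in_coords c \<phi>) w) (beta_tilde (in_coords c \<phi>) w)) (at w)"
  shows "local_primitives M discs disc (\<lambda>i x. e i (snd (fst i) x))"
proof
  show "openin (top_of_set M) (disc i)" if "i \<in> discs" for i
    using that disc_openin by (cases i) auto
  show "M = (\<Union>i\<in>discs. disc i)"
  proof
    show "(\<Union>i\<in>discs. disc i) \<subseteq> M"
    proof (rule UN_least)
      fix i assume i: "i \<in> discs"
      obtain c z r where "i = (c, z, r)" by (metis prod_cases3)
      then show "disc i \<subseteq> M" using openin_imp_subset[OF disc_openin] i by simp
    qed
    show "M \<subseteq> (\<Union>i\<in>discs. disc i)"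
    proof
      fix x assume "x \<in> M"
      then obtain c where c: "c \<in> A" "x \<in> fst c"
        using surface by (auto simp: almost_complex_surface_def smooth_surface_def)
      obtain r where "r > 0" "ball (snd c x) r \<subseteq> coord_dom c"
        using chart(2)[OF c(1)] chart_simps(2)[OF c] open_contains_ball by blast
      then have "(c, snd c x, r) \<in> discs" "x \<in> disc (c, snd c x, r)"
        using c by (auto simp: discs_def disc_def)
      then show "x \<in> (\<Union>i\<in>discs. disc i)" by blast
    qed
  qed
  fix i assume i: "i \<in> discs"
  show "develops discs disc (\<lambda>i x. e i (snd (fst i) x)) (disc i) (\<lambda>x. x) (\<lambda>x. e i (snd (fst i) x))"
    unfolding develops_def
  proof (intro ballI impI)
    fix x j assume x: "x \<in> disc i" and j: "j \<in> discs" and xj: "x \<in> disc j"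
    obtain c a r where ie: "i = (c, a, r)" by (metis prod_cases3)
    obtain c' a' r' where je: "j = (c', a', r')" by (metis prod_cases3)
    have c: "c \<in> A" "ball a r \<subseteq> coord_dom c" using i by (auto simp: ie discs_def)
    have c': "c' \<in> A" "ball a' r' \<subseteq> coord_dom c'" using j by (auto simp: je discs_def)
    have xc: "x \<in> fst c" "snd c x \<in> ball a r" using x by (auto simp: ie disc_def)
    \<comment> \<open>The overlap of the two discs, seen in the first chart.\<close>
    define N where "N = ball a r \<inter> (coord_dom c \<inter> chart_inv c -` disc j)"
    have "openin (top_of_set (coord_dom c)) (coord_dom c \<inter> chart_inv c -` disc j)"
    proof (rule continuous_openin_preimage)
      show "continuous_on (coord_dom c) (chart_inv c)" using chart(3)[OF c(1)] by (simp add: homeomorphism_def)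
      show "chart_inv c \<in> coord_dom c \<rightarrow> M"
        using chart_simps(4)[OF c(1)] openin_imp_subset[OF chart(1)[OF c(1)]] by blast
      show "openin (top_of_set M) (disc j)" using disc_openin j je by blast
    qed
    then have N: "open N" unfolding N_def
      using chart(2)[OF c(1)] by (auto simp: openin_open_eq)
    have xN: "snd c x \<in> N"
      using xc xj chart_simps(1,2)[OF c(1) xc(1)] by (simp add: N_def)
    then obtain s where s: "s > 0" "ball (snd c x) s \<subseteq> N" using N open_contains_ball by blast
    have Nj: "chart_inv c w \<in> fst c'" "snd c' (chart_inv c w) \<in> ball a' r'" if "w \<in> N" for w
      using that by (auto simp: N_def je disc_def)
    have NN: "N \<subseteq> coord_dom c" by (auto simp: N_def)
    define \<tau> where "\<tau> = in_coords c (snd c')"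
    have \<tau>: "\<tau> w = snd c' (chart_inv c w)" for w by (simp add: \<tau>_def in_coords_def)
    have "((\<lambda>w. e i w - e j (\<tau> w)) has_derivative (\<lambda>h. 0)) (at w within ball (snd c x) s)"
      if "w \<in> ball (snd c x) s" for w
    proof -
      have w: "w \<in> N" using that s by blast
      have tr: "(\<tau> has_derivative frechet_derivative \<tau> (at w)) (at w)"
        "lin2 (alpha_tilde (in_coords c \<phi>) w) (beta_tilde (in_coords c \<phi>) w) \<zeta> =
         lin2 (alpha_tilde (in_coords c' \<phi>) (\<tau> w)) (beta_tilde (in_coords c' \<phi>) (\<tau> w))
           (frechet_derivative \<tau> (at w) \<zeta>)" for \<zeta>
        unfolding \<tau>_def by (rule transition_form[OF c(1) c'(1) N NN Nj(1) w]; assumption)+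
      have i': "(e i has_derivative lin2 (alpha_tilde (in_coords c \<phi>) w) (beta_tilde (in_coords c \<phi>) w)) (at w)"
        unfolding ie by (rule e) (use i ie w N_def in auto)
      have "(e j has_derivative lin2 (alpha_tilde (in_coords c' \<phi>) (\<tau> w))
          (beta_tilde (in_coords c' \<phi>) (\<tau> w))) (at (\<tau> w))"
        unfolding je by (rule e) (use j je Nj(2)[OF w] \<tau> in auto)
      from has_derivative_compose[OF tr(1) this]
      have "((\<lambda>w. e j (\<tau> w)) has_derivative
          lin2 (alpha_tilde (in_coords c \<phi>) w) (beta_tilde (in_coords c \<phi>) w)) (at w)"
        unfolding tr(2)[symmetric] .
      from has_derivative_at_withinI[OF has_derivative_diff[OF i' this]]
      show ?thesis by simp
    qed
    then have "\<exists>k. \<forall>w\<in>ball (snd c x) s. e i w - e j (\<tau> w) = k"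
      by (intro has_derivative_zero_constant convex_ball)
    then have const: "e i w - e j (\<tau> w) = e i (snd c x) - e j (\<tau> (snd c x))"
      if "w \<in> ball (snd c x) s" for w using that s(1) by fastforce
    have "continuous_on (disc i) (snd c)"
      using chart(3)[OF c(1)] by (auto simp: homeomorphism_def ie disc_def intro: continuous_on_subset)
    then have "(snd c \<longlongrightarrow> snd c x) (at x within disc i)"
      using x by (simp add: continuous_on_def)
    then have "\<forall>\<^sub>F y in at x within disc i. snd c y \<in> ball (snd c x) s"
      by (rule topological_tendstoD) (use s in auto)
    moreover have "\<forall>\<^sub>F y in at x within disc i. y \<in> disc i"
      by (simp add: eventually_at_filter)
    ultimately show "\<forall>\<^sub>F y in at x within disc i. e i (snd (fst i) y) - e i (snd (fst i) x) =
        e j (snd (fst j) y) - e j (snd (fst j) x)"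
    proof eventually_elim
      case (elim y)
      have yc: "y \<in> fst c" using elim(2) by (simp add: ie disc_def)
      have "e i (snd c y) - e j (snd c' y) = e i (snd c x) - e j (snd c' x)"
        using const[OF elim(1)] chart_simps(1)[OF c(1) yc] chart_simps(1)[OF c(1) xc(1)] by (simp add: \<tau>)
      then show ?case by (simp add: ie je algebra_simps)
    qed
  qed
qed

lemma global_H_surface:
  assumes "simply_connected M"
  shows "\<exists>\<epsilon>::'m \<Rightarrow> real^3. smooth_map A \<epsilon> \<and>
    (\<forall>c\<in>A. associated (coord_dom c) (in_coords c \<phi>) (in_coords c \<epsilon>) \<and>
      H_surface (coord_dom c) (in_coords c \<epsilon>) \<and>
      (\<forall>z\<in>coord_dom c. immersed_at (in_coords c \<epsilon>) z \<longleftrightarrow> immersed_at (in_coords c (\<lambda>x. fst (\<phi> x))) z))"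
proof -
  obtain e where e: "\<And>c z r w. (c, z, r) \<in> discs \<Longrightarrow> w \<in> ball z r \<Longrightarrow>
    (e (c, z, r) has_derivative lin2 (alpha_tilde (in_coords c \<phi>) w) (beta_tilde (in_coords c \<phi>) w)) (at w)"
    using ball_primitives by metis
  interpret local_primitives M discs disc "\<lambda>i x. e i (snd (fst i) x)"
    using local_primitives_discs[OF e] .
  have "path_connected (disc i)" if "i \<in> discs" for i
    using that disc_path_connected by (cases i) auto
  then obtain \<epsilon> where \<epsilon>: "\<And>i x y. i \<in> discs \<Longrightarrow> x \<in> disc i \<Longrightarrow> y \<in> disc i \<Longrightarrow>
      \<epsilon> y - \<epsilon> x = e i (snd (fst i) y) - e i (snd (fst i) x)"
    using global_primitive[OF assms] by blast
  have d: "(in_coords c \<epsilon> has_derivative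
      lin2 (alpha_tilde (in_coords c \<phi>) z) (beta_tilde (in_coords c \<phi>) z)) (at z)"
    if c: "c \<in> A" and z: "z \<in> coord_dom c" for c z
  proof -
    obtain r where r: "r > 0" "ball z r \<subseteq> coord_dom c"
      using chart(2)[OF c] z open_contains_ball by blast
    have i: "(c, z, r) \<in> discs" using c r by (simp add: discs_def)
    have z': "z \<in> ball z r" using r by simp
    have "e (c, z, r) w + (in_coords c \<epsilon> z - e (c, z, r) z) = in_coords c \<epsilon> w" if w: "w \<in> ball z r" for w
    proof -
      have m: "chart_inv c v \<in> disc (c, z, r)" "snd c (chart_inv c v) = v" if "v \<in> ball z r" for v
        using that r(2) chart_simps(3,4)[OF c, of v] by (auto simp: disc_def)
      have "\<epsilon> (chart_inv c w) - \<epsilon> (chart_inv c z) = e (c, z, r) w - e (c, z, r) z"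
        using \<epsilon>[OF i m(1)[OF z'] m(1)[OF w]] m(2)[OF z'] m(2)[OF w] by simp
      then show ?thesis by (simp add: in_coords_def algebra_simps)
    qed
    then show ?thesis
      by (rule has_derivative_transform_within_open[OF has_derivative_add_const[OF e[OF i z']] open_ball z'])
  qed
  have "smooth_map A \<epsilon>"
    unfolding smooth_map_def
    using smooth_on_lin2I[OF chart(2) d] tilde_form_integrability(1,2)[OF chart(2) chart_holomorphic] by blast
  moreover have "associated (coord_dom c) (in_coords c \<phi>) (in_coords c \<epsilon>) \<and>
      H_surface (coord_dom c) (in_coords c \<epsilon>)" if "c \<in> A" for c
    using primitive_is_H_surface[OF chart(2)[OF that] chart_holomorphic[OF that] d[OF that]] by blast
  moreover have "immersed_at (in_coords c \<epsilon>) z \<longleftrightarrow> immersed_at (in_coords c (\<lambda>x. fst (\<phi> x))) z"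
    if "c \<in> A" "z \<in> coord_dom c" for c z
  proof -
    have "in_coords c (\<lambda>x. fst (\<phi> x)) = (\<lambda>z. fst (in_coords c \<phi> z))"
      by (auto simp: in_coords_def)
    then show ?thesis
      using primitive_immersed_iff[OF chart(2)[OF that(1)] chart_holomorphic[OF that(1)] that(2) d[OF that]] by simp
  qed
  ultimately show ?thesis by blast
qed

end

theorem mainTheorem2:
  fixes M :: "'m::topological_space set"
    and A :: "'m chart set"
    and \<phi> :: "'m \<Rightarrow> quat \<times> quat"
  assumes "almost_complex_surface M A \<phi>"
    and "\<And>c. c \<in> A \<Longrightarrow> isothermal_coords (coord_dom c) (in_coords c \<phi>)"
  shows "(\<forall>c\<in>A. closed_form (coord_dom c)
           (alpha_tilde (in_coords c \<phi>)) (beta_tilde (in_coords c \<phi>))) \<and>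
         (simply_connected M \<longrightarrow>
           (\<exists>\<epsilon>::'m \<Rightarrow> real^3. smooth_map A \<epsilon> \<and>
             (\<forall>c\<in>A. associated (coord_dom c) (in_coords c \<phi>) (in_coords c \<epsilon>) \<and>
                    H_surface (coord_dom c) (in_coords c \<epsilon>) \<and>
                    (\<forall>z\<in>coord_dom c. immersed_at (in_coords c \<epsilon>) z \<longleftrightarrow>
                                      immersed_at (in_coords c (\<lambda>x. fst (\<phi> x))) z)))) \<and>
         (\<forall>(z0::plane) (r::real) \<psi>.
           almost_complex_patch (ball z0 r) \<psi> \<and> isothermal_coords (ball z0 r) \<psi> \<longrightarrow>
           (\<exists>\<epsilon>. H_surface (ball z0 r) \<epsilon> \<and> associated (ball z0 r) \<psi> \<epsilon> \<and>
                (\<forall>z\<in>ball z0 r. du \<epsilon> z \<noteq> 0 \<or> dv \<epsilon> z \<noteq> 0) \<and>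
                (\<forall>\<epsilon>'. H_surface (ball z0 r) \<epsilon>' \<and> associated (ball z0 r) \<psi> \<epsilon>' \<longleftrightarrow>
                      (\<exists>w. \<forall>z\<in>ball z0 r. \<epsilon>' z = \<epsilon> z + w)))) \<and>
         (\<forall>(z0::plane) (r::real) \<epsilon>.
           H_surface (ball z0 r) \<epsilon> \<longrightarrow>
           (\<exists>\<psi>. J_holomorphic (ball z0 r) \<psi> \<and> associated (ball z0 r) \<psi> \<epsilon> \<and>
                (almost_complex_patch (ball z0 r) \<psi> \<and> isothermal_coords (ball z0 r) \<psi> \<longleftrightarrow>
                   (\<forall>z\<in>ball z0 r. du \<epsilon> z \<noteq> 0 \<or> dv \<epsilon> z \<noteq> 0)) \<and>
                (\<forall>\<psi>'. J_holomorphic (ball z0 r) \<psi>' \<and> associated (ball z0 r) \<psi>' \<epsilon> \<longleftrightarrow>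
                      (\<exists>a\<in>S3. \<exists>b\<in>S3. \<forall>z\<in>ball z0 r.
                          \<psi>' z = (a \<otimes> fst (\<psi> z), b \<otimes> snd (\<psi> z)))))) \<and>
         (\<forall>(D::plane set) \<epsilon>.
           open D \<and> H_surface D \<epsilon> \<and> isothermal_coords_R3 D \<epsilon> \<longrightarrow>
           (\<forall>z\<in>D. immersed_at \<epsilon> z \<and> mean_curvature \<epsilon> z = - 2 / sqrt 3))"
proof -
  interpret isothermal_surface M A \<phi>
    using assms by unfold_locales
  have closed: "closed_form (coord_dom c) (alpha_tilde (in_coords c \<phi>)) (beta_tilde (in_coords c \<phi>))"
    if "c \<in> A" for c
    using tilde_form_integrability[OF chart(2)[OF that] chart_holomorphic[OF that]]
    by (simp add: closed_form_def)
  have inverse: "\<exists>\<psi>. J_holomorphic (ball z0 r) \<psi> \<and> associated (ball z0 r) \<psi> \<epsilon> \<and>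
      (almost_complex_patch (ball z0 r) \<psi> \<and> isothermal_coords (ball z0 r) \<psi> \<longleftrightarrow>
         (\<forall>z\<in>ball z0 r. du \<epsilon> z \<noteq> 0 \<or> dv \<epsilon> z \<noteq> 0)) \<and>
      (\<forall>\<psi>'. J_holomorphic (ball z0 r) \<psi>' \<and> associated (ball z0 r) \<psi>' \<epsilon> \<longleftrightarrow>
         (\<exists>a\<in>S3. \<exists>b\<in>S3. \<forall>z\<in>ball z0 r. \<psi>' z = (a \<otimes> fst (\<psi> z), b \<otimes> snd (\<psi> z))))"
    if H: "H_surface (ball z0 r) \<epsilon>" for z0 r \<epsilon>
  proof -
    obtain \<psi> where \<psi>: "J_holomorphic (ball z0 r) \<psi>" "associated (ball z0 r) \<psi> \<epsilon>"
      using H_surface_to_map[OF H] .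
    have "almost_complex_patch (ball z0 r) \<psi> \<and> isothermal_coords (ball z0 r) \<psi> \<longleftrightarrow>
        (\<forall>z\<in>ball z0 r. du \<epsilon> z \<noteq> 0 \<or> dv \<epsilon> z \<noteq> 0)"
      using J_holomorphic_patch_iff[OF open_ball \<psi>(1)] \<psi>(2) by (simp add: associated_def)
    then show ?thesis using \<psi> associated_maps_are_translates[OF H \<psi>] by blast
  qed
  show ?thesis
    by (intro conjI allI impI ballI; (elim conjE)?;
      (rule closed global_H_surface patch_to_H_surface inverse isothermal_H_surface_mean_curvature; assumption))
qed

end
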